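(* Let $1\le k\le n$, let $\mathbb{H}^n=\mathbb{W}\rtimes\mathbb{V}$ be a semidirect factorization of the Heisenberg group with $\mathbb{W}$ a vertical subgroup and $\mathbb{V}$ a $k$-dimensional horizontal subgroup, and let $d$ be a homogeneous distance on $\mathbb{H}^n$. Let $\Sigma\subset\mathbb{H}^n$ be a parametrized $\mathbb{H}$-regular surface with respect to $(\mathbb{W},\mathbb{V})$ with parametrization $\phi:U\to\mathbb{V}$ ($U\subset\mathbb{W}$ open), and let $\Phi(n)=n\phi(n)$ be the graph map. If $\mathbb{W}$ is orthogonal to $\mathbb{V}$, then for every Borel set $B\subset\Sigma$ $$\int_{\Phi^{-1}(B)}J^\phi\phi(w)\,d\mathcal{H}^{2n+1-k}_E(w)=\int_B\beta_d(\mathrm{Tan}(\Sigma,x))\,d\mathcal{S}^{2n+2-k}(x),$$ where $J^\phi\phi$ is the intrinsic Jacobian of $\phi$.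
   Context: Heisenberg group: $\mathbb{H}^n=H_1\oplus H_2$ is a real vector space, $\dim H_1=2n$, $\dim H_2=1$, with a symplectic form $\omega$ on $H_1$ and a fixed $0\ne e_{2n+1}\in H_2$; $\pi_{H_1}$ is the projection on $H_1$, $[p,q]=\omega(\pi_{H_1}p,\pi_{H_1}q)e_{2n+1}$ and $pq=p+q+\frac12[p,q]$ (identity $0$). Dilations: $\delta_t$ is linear with $\delta_t w=t^iw$ for $w\in H_i$, $t>0$. Fix a basis $(e_1,\dots,e_{2n})$ of $H_1$ with $\omega(e_i,e_{n+j})=\delta_{ij}$, $\omega(e_i,e_j)=\omega(e_{n+i},e_{n+j})=0$ for $1\le i,j\le n$, and the scalar product $\langle\cdot,\cdot\rangle$ making $(e_1,\dots,e_{2n+1})$ orthonormal; this identifies $\mathbb{H}^n$ with $\mathbb{R}^{2n+1}$. A Heisenberg basis is any orthonormal basis of $\mathbb{H}^n$ of the form $(v_1,\dots,v_n,w_1,\dots,w_n,e_{2n+1})$ with $v_i,w_i\in H_1$, $\omega(v_i,w_j)=\delta_{ij}$, $\omega(v_i,v_j)=\omega(w_i,w_j)=0$. $\mathcal{H}^p_E$ is the $p$-dimensional Hausdorff measure for the Euclidean distance (normalized to agree with Lebesgue measure on $p$-dimensional subspaces). $\|\cdot\|_g$ and orthogonality refer to $\langle\cdot,\cdot\rangle$. A homogeneous distance $d$ is a distance with $d(zx,zy)=d(x,y)$ and $d(\delta_tx,\delta_ty)=t\,d(x,y)$; $\|x\|=d(x,0)$; $\mathbb{B}(x,r)=\{y:d(x,y)\le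 r\}$. Homogeneous subgroups are Lie subgroups closed under all $\delta_t$; vertical ones contain $H_2$, horizontal ones are contained in $H_1$. $\mathbb{H}^n=\mathbb{W}\rtimes\mathbb{V}$ means $\mathbb{W}$ vertical, $\mathbb{V}$ horizontal, $\mathbb{H}^n=\mathbb{W}\mathbb{V}$, $\mathbb{W}\cap\mathbb{V}=\{0\}$; then $x=\pi_{\mathbb{W}}(x)\pi_{\mathbb{V}}(x)$ uniquely. An h-homomorphism is a homogeneous (commuting with dilations) group homomorphism; on $\mathbb{R}^k$ dilations are $y\mapsto ty$. For $\Omega\subset\mathbb{H}^n$ open, $f\in C^1_h(\Omega,\mathbb{R}^k)$ means that at each $x\in\Omega$ there is an h-homomorphism $Df(x):\mathbb{H}^n\to\mathbb{R}^k$ with $|f(xw)-f(x)-Df(x)(w)|=o(\|w\|)$ as $w\to0$, and $x\mapsto Df(x)$ is continuous; $\nabla_Hf_i(x)\in H_1$ is given by $Df_i(x)(z)=\langle\nabla_Hf_i(x),z\rangle$ for all $z$. $\Sigma$ is a ($k$-codimensional) $\mathbb{H}$-regular surface if each $x\in\Sigma$ has an open neighbourhood $\Omega_x$ and $h\in C^1_h(\Omega_x,\mathbb{R}^k)$ with $\Sigma\cap\Omega_x=\{h=0\}$ and $\nabla_Hh_1\wedge\cdots\wedge\nabla_Hh_k\neq0$ on $\Omega_x$. For $\phi:U\to\mathbb{V}$, $U\subset\mathbb{W}$ open, $x\in\mathbb{H}^n$: $\sigma_x(w)=xw\,\pi_{\mathbb{V}}(x)^{-1}$ on $\mathbb{W}$,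 and $\phi_x(w)=\pi_{\mathbb{V}}(x)\phi(\sigma_{x^{-1}}(w))$ for $w\in\sigma_x(U)$. With $\Phi(w)=w\phi(w)$, $\phi$ is intrinsic differentiable at $\bar w\in U$, with intrinsic differential the (unique) h-homomorphism $d\phi_{\bar w}:\mathbb{W}\to\mathbb{V}$, if $d(d\phi_{\bar w}(w),\phi_{\Phi(\bar w)^{-1}}(w))=o(\|w\|)$ as $w\to0$; it is uniformly intrinsic differentiable on $U$ if for each $\bar w\in U$ there is an h-homomorphism $d\phi_{\bar w}$ with $\lim_{\delta\to0}\sup_{\|\bar w^{-1}w'\|<\delta}\sup_{0<\|w\|<\delta}d(d\phi_{\bar w}(w),\phi_{\Phi(w')^{-1}}(w))/\|w\|=0$. An $\mathbb{H}$-regular surface $\Sigma$ is a parametrized $\mathbb{H}$-regular surface with respect to $(\mathbb{W},\mathbb{V})$, with parametrization $\phi$, if $\mathbb{H}^n=\mathbb{W}\rtimes\mathbb{V}$ and $\Sigma=\{u\phi(u):u\in U\}$ with $U\subset\mathbb{W}$ open and $\phi:U\to\mathbb{V}$ uniformly intrinsic differentiable. Intrinsic Jacobian (for $\mathbb{W}\perp\mathbb{V}$): fix a Heisenberg basis $(v_1,\dots,v_n,w_1,\dots,w_n,e_{2n+1})$ with $\mathbb{V}=\mathrm{span}(v_1,\dots,v_k)$ and $\mathbb{W}=\mathrm{span}(v_{k+1},\dots,v_n,w_1,\dots,w_n,e_{2n+1})$. Identify $\mathbb{V}\cong\mathbb{R}^k$ through $(v_1,\dots,v_k)$ and $\mathbb{W}\cong\mathbb{R}^{2n+1-k}$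 by giving $ze_{2n+1}+\sum_{i=k+1}^n(x_iv_i+y_iw_i)+\sum_{i=1}^k\eta_iw_i$ the coordinates $(x_{k+1},\dots,x_n,\eta_1,\dots,\eta_k,y_{k+1},\dots,y_n,z)$. An h-homomorphism $\mathbb{W}\to\mathbb{V}$ is then given by a $k\times(2n-k)$ matrix acting on the first $2n-k$ coordinates. Let $D^\phi\phi(\bar w)$ be the matrix of $d\phi_{\bar w}$; its $(i,j)$ entry is denoted $\partial^{\phi_j}\phi_i(\bar w)$ (for uniformly intrinsic differentiable $\phi$ it is the derivative at $t=0$ of $\phi_i$ along any integral curve through $\bar w$ of the $j$-th vector field of the list: the left invariant fields $\partial_{x_i}-\frac12y_i\partial_z$, $i=k+1,\dots,n$; $\partial_{\eta_i}+\phi_i\partial_z$, $i=1,\dots,k$; $\partial_{y_i}+\frac12x_i\partial_z$, $i=k+1,\dots,n$). Then $$J^\phi\phi(\bar w)=\sqrt{1+\sum_{\ell=1}^k\sum_{I}M_I^\phi(\bar w)^2},$$ where the inner sum is over all $\ell\times\ell$ minors $M_I^\phi(\bar w)$ of $D^\phi\phi(\bar w)$ (choices of $\ell$ rows among $k$ and $\ell$ columns among $2n-k$). Tangent cone: $\mathrm{Tan}(\Sigma,x)$ is the set of limits $\lim_h\delta_{r_h}(x^{-1}x_h)$ with $r_h>0$, $x_h\in\Sigma$, $x_h\to x$ (for these surfaces it is a $(2n+1-k)$-dimensional vertical subgroup). Spherical factor of a $p$-dimensional linear subspace $\Pi$: $\beta_d(\Pi)=\max_{z\in\mathbb{B}(0,1)}\mathcal{H}^p_E(\Pi\cap\mathbb{B}(z,1))$.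 Spherical measure: $\mathcal{S}^\alpha(A)=\sup_{\delta>0}\inf\{\sum_j2^{-\alpha}\mathrm{diam}(B_j)^\alpha: A\subset\bigcup_jB_j,\ B_j\text{ closed }d\text{-balls},\ \mathrm{diam}(B_j)\le\delta\}$. *)

theory Defs
  imports
    "HOL-Analysis.Analysis"
    "Jordan_Normal_Form.Determinant"
    "Jordan_Normal_Form.DL_Submatrix"
begin

text \<open>
  Throughout, \<open>n = CARD('n)\<close> and the Heisenberg group is \<open>\<real>\<^sup>n \<times> \<real>\<^sup>n \<times> \<real>\<close>, identified through the fixed
  symplectic basis: \<open>(x, y, z)\<close> stands for \<open>x\<^sub>1 e\<^sub>1 + \<dots> + x\<^sub>n e\<^sub>n + y\<^sub>1 e\<^sub>n\<^sub>+\<^sub>1 + \<dots> + y\<^sub>n e\<^sub>2\<^sub>n + z e\<^sub>2\<^sub>n\<^sub>+\<^sub>1\<close>.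
  The library inner product of this product type is the scalar product that makes
  \<open>e\<^sub>1, \<dots>, e\<^sub>2\<^sub>n\<^sub>+\<^sub>1\<close> orthonormal.
\<close>

type_synonym 'n heis = "(real ^ 'n) \<times> (real ^ 'n) \<times> real"

section \<open>The Heisenberg group\<close>

definition H1 :: "'n::finite heis set" where
  "H1 = {(x, y, z). z = 0}"

definition H2 :: "'n::finite heis set" where
  "H2 = {(x, y, z). x = 0 \<and> y = 0}"

definition e_last :: "'n::finite heis" where
  "e_last = (0, 0, 1)"

definition proj_H1 :: "'n::finite heis \<Rightarrow> 'n heis" where
  "proj_H1 = (\<lambda>(x, y, z). (x, y, 0))"

text \<open>The symplectic form on \<open>H1\<close>; the third component of the arguments is ignored.\<close>

definition omega :: "'n::finite heis \<Rightarrow> 'n heis \<Rightarrow> real" where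
  "omega = (\<lambda>(x, y, z) (x', y', z'). inner x y' - inner y x')"

definition bracket :: "'n::finite heis \<Rightarrow> 'n heis \<Rightarrow> 'n heis" where
  "bracket p q = omega (proj_H1 p) (proj_H1 q) *\<^sub>R e_last"

definition hmul :: "'n::finite heis \<Rightarrow> 'n heis \<Rightarrow> 'n heis" (infixl "\<cdot>" 70) where
  "p \<cdot> q = p + q + (1 / 2) *\<^sub>R bracket p q"

definition hinv :: "'n::finite heis \<Rightarrow> 'n heis" where
  "hinv p = - p"

definition dil :: "real \<Rightarrow> 'n::finite heis \<Rightarrow> 'n heis" where
  "dil t = (\<lambda>(x, y, z). (t *\<^sub>R x, t *\<^sub>R y, t\<^sup>2 * z))"

text \<open>
  A homogeneous distance on the Heisenberg group automatically induces the Euclidean topology, so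
  open sets, Borel sets and limits below are those of the underlying Euclidean space.
\<close>

definition homogeneous_distance :: "('n::finite heis \<Rightarrow> 'n heis \<Rightarrow> real) \<Rightarrow> bool" where
  "homogeneous_distance d \<longleftrightarrow>
     Metric_space UNIV d \<and>
     (\<forall>x y z. d (z \<cdot> x) (z \<cdot> y) = d x y) \<and>
     (\<forall>t x y. t > 0 \<longrightarrow> d (dil t x) (dil t y) = t * d x y)"

definition hnorm :: "('n::finite heis \<Rightarrow> 'n heis \<Rightarrow> real) \<Rightarrow> 'n heis \<Rightarrow> real" where
  "hnorm d x = d x 0"

definition hcball :: "('n::finite heis \<Rightarrow> 'n heis \<Rightarrow> real) \<Rightarrow> 'n heis \<Rightarrow> real \<Rightarrow> 'n heis set" where
  "hcball d x r = {y. d x y \<le> r}"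

section \<open>Homogeneous subgroups and semidirect factorizations\<close>

text \<open>Lie subgroups are taken to be the closed subgroups. (For subgroups that are invariant under
  dilations closedness is in fact automatic.)\<close>

definition homogeneous_subgroup :: "'n::finite heis set \<Rightarrow> bool" where
  "homogeneous_subgroup S \<longleftrightarrow>
     0 \<in> S \<and> (\<forall>p\<in>S. \<forall>q\<in>S. p \<cdot> q \<in> S) \<and> (\<forall>p\<in>S. hinv p \<in> S) \<and> closed S \<and>
     (\<forall>t>0. \<forall>p\<in>S. dil t p \<in> S)"

definition vertical_subgroup :: "'n::finite heis set \<Rightarrow> bool" where
  "vertical_subgroup S \<longleftrightarrow> homogeneous_subgroup S \<and> H2 \<subseteq> S"

definition horizontal_subgroup :: "'n::finite heis set \<Rightarrow> bool" where
  "horizontal_subgroup S \<longleftrightarrow> homogeneous_subgroup S \<and> S \<subseteq> H1"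

definition semidirect :: "'n::finite heis set \<Rightarrow> 'n heis set \<Rightarrow> bool" where
  "semidirect W V \<longleftrightarrow>
     vertical_subgroup W \<and> horizontal_subgroup V \<and>
     {w \<cdot> v | w v. w \<in> W \<and> v \<in> V} = UNIV \<and> W \<inter> V = {0}"

definition proj_W :: "'n::finite heis set \<Rightarrow> 'n heis set \<Rightarrow> 'n heis \<Rightarrow> 'n heis" where
  "proj_W W V x = (THE w. w \<in> W \<and> (\<exists>v\<in>V. x = w \<cdot> v))"

definition proj_V :: "'n::finite heis set \<Rightarrow> 'n heis set \<Rightarrow> 'n heis \<Rightarrow> 'n heis" where
  "proj_V W V x = (THE v. v \<in> V \<and> (\<exists>w\<in>W. x = w \<cdot> v))"

definition h_homomorphism ::
    "'n::finite heis set \<Rightarrow> 'n heis set \<Rightarrow> ('n heis \<Rightarrow> 'n heis) \<Rightarrow> bool" where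
  "h_homomorphism W V L \<longleftrightarrow>
     (\<forall>w\<in>W. L w \<in> V) \<and> (\<forall>w\<in>W. \<forall>w'\<in>W. L (w \<cdot> w') = L w \<cdot> L w') \<and>
     (\<forall>t>0. \<forall>w\<in>W. L (dil t w) = dil t (L w))"

section \<open>Regular surfaces\<close>

text \<open>Points of \<open>\<real>\<^sup>k\<close> are functions \<open>nat \<Rightarrow> real\<close> of which only the components with index \<open>< k\<close>
  matter (indices start at 0); \<open>L2_set\<close> gives the Euclidean norm.\<close>

definition h_homomorphism_Rk :: "nat \<Rightarrow> ('n::finite heis \<Rightarrow> nat \<Rightarrow> real) \<Rightarrow> bool" where
  "h_homomorphism_Rk k L \<longleftrightarrow>
     (\<forall>p q. \<forall>i<k. L (p \<cdot> q) i = L p i + L q i) \<and>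
     (\<forall>t>0. \<forall>p. \<forall>i<k. L (dil t p) i = t * L p i)"

text \<open>\<open>C1_h d k \<Omega> f Df\<close>: the map \<open>f\<close> belongs to \<open>C\<^sup>1\<^sub>h(\<Omega>, \<real>\<^sup>k)\<close> and \<open>Df\<close> is its differential. The
  h-homomorphisms into \<open>\<real>\<^sup>k\<close> form a finite-dimensional vector space, so continuity of
  \<open>x \<mapsto> Df x\<close> is pointwise continuity.\<close>

definition C1_h ::
    "('n::finite heis \<Rightarrow> 'n heis \<Rightarrow> real) \<Rightarrow> nat \<Rightarrow> 'n heis set \<Rightarrow> ('n heis \<Rightarrow> nat \<Rightarrow> real) \<Rightarrow>
      ('n heis \<Rightarrow> 'n heis \<Rightarrow> nat \<Rightarrow> real) \<Rightarrow> bool" where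
  "C1_h d k \<Omega> f Df \<longleftrightarrow>
     (\<forall>x\<in>\<Omega>. h_homomorphism_Rk k (Df x) \<and>
        ((\<lambda>w. L2_set (\<lambda>i. f (x \<cdot> w) i - f x i - Df x w i) {..<k} / hnorm d w) \<longlongrightarrow> 0) (at 0)) \<and>
     (\<forall>w. \<forall>i<k. continuous_on \<Omega> (\<lambda>x. Df x w i))"

definition horizontal_gradient :: "('n::finite heis \<Rightarrow> real) \<Rightarrow> 'n heis" where
  "horizontal_gradient l = (THE g. g \<in> H1 \<and> (\<forall>z. l z = inner g z))"

text \<open>The exterior product \<open>u\<^sub>0 \<and> \<dots> \<and> u\<^sub>k\<^sub>-\<^sub>1\<close>, realised (via the scalar product) as an
  alternating \<open>k\<close>-linear form.\<close>

definition wedge :: "nat \<Rightarrow> (nat \<Rightarrow> 'a::real_inner) \<Rightarrow> (nat \<Rightarrow> 'a) \<Rightarrow> real" where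
  "wedge k u = (\<lambda>a. Determinant.det (Matrix.mat k k (\<lambda>(i, j). inner (u i) (a j))))"

definition H_regular_surface ::
    "('n::finite heis \<Rightarrow> 'n heis \<Rightarrow> real) \<Rightarrow> nat \<Rightarrow> 'n heis set \<Rightarrow> bool" where
  "H_regular_surface d k S \<longleftrightarrow>
     (\<forall>x\<in>S. \<exists>\<Omega> h Dh.
        open \<Omega> \<and> x \<in> \<Omega> \<and> C1_h d k \<Omega> h Dh \<and>
        S \<inter> \<Omega> = {y \<in> \<Omega>. \<forall>i<k. h y i = 0} \<and>
        (\<forall>y\<in>\<Omega>. wedge k (\<lambda>i. horizontal_gradient (\<lambda>z. Dh y z i)) \<noteq> (\<lambda>_. 0)))"

section \<open>Intrinsic differentiability\<close>

definition graph_map :: "('n::finite heis \<Rightarrow> 'n heis) \<Rightarrow> 'n heis \<Rightarrow> 'n heis" where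
  "graph_map \<phi> w = w \<cdot> \<phi> w"

definition sigma_tr ::
    "'n::finite heis set \<Rightarrow> 'n heis set \<Rightarrow> 'n heis \<Rightarrow> 'n heis \<Rightarrow> 'n heis" where
  "sigma_tr W V x w = x \<cdot> w \<cdot> hinv (proj_V W V x)"

text \<open>The translated map \<open>\<phi>\<^sub>x\<close>; its domain is \<open>sigma_tr W V x ` U\<close>.\<close>

definition translated ::
    "'n::finite heis set \<Rightarrow> 'n heis set \<Rightarrow> ('n heis \<Rightarrow> 'n heis) \<Rightarrow> 'n heis \<Rightarrow> 'n heis \<Rightarrow> 'n heis"
    where
  "translated W V \<phi> x w = proj_V W V x \<cdot> \<phi> (sigma_tr W V (hinv x) w)"

definition has_intrinsic_differential ::
    "('n::finite heis \<Rightarrow> 'n heis \<Rightarrow> real) \<Rightarrow> 'n heis set \<Rightarrow> 'n heis set \<Rightarrow> ('n heis \<Rightarrow> 'n heis) \<Rightarrow>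
      'n heis \<Rightarrow> ('n heis \<Rightarrow> 'n heis) \<Rightarrow> bool" where
  "has_intrinsic_differential d W V \<phi> p L \<longleftrightarrow>
     h_homomorphism W V L \<and>
     ((\<lambda>w. d (L w) (translated W V \<phi> (hinv (graph_map \<phi> p)) w) / hnorm d w) \<longlongrightarrow> 0) (at 0 within W)"

text \<open>The values on \<open>W\<close> of the chosen map are uniquely determined when \<open>\<phi>\<close> is intrinsic
  differentiable at an interior point \<open>p\<close> of its domain in \<open>W\<close>.\<close>

definition intrinsic_differential ::
    "('n::finite heis \<Rightarrow> 'n heis \<Rightarrow> real) \<Rightarrow> 'n heis set \<Rightarrow> 'n heis set \<Rightarrow> ('n heis \<Rightarrow> 'n heis) \<Rightarrow>
      'n heis \<Rightarrow> 'n heis \<Rightarrow> 'n heis" where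
  "intrinsic_differential d W V \<phi> p = (SOME L. has_intrinsic_differential d W V \<phi> p L)"

text \<open>The suprema are taken in \<open>[0, \<infinity>]\<close>, where the supremum of the empty set is 0. Since \<open>U\<close> is
  open, the restriction of \<open>w\<close> to the domain of the translated map is void for small \<open>\<delta>\<close>.\<close>

definition uniformly_intrinsic_differentiable ::
    "('n::finite heis \<Rightarrow> 'n heis \<Rightarrow> real) \<Rightarrow> 'n heis set \<Rightarrow> 'n heis set \<Rightarrow> 'n heis set \<Rightarrow>
      ('n heis \<Rightarrow> 'n heis) \<Rightarrow> bool" where
  "uniformly_intrinsic_differentiable d W V U \<phi> \<longleftrightarrow>
     (\<forall>p\<in>U. \<exists>L. h_homomorphism W V L \<and>
        ((\<lambda>\<delta>. SUP p'\<in>{p'\<in>U. hnorm d (hinv p \<cdot> p') < \<delta>}.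
              SUP w\<in>{w \<in> sigma_tr W V (hinv (graph_map \<phi> p')) ` U. 0 < hnorm d w \<and> hnorm d w < \<delta>}.
                ennreal (d (L w) (translated W V \<phi> (hinv (graph_map \<phi> p')) w) / hnorm d w))
          \<longlongrightarrow> 0) (at_right 0))"

definition parametrized_H_regular_surface ::
    "('n::finite heis \<Rightarrow> 'n heis \<Rightarrow> real) \<Rightarrow> nat \<Rightarrow> 'n heis set \<Rightarrow> 'n heis set \<Rightarrow> 'n heis set \<Rightarrow>
      ('n heis \<Rightarrow> 'n heis) \<Rightarrow> 'n heis set \<Rightarrow> bool" where
  "parametrized_H_regular_surface d k W V U \<phi> S \<longleftrightarrow>
     H_regular_surface d k S \<and> semidirect W V \<and>
     U \<subseteq> W \<and> openin (top_of_set W) U \<and> \<phi> ` U \<subseteq> V \<and>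
     uniformly_intrinsic_differentiable d W V U \<phi> \<and>
     S = graph_map \<phi> ` U"

section \<open>The intrinsic Jacobian\<close>

text \<open>Indices start at 0: \<open>v\<^sub>1, \<dots>, v\<^sub>n, w\<^sub>1, \<dots>, w\<^sub>n\<close> are \<open>v 0, \<dots>, v (n-1), w 0, \<dots>, w (n-1)\<close>.\<close>

definition heisenberg_basis ::
    "(nat \<Rightarrow> 'n::finite heis) \<Rightarrow> (nat \<Rightarrow> 'n heis) \<Rightarrow> bool" where
  "heisenberg_basis v w \<longleftrightarrow>
     (\<forall>i<CARD('n). v i \<in> H1 \<and> w i \<in> H1) \<and>
     (\<forall>i<CARD('n). \<forall>j<CARD('n).
        inner (v i) (v j) = (if i = j then 1 else 0) \<and>
        inner (w i) (w j) = (if i = j then 1 else 0) \<and>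
        inner (v i) (w j) = 0) \<and>
     span (v ` {..<CARD('n)} \<union> w ` {..<CARD('n)} \<union> {e_last}) = UNIV \<and>
     (\<forall>i<CARD('n). \<forall>j<CARD('n).
        omega (v i) (w j) = (if i = j then 1 else 0) \<and>
        omega (v i) (v j) = 0 \<and> omega (w i) (w j) = 0)"

text \<open>Heisenberg bases adapted to an orthogonal pair \<open>(W, V)\<close> with \<open>dim V = k\<close>. They exist for every
  orthogonal semidirect factorization: \<open>V\<close> is isotropic and \<open>W\<close> is its orthogonal complement.\<close>

definition adapted_basis ::
    "nat \<Rightarrow> 'n::finite heis set \<Rightarrow> 'n heis set \<Rightarrow> (nat \<Rightarrow> 'n heis) \<Rightarrow> (nat \<Rightarrow> 'n heis) \<Rightarrow> bool" where
  "adapted_basis k W V v w \<longleftrightarrow>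
     heisenberg_basis v w \<and>
     V = span (v ` {..<k}) \<and>
     W = span (v ` {k..<CARD('n)} \<union> w ` {..<CARD('n)} \<union> {e_last})"

text \<open>The first \<open>2n - k\<close> coordinates on \<open>W\<close> are those along
  \<open>v\<^sub>k\<^sub>+\<^sub>1, \<dots>, v\<^sub>n, w\<^sub>1, \<dots>, w\<^sub>k, w\<^sub>k\<^sub>+\<^sub>1, \<dots>, w\<^sub>n\<close>, in this order. The entries of the matrix of an
  h-homomorphism \<open>L : W \<rightarrow> V\<close> are the coordinates along \<open>v\<^sub>1, \<dots>, v\<^sub>k\<close> of the images of these
  vectors.\<close>

definition h_matrix ::
    "nat \<Rightarrow> (nat \<Rightarrow> 'n::finite heis) \<Rightarrow> (nat \<Rightarrow> 'n heis) \<Rightarrow> ('n heis \<Rightarrow> 'n heis) \<Rightarrow> real mat" where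
  "h_matrix k v w L =
     Matrix.mat k (2 * CARD('n) - k)
       (\<lambda>(i, j). inner (v i) (L (if j < CARD('n) - k then v (k + j) else w (j - (CARD('n) - k)))))"

definition intrinsic_jacobian ::
    "('n::finite heis \<Rightarrow> 'n heis \<Rightarrow> real) \<Rightarrow> nat \<Rightarrow> 'n heis set \<Rightarrow> 'n heis set \<Rightarrow>
      (nat \<Rightarrow> 'n heis) \<Rightarrow> (nat \<Rightarrow> 'n heis) \<Rightarrow> ('n heis \<Rightarrow> 'n heis) \<Rightarrow> 'n heis \<Rightarrow> real" where
  "intrinsic_jacobian d k W V v w \<phi> p =
     (let D = h_matrix k v w (intrinsic_differential d W V \<phi> p) in
      sqrt (1 + (\<Sum>l = 1..k.
        \<Sum>(I, J) \<in> {(I, J). I \<subseteq> {..<k} \<and> J \<subseteq> {..<2 * CARD('n) - k} \<and> card I = l \<and> card J = l}.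
          (Determinant.det (submatrix D I J))\<^sup>2)))"

section \<open>Measures, tangent cone and spherical factor\<close>

text \<open>Caratheodory's construction: \<open>F\<close> is the family of admissible covering sets and \<open>dm\<close> their
  diameter.\<close>

definition covering_measure :: "('a set \<Rightarrow> real) \<Rightarrow> 'a set set \<Rightarrow> nat \<Rightarrow> 'a set \<Rightarrow> ennreal" where
  "covering_measure dm F \<alpha> A =
     (SUP \<delta>\<in>{0<..}. INF C\<in>{C :: nat \<Rightarrow> 'a set. (\<forall>j. C j \<in> F \<and> dm (C j) \<le> \<delta>) \<and> A \<subseteq> (\<Union>j. C j)}.
        \<Sum>j. ennreal ((dm (C j) / 2) ^ \<alpha>))"

text \<open>The restriction of an outer measure to the Borel sets. (The two outer measures below are metric
  outer measures, hence countably additive on Borel sets.)\<close>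

definition borel_restriction :: "('a::topological_space set \<Rightarrow> ennreal) \<Rightarrow> 'a measure" where
  "borel_restriction \<mu> = measure_of UNIV (sets borel) \<mu>"

definition unit_cube :: "nat \<Rightarrow> 'a::euclidean_space set" where
  "unit_cube p =
     (let S = (SOME S. S \<subseteq> Basis \<and> card S = p)
      in {x. (\<forall>b\<in>S. 0 \<le> inner x b \<and> inner x b \<le> 1) \<and> (\<forall>b\<in>Basis - S. inner x b = 0)})"

text \<open>On a \<open>p\<close>-dimensional subspace the unnormalized Hausdorff measure is a translation invariant,
  locally finite Borel measure, and subspaces of the same dimension are isometric. Giving a
  \<open>p\<close>-dimensional unit cube measure 1 is therefore the normalization for which the measure
  agrees with Lebesgue measure on all \<open>p\<close>-dimensional subspaces. Covering sets must be bounded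
  because \<open>diameter\<close> is unspecified on unbounded sets.\<close>

definition hausdorff_E :: "nat \<Rightarrow> 'a::euclidean_space set \<Rightarrow> ennreal" where
  "hausdorff_E p A =
     covering_measure diameter {C. bounded C} p A /
     covering_measure diameter {C. bounded C} p (unit_cube p :: 'a set)"

definition hausdorff_measure_E :: "nat \<Rightarrow> 'a::euclidean_space measure" where
  "hausdorff_measure_E p = borel_restriction (hausdorff_E p)"

definition hdiam :: "('n::finite heis \<Rightarrow> 'n heis \<Rightarrow> real) \<Rightarrow> 'n heis set \<Rightarrow> real" where
  "hdiam d C = Sup {d x y | x y. x \<in> C \<and> y \<in> C}"

definition spherical_measure ::
    "('n::finite heis \<Rightarrow> 'n heis \<Rightarrow> real) \<Rightarrow> nat \<Rightarrow> 'n heis measure" where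
  "spherical_measure d \<alpha> =
     borel_restriction (covering_measure (hdiam d) {hcball d x r | x r. r > 0} \<alpha>)"

definition Tan :: "'n::finite heis set \<Rightarrow> 'n heis \<Rightarrow> 'n heis set" where
  "Tan S x =
     {y. \<exists>r X. (\<forall>h::nat. r h > 0 \<and> X h \<in> S) \<and> X \<longlonglongrightarrow> x \<and>
           (\<lambda>h. dil (r h) (hinv x \<cdot> X h)) \<longlonglongrightarrow> y}"

text \<open>The maximum is written as a supremum in \<open>[0, \<infinity>]\<close>; \<open>P\<close> is a linear subspace.\<close>

definition spherical_factor ::
    "('n::finite heis \<Rightarrow> 'n heis \<Rightarrow> real) \<Rightarrow> 'n heis set \<Rightarrow> ennreal" where
  "spherical_factor d P = (SUP z\<in>hcball d 0 1. hausdorff_E (dim P) (P \<inter> hcball d z 1))"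

end

theory Submission
  imports Defs
begin

text \<open>
  Let \<open>p = 2n + 1 - k\<close> and let \<open>\<mu>\<close> be the image under the graph map of the measure with density
  \<open>J\<^sup>\<phi>\<phi>\<close> with respect to \<open>\<H>\<^sup>p\<close> on \<open>U\<close>. If \<open>y = \<Phi>(q) \<delta>\<^sub>r z\<close>, the change of variables
  \<open>u \<mapsto> \<Phi>(q) (\<delta>\<^sub>r u) \<phi>(q)\<^sup>-\<^sup>1\<close> of \<open>W\<close>, whose Jacobian is \<open>r\<^sup>p\<^sup>+\<^sup>1\<close>, expresses \<open>\<mu>(B(y, r)) / r\<^sup>p\<^sup>+\<^sup>1\<close> as an
  integral over those \<open>u\<close> for which the point over \<open>u\<close> of the rescaled graph lies in \<open>B(z, 1)\<close>. By uniform
  intrinsic differentiability the rescaled graphs converge, locally uniformly in the base point, to the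
  graph of the intrinsic differential, which is the tangent cone, and the linear area formula
  identifies the limit with the Euclidean measure of \<open>Tan(\<Sigma>, x) \<inter> B(z, 1)\<close>. Hence the spherical Federer density of
  \<open>\<mu>\<close> at \<open>x\<close> is \<open>\<beta>(Tan(\<Sigma>, x))\<close>, and a density theorem based on Vitali's \<open>5r\<close>-covering lemma for
  \<open>d\<close>-balls turns this into the integral formula.
\<close>

text \<open>The covering balls of the spherical measure need not be centred on the surface, so the
  density that matters is an upper limit over all small balls containing x. This is why
  \<open>spherical_factor\<close> maximises over centres z of norm at most 1, and it decides the
  base point of the blow-up: a ball that meets the surface near x is viewed from a surface point
  inside the ball, yet the limit must be the one given by the differential at x. Pointwise
  differentiability would not give this; the uniform version does. The error of the blow-up is
  turned into a factor: the unit slice is traded for a slice of radius s slightly above 1, and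
  homogeneity evaluates the loss. The exponent p + 1 exceeds the linear dimension p of W because
  dilations act on the centre by the square. The Hausdorff measure on a subspace is handled through
  similarities of sets alone. It is never identified with Lebesgue measure, and the normalizing cube
  is not shown to have positive finite measure. Hence only invariance, scaling and finiteness on
  bounded sets are used, and the case of a vanishing measure on W is settled separately.\<close>

hide_const (open) Order.top

section \<open>Caratheodory's construction\<close>

definition covering_premeasure ::
    "('a set \<Rightarrow> real) \<Rightarrow> 'a set set \<Rightarrow> nat \<Rightarrow> real \<Rightarrow> 'a set \<Rightarrow> ennreal" where
  "covering_premeasure dm F \<alpha> \<delta> A =
     (INF C\<in>{C :: nat \<Rightarrow> 'a set. (\<forall>j. C j \<in> F \<and> dm (C j) \<le> \<delta>) \<and> A \<subseteq> (\<Union>j. C j)}.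
        \<Sum>j. ennreal ((dm (C j) / 2) ^ \<alpha>))"

lemma covering_measure_eq_SUP:
  "covering_measure dm F \<alpha> A = (SUP \<delta>\<in>{0<..}. covering_premeasure dm F \<alpha> \<delta> A)"
  by (simp add: covering_measure_def covering_premeasure_def)

lemma covering_premeasure_le_covering_measure:
  "\<delta> > 0 \<Longrightarrow> covering_premeasure dm F \<alpha> \<delta> A \<le> covering_measure dm F \<alpha> A"
  unfolding covering_measure_eq_SUP by (rule SUP_upper) auto

lemma covering_measure_leI:
  "(\<And>\<delta>. \<delta> > 0 \<Longrightarrow> covering_premeasure dm F \<alpha> \<delta> A \<le> c) \<Longrightarrow> covering_measure dm F \<alpha> A \<le> c"
  unfolding covering_measure_eq_SUP by (rule SUP_least) auto

lemma covering_premeasure_antimono: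
  assumes "\<delta> \<le> \<delta>'"
  shows "covering_premeasure dm F \<alpha> \<delta>' A \<le> covering_premeasure dm F \<alpha> \<delta> A"
  unfolding covering_premeasure_def using assms by (intro INF_superset_mono Collect_mono) (auto intro: order_trans)

lemma covering_premeasure_mono:
  assumes "A \<subseteq> B"
  shows "covering_premeasure dm F \<alpha> \<delta> A \<le> covering_premeasure dm F \<alpha> \<delta> B"
  unfolding covering_premeasure_def using assms by (intro INF_superset_mono) auto

lemma covering_measure_mono:
  "A \<subseteq> B \<Longrightarrow> covering_measure dm F \<alpha> A \<le> covering_measure dm F \<alpha> B"
  unfolding covering_measure_eq_SUP by (intro SUP_mono) (blast intro: covering_premeasure_mono)

lemma covering_premeasure_le:
  assumes "\<And>j. C j \<in> F" "\<And>j. dm (C j) \<le> \<delta>" "A \<subseteq> (\<Union>j. C j)"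
  shows "covering_premeasure dm F \<alpha> \<delta> A \<le> (\<Sum>j. ennreal ((dm (C j) / 2) ^ \<alpha>))"
  unfolding covering_premeasure_def using assms by (intro INF_lower) auto

lemma covering_premeasure_approx:
  assumes "covering_premeasure dm F \<alpha> \<delta> A < c"
  obtains C where "\<And>j. C j \<in> F" "\<And>j. dm (C j) \<le> \<delta>" "A \<subseteq> (\<Union>j. C j)"
    "(\<Sum>j. ennreal ((dm (C j) / 2) ^ \<alpha>)) < c"
  using assms unfolding covering_premeasure_def INF_less_iff by blast

lemma ennreal_less_add_pos: "x < top \<Longrightarrow> 0 < e \<Longrightarrow> x < x + ennreal e"
  by (cases x) (auto simp: ennreal_plus[symmetric] ennreal_less_iff simp del: ennreal_plus)

lemma suminf_ennreal_half_powers: "(\<Sum>j::nat. ennreal (\<eta> / 2 ^ Suc j)) = ennreal \<eta>" if "\<eta> \<ge> 0"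
proof -
  have "(\<lambda>j. \<eta> * (1/2) ^ Suc j) sums (\<eta> * 1)"
    by (intro sums_mult power_half_series)
  then have "(\<lambda>j. \<eta> / 2 ^ Suc j) sums \<eta>"
    by (simp add: power_divide)
  then show ?thesis
    using that by (intro suminf_ennreal_eq) auto
qed

text \<open>The common frame of both outer measures: bounded sets with the Euclidean diameter, and
  d-balls with \<open>hdiam\<close>. Topology enters only through \<open>rho_closed\<close>;
  \<open>small_sets\<close> and \<open>alpha_pos\<close> allow a cover to be padded by sets of
  negligible cost.\<close>

locale metric_covering =
  fixes dm :: "'a::second_countable_topology set \<Rightarrow> real" and F :: "'a set set" and \<alpha> :: nat
    and \<rho> :: "'a \<Rightarrow> 'a \<Rightarrow> real"
  assumes alpha_pos: "\<alpha> > 0"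
    and dm_nonneg: "C \<in> F \<Longrightarrow> 0 \<le> dm C"
    and small_sets: "\<epsilon> > 0 \<Longrightarrow> \<exists>C\<in>F. dm C \<le> \<epsilon>"
    and dist_le_dm: "\<lbrakk>C \<in> F; x \<in> C; y \<in> C\<rbrakk> \<Longrightarrow> \<rho> x y \<le> dm C"
    and rho_refl: "\<rho> x x = 0"
    and rho_sym: "\<rho> x y = \<rho> y x"
    and rho_triangle: "\<rho> x z \<le> \<rho> x y + \<rho> y z"
    and rho_closed: "\<lbrakk>closed K; x \<notin> K\<rbrakk> \<Longrightarrow> \<exists>\<epsilon>>0. \<forall>y\<in>K. \<epsilon> \<le> \<rho> x y"
begin

abbreviation "pre \<equiv> covering_premeasure dm F \<alpha>"
abbreviation "cm \<equiv> covering_measure dm F \<alpha>"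

lemma premeasure_le_partial:
  assumes "\<delta> > 0" and C: "\<And>j. j \<in> J \<Longrightarrow> C j \<in> F" "\<And>j. j \<in> J \<Longrightarrow> dm (C j) \<le> \<delta>"
    and A: "A \<subseteq> (\<Union>j\<in>J. C j)"
  shows "pre \<delta> A \<le> (\<Sum>j. if j \<in> J then ennreal ((dm (C j) / 2) ^ \<alpha>) else 0)"
proof (rule ennreal_le_epsilon)
  fix \<eta> :: real assume "\<eta> > 0"
  \<comment> \<open>Size at most 1 bounds the power by its base; size at most
    \<open>\<eta> / 2 ^ Suc j\<close> then makes the whole padding cost at most \<eta>.\<close>
  have "\<exists>E\<in>F. dm E \<le> min \<delta> (min 1 (\<eta> / 2 ^ Suc j))" for j :: nat
    using \<open>\<eta> > 0\<close> \<open>\<delta> > 0\<close> by (intro small_sets) auto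
  then obtain E where E: "\<And>j. E j \<in> F" "\<And>j. dm (E j) \<le> min \<delta> (min 1 (\<eta> / 2 ^ Suc j))"
    by metis
  have E': "(dm (E j) / 2) ^ \<alpha> \<le> \<eta> / 2 ^ Suc j" for j
  proof -
    have "(dm (E j) / 2) ^ \<alpha> \<le> (dm (E j) / 2) ^ 1"
      using dm_nonneg[OF E(1)[of j]] E(2)[of j] alpha_pos by (intro power_decreasing) auto
    also have "\<dots> \<le> \<eta> / 2 ^ Suc j"
      using dm_nonneg[OF E(1)[of j]] E(2)[of j] by auto
    finally show ?thesis .
  qed
  define C' where "C' j = (if j \<in> J then C j else E j)" for j
  have "pre \<delta> A \<le> (\<Sum>j. ennreal ((dm (C' j) / 2) ^ \<alpha>))"
    using C E A by (intro covering_premeasure_le) (auto simp: C'_def)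
  also have "\<dots> \<le> (\<Sum>j. (if j \<in> J then ennreal ((dm (C j) / 2) ^ \<alpha>) else 0) + ennreal (\<eta> / 2 ^ Suc j))"
  proof (intro suminf_le)
    fix j show "ennreal ((dm (C' j) / 2) ^ \<alpha>)
       \<le> (if j \<in> J then ennreal ((dm (C j) / 2) ^ \<alpha>) else 0) + ennreal (\<eta> / 2 ^ Suc j)"
      using E'[of j] by (auto simp: C'_def intro!: ennreal_leI)
  qed auto
  also have "\<dots> = (\<Sum>j. if j \<in> J then ennreal ((dm (C j) / 2) ^ \<alpha>) else 0) + ennreal \<eta>"
    using \<open>\<eta> > 0\<close> by (subst suminf_add[symmetric]) (simp_all only: suminf_ennreal_half_powers less_imp_le summableI)
  finally show "pre \<delta> A \<le> (\<Sum>j. if j \<in> J then ennreal ((dm (C j) / 2) ^ \<alpha>) else 0) + ennreal \<eta>" .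
qed

lemma cm_empty: "cm {} = 0"
proof -
  have "pre \<delta> {} \<le> 0" if "\<delta> > 0" for \<delta>
    using premeasure_le_partial[OF that, of "{}" _ "{}"] by simp
  then have "cm {} \<le> 0"
    by (intro covering_measure_leI)
  then show ?thesis by simp
qed

lemma cm_countably_subadditive: "cm (\<Union>i::nat. A i) \<le> (\<Sum>i. cm (A i))"
proof (rule covering_measure_leI, rule ennreal_le_epsilon)
  fix \<delta> \<eta> :: real assume "\<delta> > 0" "\<eta> > 0" and fin: "(\<Sum>i. cm (A i)) < top"
  have fin': "cm (A i) < top" for i
    using fin by (rule ennreal_suminf_lessD)
  have "\<exists>C. (\<forall>j. C j \<in> F \<and> dm (C j) \<le> \<delta>) \<and> A i \<subseteq> (\<Union>j. C j) \<and>
       (\<Sum>j. ennreal ((dm (C j) / 2) ^ \<alpha>)) \<le> cm (A i) + ennreal (\<eta> / 2 ^ Suc i)" for i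
  proof -
    have "pre \<delta> (A i) \<le> cm (A i)"
      using \<open>\<delta> > 0\<close> by (rule covering_premeasure_le_covering_measure)
    also have "\<dots> < cm (A i) + ennreal (\<eta> / 2 ^ Suc i)"
      using fin'[of i] \<open>\<eta> > 0\<close> by (simp add: ennreal_less_add_pos)
    finally show ?thesis
      by (elim covering_premeasure_approx) (auto intro: less_imp_le)
  qed
  then obtain C where C: "\<And>i j. C i j \<in> F" "\<And>i j. dm (C i j) \<le> \<delta>" "\<And>i. A i \<subseteq> (\<Union>j. C i j)"
    "\<And>i. (\<Sum>j. ennreal ((dm (C i j) / 2) ^ \<alpha>)) \<le> cm (A i) + ennreal (\<eta> / 2 ^ Suc i)"
    by metis
  have "pre \<delta> (\<Union>i. A i) \<le> (\<Sum>m. ennreal ((dm (case_prod C (prod_decode m)) / 2) ^ \<alpha>))"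
  proof (rule covering_premeasure_le)
    show "(\<Union>i. A i) \<subseteq> (\<Union>m. case_prod C (prod_decode m))"
    proof
      fix x assume "x \<in> (\<Union>i. A i)"
      then obtain i j where "x \<in> C i j" using C(3) by blast
      then show "x \<in> (\<Union>m. case_prod C (prod_decode m))"
        by (intro UN_I[of "prod_encode (i, j)"]) auto
    qed
  qed (auto simp: C split: prod.split)
  also have "\<dots> = (\<Sum>i. \<Sum>j. ennreal ((dm (C i j) / 2) ^ \<alpha>))"
    using suminf_ennreal_2dimen[of "\<lambda>i. \<Sum>j. ennreal ((dm (C i j) / 2) ^ \<alpha>)"
        "\<lambda>m. ennreal ((dm (case_prod C m) / 2) ^ \<alpha>)"] by simp
  also have "\<dots> \<le> (\<Sum>i. cm (A i) + ennreal (\<eta> / 2 ^ Suc i))"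
    using C(4) by (intro suminf_le) auto
  also have "\<dots> = (\<Sum>i. cm (A i)) + ennreal \<eta>"
    using \<open>\<eta> > 0\<close> by (subst suminf_add[symmetric]) (simp_all only: suminf_ennreal_half_powers less_imp_le summableI)
  finally show "pre \<delta> (\<Union>i. A i) \<le> (\<Sum>i. cm (A i)) + ennreal \<eta>" .
qed

lemma outer_measure_space_cm: "outer_measure_space UNIV cm"
  unfolding outer_measure_space_def
  by (auto simp: positive_def increasing_def countably_subadditive_def cm_empty
      intro: covering_measure_mono cm_countably_subadditive)

lemma cm_subadditive: "cm (A \<union> B) \<le> cm A + cm B"
proof -
  have "cm (A \<union> B) = cm (\<Union>i. binaryset A B i)"
    by (simp add: UN_binaryset_eq)
  also have "\<dots> \<le> (\<Sum>i. cm (binaryset A B i))"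
    by (rule cm_countably_subadditive)
  also have "\<dots> = cm A + cm B"
    by (simp add: suminf_binaryset_eq cm_empty)
  finally show ?thesis .
qed

text \<open>Once the mesh is below \<epsilon>, no covering set meets both A and B, so every cover of
  the union splits into two covers with disjoint index sets.\<close>

lemma cm_add_le_separated:
  assumes "\<epsilon> > 0" and sep: "\<And>a b. a \<in> A \<Longrightarrow> b \<in> B \<Longrightarrow> \<epsilon> \<le> \<rho> a b"
  shows "cm A + cm B \<le> cm (A \<union> B)"
proof -
  have key: "pre \<delta> A + pre \<delta> B \<le> pre \<delta> (A \<union> B)" if \<delta>: "0 < \<delta>" "\<delta> < \<epsilon>" for \<delta>
    unfolding covering_premeasure_def[of _ _ _ _ "A \<union> B"]
  proof (rule INF_greatest)
    fix C :: "nat \<Rightarrow> 'a set"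
    assume C: "C \<in> {C. (\<forall>j. C j \<in> F \<and> dm (C j) \<le> \<delta>) \<and> A \<union> B \<subseteq> (\<Union>j. C j)}"
    define JA where "JA = {j. C j \<inter> A \<noteq> {}}"
    define JB where "JB = {j. C j \<inter> B \<noteq> {}}"
    have disj: "j \<notin> JB" if j: "j \<in> JA" for j
    proof
      assume "j \<in> JB"
      with j obtain a b where "a \<in> C j" "b \<in> C j" "a \<in> A" "b \<in> B"
        by (auto simp: JA_def JB_def)
      then have "\<epsilon> \<le> \<rho> a b" "\<rho> a b \<le> \<delta>"
        using sep C dist_le_dm[of "C j" a b] by (auto intro: order_trans)
      then show False using \<delta> by simp
    qed
    have "pre \<delta> A \<le> (\<Sum>j. if j \<in> JA then ennreal ((dm (C j) / 2) ^ \<alpha>) else 0)"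
      using C \<delta> by (intro premeasure_le_partial) (auto simp: JA_def, blast?)
    moreover have "pre \<delta> B \<le> (\<Sum>j. if j \<in> JB then ennreal ((dm (C j) / 2) ^ \<alpha>) else 0)"
      using C \<delta> by (intro premeasure_le_partial) (auto simp: JB_def, blast?)
    ultimately have "pre \<delta> A + pre \<delta> B \<le> (\<Sum>j. if j \<in> JA then ennreal ((dm (C j) / 2) ^ \<alpha>) else 0)
         + (\<Sum>j. if j \<in> JB then ennreal ((dm (C j) / 2) ^ \<alpha>) else 0)"
      by (rule add_mono)
    also have "\<dots> = (\<Sum>j. (if j \<in> JA then ennreal ((dm (C j) / 2) ^ \<alpha>) else 0)
         + (if j \<in> JB then ennreal ((dm (C j) / 2) ^ \<alpha>) else 0))"
      by (rule suminf_add) auto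
    also have "\<dots> \<le> (\<Sum>j. ennreal ((dm (C j) / 2) ^ \<alpha>))"
      using disj by (intro suminf_le) auto
    finally show "pre \<delta> A + pre \<delta> B \<le> (\<Sum>j. ennreal ((dm (C j) / 2) ^ \<alpha>))" .
  qed
  \<comment> \<open>Separate meshes for A and B allow the two suprema to be taken one after the
    other.\<close>
  have *: "pre \<delta>1 A + pre \<delta>2 B \<le> cm (A \<union> B)" if "\<delta>1 > 0" "\<delta>2 > 0" for \<delta>1 \<delta>2
  proof -
    define \<delta> where "\<delta> = min (\<epsilon> / 2) (min \<delta>1 \<delta>2)"
    have \<delta>: "0 < \<delta>" "\<delta> < \<epsilon>" "\<delta> \<le> \<delta>1" "\<delta> \<le> \<delta>2"
      using that \<open>\<epsilon> > 0\<close> by (auto simp: \<delta>_def)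
    have "pre \<delta>1 A + pre \<delta>2 B \<le> pre \<delta> A + pre \<delta> B"
      using \<delta> by (intro add_mono covering_premeasure_antimono)
    also have "\<dots> \<le> pre \<delta> (A \<union> B)" using key \<delta> by blast
    also have "\<dots> \<le> cm (A \<union> B)" using \<delta> by (intro covering_premeasure_le_covering_measure)
    finally show ?thesis .
  qed
  have "cm A + pre \<delta>2 B \<le> cm (A \<union> B)" if "\<delta>2 > 0" for \<delta>2
    unfolding covering_measure_eq_SUP[of _ _ _ A]
    by (subst ennreal_SUP_add_left[symmetric]) (auto intro!: SUP_least *[OF _ that])
  then show ?thesis
    unfolding covering_measure_eq_SUP[of _ _ _ B]
    by (subst add.commute, subst ennreal_SUP_add_left[symmetric]) (auto intro!: SUP_least simp: add.commute)
qed

text \<open>Caratheodory's criterion: the shells between consecutive distances \<open>1/(m+1)\<close> from a closed set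
  of the same parity are separated, hence the measures of the shells have a finite sum.\<close>

lemma closed_caratheodory:
  assumes K: "closed K"
  shows "cm (K \<inter> A) + cm (A - K) \<le> cm A"
proof (cases "cm A = top")
  case False
  define G where "G m = {x\<in>A. \<forall>y\<in>K. 1 / real (Suc m) \<le> \<rho> x y}" for m
  have G_sub: "G m \<subseteq> A" for m by (auto simp: G_def)
  have G_mono: "G m \<subseteq> G m'" if "m \<le> m'" for m m'
  proof
    fix x assume x: "x \<in> G m"
    have "1 / real (Suc m') \<le> 1 / real (Suc m)"
      using that by (intro divide_left_mono) auto
    then show "x \<in> G m'"
      using x unfolding G_def by (blast intro: order_trans)
  qed
  have G_Un: "A - K = (\<Union>m. G m)" 
  proof (intro equalityI subsetI)
    fix x assume "x \<in> A - K"
    then obtain \<epsilon> where \<epsilon>: "\<epsilon> > 0" "\<forall>y\<in>K. \<epsilon> \<le> \<rho> x y"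
      using rho_closed[OF K] by blast
    obtain m where "1 / real (Suc m) < \<epsilon>"
      using \<epsilon>(1) nat_approx_posE by blast
    with \<epsilon> \<open>x \<in> A - K\<close> have "x \<in> G m"
      by (force simp: G_def)
    then show "x \<in> (\<Union>m. G m)" by blast
  next
    fix x assume "x \<in> (\<Union>m. G m)"
    then obtain m where m: "x \<in> G m" by blast
    have "x \<notin> K"
      using m rho_refl[of x] by (force simp: G_def)
    then show "x \<in> A - K" using m by (auto simp: G_def)
  qed
  define H where "H m = G (Suc m) - G m" for m
  have sep: "cm (G m) + cm (H (Suc m)) \<le> cm (G (Suc (Suc m)))" for m
  proof -
    have "cm (G m) + cm (H (Suc m)) \<le> cm (G m \<union> H (Suc m))"
    proof (rule cm_add_le_separated)
      \<comment> \<open>The gap comes from the triangle inequality: a point of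
        \<open>H (Suc m)\<close> lies within \<open>1 / (m + 2)\<close> of some point of K, while a
        point of \<open>G m\<close> is at least \<open>1 / (m + 1)\<close> away from all of
        K.\<close>
      show "0 < 1 / real (Suc m) - 1 / real (Suc (Suc m))"
        by (simp add: divide_simps)
      fix a b assume a: "a \<in> G m" and b: "b \<in> H (Suc m)"
      then obtain y where y: "y \<in> K" "\<rho> b y < 1 / real (Suc (Suc m))"
        by (fastforce simp: G_def H_def not_le)
      have "1 / real (Suc m) \<le> \<rho> a y" using a y by (auto simp: G_def)
      with y rho_triangle[of a y b] show "1 / real (Suc m) - 1 / real (Suc (Suc m)) \<le> \<rho> a b"
        by linarith
    qed
    also have "\<dots> \<le> cm (G (Suc (Suc m)))"
      using G_mono[of m "Suc (Suc m)"] by (intro covering_measure_mono) (auto simp: H_def)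
    finally show ?thesis .
  qed
  \<comment> \<open>The sum advances two shells at a time, one of each parity, so that each parity
    is absorbed by one of two consecutive sets G.\<close>
  have partial: "(\<Sum>i<2*m. cm (H (Suc i))) \<le> cm (G (2 * m)) + cm (G (Suc (2 * m)))" for m
  proof (induction m)
    case (Suc m)
    have "(\<Sum>i<2*Suc m. cm (H (Suc i))) = (\<Sum>i<2*m. cm (H (Suc i)))
        + (cm (H (Suc (2 * m))) + cm (H (Suc (Suc (2 * m)))))"
      by (simp add: add.assoc)
    also have "\<dots> \<le> (cm (G (2 * m)) + cm (G (Suc (2 * m))))
        + (cm (H (Suc (2 * m))) + cm (H (Suc (Suc (2 * m)))))"
      by (intro add_right_mono Suc.IH)
    also have "\<dots> = (cm (G (2 * m)) + cm (H (Suc (2 * m))))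
        + (cm (G (Suc (2 * m))) + cm (H (Suc (Suc (2 * m)))))"
      by (simp add: ac_simps)
    also have "\<dots> \<le> cm (G (Suc (Suc (2 * m)))) + cm (G (Suc (Suc (Suc (2 * m)))))"
      by (intro add_mono sep)
    finally show ?case by simp
  qed simp
  have "(\<Sum>i. cm (H (Suc i))) \<le> cm A + cm A"
    unfolding suminf_eq_SUP
  proof (rule SUP_least)
    fix m :: nat
    have "(\<Sum>i<m. cm (H (Suc i))) \<le> (\<Sum>i<2*m. cm (H (Suc i)))"
      by (intro sum_mono2) auto
    also note partial
    also have "cm (G (2 * m)) + cm (G (Suc (2 * m))) \<le> cm A + cm A"
      by (intro add_mono covering_measure_mono G_sub)
    finally show "(\<Sum>i<m. cm (H (Suc i))) \<le> cm A + cm A" .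
  qed
  with False have fin: "(\<Sum>i. cm (H (Suc i))) \<noteq> top"
    by (auto simp: top_unique)
  define a where "a i = enn2real (cm (H (Suc i)))" for i
  have a: "cm (H (Suc i)) = ennreal (a i)" for i
    using ennreal_suminf_lessD[of "\<lambda>i. cm (H (Suc i))" top i] fin by (simp add: a_def less_top)
  have a_nonneg: "0 \<le> a i" for i by (simp add: a_def)
  have "summable a"
    using fin by (intro summable_suminf_not_top) (auto simp: a a_nonneg)
  show ?thesis
  proof (rule ennreal_le_epsilon)
    fix \<eta> :: real assume "\<eta> > 0"
    then obtain N where N: "\<And>n. n \<ge> N \<Longrightarrow> norm (\<Sum>i. a (i + n)) < \<eta>"
      using suminf_exist_split[OF _ \<open>summable a\<close>] by blast
    have "(\<Sum>i. cm (H (Suc (i + N)))) = ennreal (\<Sum>i. a (i + N))"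
      unfolding a using \<open>summable a\<close> a_nonneg
      by (intro suminf_ennreal2) (auto simp: summable_iff_shift)
    also have "\<dots> \<le> ennreal \<eta>"
      using N[of N] by (intro ennreal_leI) auto
    finally have tail: "(\<Sum>i. cm (H (Suc (i + N)))) \<le> ennreal \<eta>" .
    have cover: "G m \<subseteq> G (Suc N) \<union> (\<Union>i. H (Suc (i + N)))" for m
    proof (induction m)
      case 0
      show ?case using G_mono[of 0 "Suc N"] by auto
    next
      case (Suc m)
      show ?case
      proof (cases "m \<le> N")
        case True
        then show ?thesis using G_mono[of "Suc m" "Suc N"] by auto
      next
        case False
        then have "H m \<subseteq> (\<Union>i. H (Suc (i + N)))"
          by (intro UN_upper[of "m - Suc N", THEN subset_trans[rotated]]) auto
        then show ?thesis using Suc.IH by (auto simp: H_def)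
      qed
    qed
    have "cm (A - K) \<le> cm (G (Suc N) \<union> (\<Union>i. H (Suc (i + N))))"
      using cover by (intro covering_measure_mono) (auto simp: G_Un)
    also have "\<dots> \<le> cm (G (Suc N)) + cm (\<Union>i. H (Suc (i + N)))"
      by (rule cm_subadditive)
    also have "\<dots> \<le> cm (G (Suc N)) + ennreal \<eta>"
      by (intro add_left_mono order_trans[OF cm_countably_subadditive tail])
    finally have "cm (K \<inter> A) + cm (A - K) \<le> cm (K \<inter> A) + cm (G (Suc N)) + ennreal \<eta>"
      by (simp add: add.assoc add_left_mono)
    also have "cm (K \<inter> A) + cm (G (Suc N)) \<le> cm ((K \<inter> A) \<union> G (Suc N))"
      by (rule cm_add_le_separated[of "1 / real (Suc (Suc N))"]) (auto simp: G_def rho_sym)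
    also have "\<dots> \<le> cm A"
      using G_sub by (intro covering_measure_mono) auto
    finally show "cm (K \<inter> A) + cm (A - K) \<le> cm A + ennreal \<eta>"
      by (simp add: add_right_mono)
  qed
qed simp

lemma measure_space_cm: "measure_space UNIV (sets borel) cm"
proof -
  interpret Pw: sigma_algebra UNIV "UNIV :: 'a set set"
    using sigma_algebra_Pow[of "UNIV :: 'a set"] by simp
  have "measure_space UNIV (lambda_system UNIV UNIV cm) cm"
    by (rule Pw.caratheodory_lemma[OF outer_measure_space_cm])
  moreover have "sets borel \<subseteq> lambda_system UNIV UNIV cm"
  proof -
    have "sigma_algebra UNIV (lambda_system UNIV UNIV cm)"
      using calculation by (simp add: measure_space_def)
    moreover have "K \<in> lambda_system UNIV UNIV cm" if "closed K" for K
    proof -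
      have "cm (K \<inter> A) + cm ((UNIV - K) \<inter> A) = cm A" for A
      proof (rule antisym)
        have "(UNIV - K) \<inter> A = A - K" by auto
        then show "cm (K \<inter> A) + cm ((UNIV - K) \<inter> A) \<le> cm A"
          using closed_caratheodory[OF that] by simp
        have "A = (K \<inter> A) \<union> ((UNIV - K) \<inter> A)" by auto
        then show "cm A \<le> cm (K \<inter> A) + cm ((UNIV - K) \<inter> A)"
          using cm_subadditive by metis
      qed
      then show ?thesis by (simp add: lambda_system_def)
    qed
    ultimately have "sigma_sets UNIV (Collect closed) \<subseteq> lambda_system UNIV UNIV cm"
      by (intro sigma_algebra.sigma_sets_subset) auto
    then show ?thesis by (simp add: borel_eq_closed)
  qed
  moreover have "sigma_algebra UNIV (sets (borel :: 'a measure))"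
    using sets.sigma_algebra_axioms[of "borel :: 'a measure"] by (simp only: space_borel)
  ultimately show ?thesis
    by (metis measure_down)
qed

lemma emeasure_borel_restriction_cm:
  assumes "A \<in> sets borel"
  shows "emeasure (borel_restriction cm) A = cm A"
proof -
  show ?thesis
    unfolding borel_restriction_def
    using measure_space_cm assms
    by (intro emeasure_measure_of_sigma) (auto simp: measure_space_def)
qed

end

lemma sets_borel_restriction [simp, measurable_cong]: "sets (borel_restriction \<mu>) = sets borel"
  unfolding borel_restriction_def by (rule sigma_algebra.sets_measure_of_eq)
     (use sets.sigma_algebra_axioms[of "borel :: 'a::topological_space measure"] in \<open>simp only: space_borel\<close>)

lemma space_borel_restriction [simp]: "space (borel_restriction \<mu>) = UNIV"
  by (simp add: borel_restriction_def)

declare split_paired_All [simp del] split_paired_Ex [simp del]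

section \<open>Homogeneous distances\<close>

lemma omega_altdef:
  "omega p q = inner (fst p) (fst (snd q)) - inner (fst (snd p)) (fst q)"
  by (simp add: omega_def case_prod_unfold)

lemma omega_add_left: "omega (p + q) r = omega p r + omega q r"
  and omega_add_right: "omega r (p + q) = omega r p + omega r q"
  and omega_scale_left: "omega (c *\<^sub>R p) q = c * omega p q"
  and omega_scale_right: "omega p (c *\<^sub>R q) = c * omega p q"
  and omega_minus_left: "omega (- p) q = - omega p q"
  and omega_minus_right: "omega p (- q) = - omega p q"
  and omega_diff_left: "omega (p - q) r = omega p r - omega q r"
  and omega_diff_right: "omega r (p - q) = omega r p - omega r q"
  and omega_self: "omega p p = 0"
  and omega_e_last_left: "omega e_last p = 0"
  and omega_e_last_right: "omega p e_last = 0"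
  and omega_0_left: "omega 0 p = 0"
  and omega_0_right: "omega p 0 = 0"
  by (auto simp: omega_altdef algebra_simps e_last_def inner_commute)

lemma omega_commute: "omega p q = - omega q p"
  by (simp add: omega_altdef inner_commute)

lemmas omega_simps [simp] = omega_add_left omega_add_right omega_scale_left omega_scale_right
  omega_minus_left omega_minus_right omega_diff_left omega_diff_right omega_self
  omega_e_last_left omega_e_last_right omega_0_left omega_0_right

lemma hmul_eq: "p \<cdot> q = p + q + (omega p q / 2) *\<^sub>R e_last"
  by (simp add: hmul_def bracket_def proj_H1_def omega_def case_prod_unfold)

lemma hmul_components:
  "(a, b, c) \<cdot> (a', b', c') = (a + a', b + b', c + c' + (inner a b' - inner b a') / 2)"
  by (simp add: hmul_eq e_last_def omega_def)

lemma hmul_assoc: "(p \<cdot> q) \<cdot> r = p \<cdot> (q \<cdot> r)"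
  by (simp add: hmul_eq algebra_simps add_divide_distrib)

lemma hmul_0_left [simp]: "0 \<cdot> p = p"
  and hmul_0_right [simp]: "p \<cdot> 0 = p"
  by (simp_all add: hmul_eq)

lemma hinv_hmul [simp]: "hinv p \<cdot> p = 0"
  and hmul_hinv [simp]: "p \<cdot> hinv p = 0"
  by (simp_all add: hmul_eq hinv_def)

lemma hinv_hmul_cancel [simp]: "hinv p \<cdot> (p \<cdot> q) = q"
  and hmul_hinv_cancel [simp]: "p \<cdot> (hinv p \<cdot> q) = q"
  by (simp_all flip: hmul_assoc)

lemma hinv_hinv [simp]: "hinv (hinv p) = p"
  and hinv_0 [simp]: "hinv 0 = 0"
  by (simp_all add: hinv_def)

text \<open>Like the product, a dilation is a vector operation up to a multiple of
  \<open>e_last\<close>. A linear map that kills \<open>e_last\<close> therefore turns it into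
  multiplication by t.\<close>

lemma dil_eq: "dil t p = t *\<^sub>R p + ((t\<^sup>2 - t) * snd (snd p)) *\<^sub>R e_last"
  by (simp add: dil_def case_prod_unfold e_last_def prod_eq_iff algebra_simps)

lemma dil_hmul: "dil t (p \<cdot> q) = dil t p \<cdot> dil t q"
  by (auto simp: dil_def hmul_components case_prod_unfold prod_eq_iff hmul_eq omega_altdef e_last_def
      algebra_simps power2_eq_square add_divide_distrib diff_divide_distrib)

lemma dil_dil: "dil s (dil t p) = dil (s * t) p"
  by (simp add: dil_def case_prod_unfold power_mult_distrib)

lemma dil_1 [simp]: "dil 1 p = p"
  by (simp add: dil_def case_prod_unfold)

lemma dil_0_right [simp]: "dil t 0 = 0"
  by (simp add: dil_def case_prod_unfold zero_prod_def)

lemma dil_0_left [simp]: "dil 0 p = 0"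
  by (simp add: dil_def case_prod_unfold zero_prod_def)

lemma dil_hinv: "dil t (hinv p) = hinv (dil t p)"
  by (simp add: dil_def case_prod_unfold hinv_def prod_eq_iff)

lemma continuous_on_hmul [continuous_intros]:
  assumes "continuous_on A f" "continuous_on A g"
  shows "continuous_on A (\<lambda>x. f x \<cdot> g x)"
  unfolding hmul_eq omega_altdef by (intro continuous_intros assms) auto

lemma continuous_on_hinv [continuous_intros]:
  "continuous_on A f \<Longrightarrow> continuous_on A (\<lambda>x. hinv (f x))"
  unfolding hinv_def by (intro continuous_intros)

lemma continuous_on_dil [continuous_intros]:
  assumes "continuous_on A f" "continuous_on A g"
  shows "continuous_on A (\<lambda>x. dil (f x) (g x))"
  unfolding dil_eq by (intro continuous_intros assms)

section \<open>A homogeneous distance compared with the Euclidean topology\<close>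

locale homog_dist =
  fixes d :: "'n::finite heis \<Rightarrow> 'n heis \<Rightarrow> real"
  assumes homogeneous_distance: "homogeneous_distance d"
begin

abbreviation "N \<equiv> hnorm d"

lemma dist_left_invariant: "d (z \<cdot> x) (z \<cdot> y) = d x y"
  and dist_dil: "t > 0 \<Longrightarrow> d (dil t x) (dil t y) = t * d x y"
  and dist_nonneg: "0 \<le> d x y"
  and dist_commute: "d x y = d y x"
  and dist_eq_0_iff: "d x y = 0 \<longleftrightarrow> x = y"
  and dist_triangle: "d x z \<le> d x y + d y z"
  using homogeneous_distance
  unfolding homogeneous_distance_def Metric_space_def by blast+

lemma dist_refl [simp]: "d x x = 0"
  by (simp add: dist_eq_0_iff)

lemma dist_eq_hnorm: "d x y = N (hinv y \<cdot> x)"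
  using dist_left_invariant[of "hinv y" x y] by (simp add: hnorm_def)

lemma dist_eq_hnorm': "d x y = N (hinv x \<cdot> y)"
  by (metis dist_commute dist_eq_hnorm)

lemma hnorm_nonneg: "0 \<le> N x"
  and hnorm_0 [simp]: "N 0 = 0"
  and hnorm_eq_0_iff: "N x = 0 \<longleftrightarrow> x = 0"
  by (simp_all add: hnorm_def dist_nonneg dist_eq_0_iff)

lemma hnorm_pos_iff: "0 < N x \<longleftrightarrow> x \<noteq> 0"
  using hnorm_nonneg[of x] hnorm_eq_0_iff[of x] by linarith

lemma hnorm_dil: "t > 0 \<Longrightarrow> N (dil t x) = t * N x"
  using dist_dil[of t x 0] by (simp add: hnorm_def)

lemma hnorm_dil': "t \<ge> 0 \<Longrightarrow> N (dil t x) = t * N x"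
  by (cases "t = 0") (auto simp: hnorm_dil)

lemma hnorm_hinv: "N (hinv x) = N x"
  using dist_eq_hnorm[of 0 x] by (simp add: hnorm_def dist_commute)

lemma hnorm_hmul: "N (x \<cdot> y) \<le> N x + N y"
proof -
  have "N (x \<cdot> y) = d y (hinv x)" by (simp add: dist_eq_hnorm)
  also have "\<dots> \<le> d y 0 + d 0 (hinv x)" by (rule dist_triangle)
  also have "\<dots> = N x + N y"
    by (metis add.commute dist_commute hnorm_def hnorm_hinv)
  finally show ?thesis .
qed

lemma hnorm_uminus: "N (- x) = N x"
  using hnorm_hinv by (simp add: hinv_def)

lemma abs_hnorm_diff_le: "\<bar>N x - N y\<bar> \<le> d x y"
  using dist_triangle[of x 0 y] dist_triangle[of y 0 x] by (auto simp: hnorm_def dist_commute)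

lemma hnorm_vertical: "N (0, 0, c) = sqrt \<bar>c\<bar> * N e_last"
proof -
  have *: "N (0, 0, c) = sqrt c * N e_last" if "c \<ge> 0" for c
  proof -
    have "dil (sqrt c) e_last = (0, 0, c)" using that by (simp add: dil_def e_last_def)
    then show ?thesis using that hnorm_dil'[of "sqrt c" e_last] by (metis abs_of_nonneg real_sqrt_ge_zero)
  qed
  show ?thesis
  proof (cases "c \<ge> 0")
    case False
    then show ?thesis using *[of "- c"] hnorm_uminus[of "(0, 0, c)"] by simp
  qed (simp add: *)
qed

lemma hnorm_scale_H1: "N (t *\<^sub>R (x, y, 0)) = \<bar>t\<bar> * N (x, y, 0)"
proof (cases "t \<ge> 0")
  case True
  then show ?thesis using hnorm_dil'[of t "(x, y, 0)"] by (simp add: dil_def)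
next
  case False
  then show ?thesis
    using hnorm_dil'[of "- t" "(x, y, 0)"] hnorm_uminus[of "t *\<^sub>R (x, y, 0)"] by (simp add: dil_def)
qed

text \<open>For vectors that are pairwise \<omega>-orthogonal the group product is the vector sum,
  so the triangle inequality for products applies to sums.\<close>

lemma hnorm_isotropic_sum:
  assumes "finite S" and comm: "\<And>i j. i \<in> S \<Longrightarrow> j \<in> S \<Longrightarrow> omega (f i) (f j) = 0"
  shows "N (\<Sum>i\<in>S. f i) \<le> (\<Sum>i\<in>S. N (f i))"
  using assms
proof (induction S rule: finite_induct)
  case (insert i S)
  have "omega (f i) (sum f T) = 0" if "T \<subseteq> S" for T
    using finite_subset[OF that insert.hyps(1)] that
    by (induction T rule: finite_induct) (auto simp: insert.prems)
  then have "(\<Sum>j\<in>insert i S. f j) = f i \<cdot> (\<Sum>j\<in>S. f j)"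
    using insert.hyps by (simp add: hmul_eq)
  then show ?case
    using hnorm_hmul[of "f i" "\<Sum>j\<in>S. f j"] insert by simp
qed simp

text \<open>The point factors as \<open>(a, 0, 0) \<cdot> (0, b, 0) \<cdot> (0, 0, c - inner a b /
  2)\<close>, and the first two factors are isotropic sums along the axes. The bound is continuous
  and vanishes at 0, which is how continuity of \<open>d\<close> follows from its algebraic
  axioms.\<close>

lemma hnorm_upper:
  "N (a, b, c) \<le> (\<Sum>i\<in>UNIV. \<bar>a $ i\<bar> * N (axis i 1, 0, 0)) + (\<Sum>i\<in>UNIV. \<bar>b $ i\<bar> * N (0, axis i 1, 0))
     + sqrt \<bar>c - inner a b / 2\<bar> * N e_last"
proof -
  have vec_sum: "(\<Sum>i\<in>UNIV. v $ i *\<^sub>R axis i 1) = v" for v :: "real ^ 'n"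
    using basis_expansion[of v] by (simp add: scalar_mult_eq_scaleR)
  have a_eq: "(a, 0, 0) = (\<Sum>i\<in>UNIV. (a $ i) *\<^sub>R ((axis i 1, 0, 0) :: 'n heis))"
    by (simp add: prod_eq_iff fst_sum snd_sum vec_sum)
  have b_eq: "(0, b, 0) = (\<Sum>i\<in>UNIV. (b $ i) *\<^sub>R ((0, axis i 1, 0) :: 'n heis))"
    by (simp add: prod_eq_iff fst_sum snd_sum vec_sum)
  have a: "N (a, 0, 0) \<le> (\<Sum>i\<in>UNIV. \<bar>a $ i\<bar> * N (axis i 1, 0, 0))"
    using hnorm_isotropic_sum[of UNIV "\<lambda>i. (a $ i) *\<^sub>R ((axis i 1, 0, 0) :: 'n heis)"]
    by (subst a_eq) (simp add: hnorm_scale_H1 omega_altdef del: scaleR_Pair)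
  have b: "N (0, b, 0) \<le> (\<Sum>i\<in>UNIV. \<bar>b $ i\<bar> * N (0, axis i 1, 0))"
    using hnorm_isotropic_sum[of UNIV "\<lambda>i. (b $ i) *\<^sub>R ((0, axis i 1, 0) :: 'n heis)"]
    by (subst b_eq) (simp add: hnorm_scale_H1 omega_altdef del: scaleR_Pair)
  have "(a, b, c) = (a, 0, 0) \<cdot> ((0, b, 0) \<cdot> (0, 0, c - inner a b / 2))"
    by (simp add: hmul_components)
  then have "N (a, b, c) \<le> N (a, 0, 0) + (N (0, b, 0) + N (0, 0, c - inner a b / 2))"
    using hnorm_hmul[of "(a, 0, 0)" "(0, b, 0) \<cdot> (0, 0, c - inner a b / 2)"]
      hnorm_hmul[of "(0, b, 0)" "(0, 0, c - inner a b / 2)"] by simp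
  then show ?thesis using a b by (simp add: hnorm_vertical)
qed

lemma hnorm_tendsto_0:
  assumes "(f \<longlongrightarrow> 0) G"
  shows "((\<lambda>x. N (f x)) \<longlongrightarrow> 0) G"
proof -
  define u :: "'n heis \<Rightarrow> real" where
    "u p = (\<Sum>i\<in>UNIV. \<bar>fst p $ i\<bar> * N (axis i 1, 0, 0)) + (\<Sum>i\<in>UNIV. \<bar>fst (snd p) $ i\<bar> * N (0, axis i 1, 0))
     + sqrt \<bar>snd (snd p) - inner (fst p) (fst (snd p)) / 2\<bar> * N e_last" for p
  have "continuous_on UNIV u"
    unfolding u_def by (intro continuous_intros)  auto
  then have "isCont u 0" by (simp add: continuous_on_eq_continuous_at)
  then have "((\<lambda>x. u (f x)) \<longlongrightarrow> u 0) G"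
    using assms by (rule isCont_tendsto_compose)
  then have lim: "((\<lambda>x. u (f x)) \<longlongrightarrow> 0) G"
    by (simp add: u_def)
  have upper: "\<forall>x. N (f x) \<le> u (f x)"
    using hnorm_upper[of "fst (f x)" "fst (snd (f x))" "snd (snd (f x))" for x] by (simp add: u_def)
  have lower: "\<forall>x. 0 \<le> N (f x)"
    by (simp add: hnorm_nonneg)
  show ?thesis
    by (rule tendsto_sandwich[OF always_eventually[OF lower] always_eventually[OF upper] tendsto_const lim])
qed




lemma continuous_on_hnorm_UNIV: "continuous_on UNIV N"
  unfolding continuous_on_def
proof
  fix x :: "'n heis"
  have "continuous_on UNIV (\<lambda>y. hinv x \<cdot> y)" by (intro continuous_intros)
  then have "((\<lambda>y. hinv x \<cdot> y) \<longlongrightarrow> hinv x \<cdot> x) (at x)"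
    unfolding continuous_on_def by blast
  then have "((\<lambda>y. N (hinv x \<cdot> y)) \<longlongrightarrow> 0) (at x)"
    by (intro hnorm_tendsto_0) simp
  then have "((\<lambda>y. N y - N x) \<longlongrightarrow> 0) (at x)"
    by (rule tendsto_rabs_zero_cancel[OF tendsto_sandwich[OF _ _ tendsto_const], rotated 2])
      (use abs_hnorm_diff_le in \<open>auto simp: dist_eq_hnorm\<close>)
  then show "(N \<longlongrightarrow> N x) (at x)"
    by (rule LIM_zero_cancel)
qed

lemma continuous_on_hnorm [continuous_intros]:
  "continuous_on A f \<Longrightarrow> continuous_on A (\<lambda>x. N (f x))"
  using continuous_on_compose2[OF continuous_on_hnorm_UNIV] by auto

lemma continuous_on_hdist [continuous_intros]:
  assumes "continuous_on A f" "continuous_on A g"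
  shows "continuous_on A (\<lambda>x. d (f x) (g x))"
proof -
  have "(\<lambda>x. d (f x) (g x)) = (\<lambda>x. N (hinv (g x) \<cdot> f x))"
    by (intro ext dist_eq_hnorm)
  moreover have "continuous_on A (\<lambda>x. N (hinv (g x) \<cdot> f x))"
    by (intro continuous_intros assms)
  ultimately show ?thesis by (rule ssubst[where P = "continuous_on A"])
qed

text \<open>\<open>N\<close> has a positive minimum on the Euclidean unit sphere, and every nonzero
  p has a dilate on that sphere. A dilation changes the Euclidean norm by a factor between t and
  \<open>t\<^sup>2\<close>, which yields the square root for long vectors and the norm itself for
  short ones.\<close>

lemma hnorm_lower: "\<exists>m>0. \<forall>p. m * min (norm p) (sqrt (norm p)) \<le> N p"
proof -
  have "sphere 0 1 \<noteq> ({} :: 'n heis set)" by simp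
  then obtain q where q: "q \<in> sphere 0 1" and qmin: "\<And>p. p \<in> sphere 0 1 \<Longrightarrow> N q \<le> N p"
    using continuous_attains_inf[of "sphere 0 1" N] continuous_on_hnorm[OF continuous_on_id] by auto
  have "q \<noteq> 0" using q by auto
  then have "N q > 0" by (simp add: hnorm_pos_iff)
  moreover have "N q * min (norm p) (sqrt (norm p)) \<le> N p" for p
  proof (cases "p = 0")
    case False
    have cont: "continuous_on A (\<lambda>t. norm (dil t p))" for A by (intro continuous_intros)
    have nd: "norm (dil t p) = sqrt (t\<^sup>2 * ((norm (fst p))\<^sup>2 + (norm (fst (snd p)))\<^sup>2) + (t\<^sup>2)\<^sup>2 * (norm (snd (snd p)))\<^sup>2)" for t
      by (cases p) (simp add: dil_def norm_Pair power_mult_distrib algebra_simps)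
    have np: "norm p = sqrt ((norm (fst p))\<^sup>2 + (norm (fst (snd p)))\<^sup>2 + (norm (snd (snd p)))\<^sup>2)"
      by (cases p) (simp add: norm_Pair)
    show ?thesis
    proof (cases "norm p \<ge> 1")
      case True
      obtain t where t: "0 \<le> t" "t \<le> 1" "norm (dil t p) = 1"
        using IVT'[of "\<lambda>t. norm (dil t p)" 0 1 1] True cont by auto
      then have "t > 0" by (cases "t = 0") auto
      have "t\<^sup>2 * norm p \<le> norm (dil t p)"
      proof -
        have "(t\<^sup>2)\<^sup>2 * ((norm (fst p))\<^sup>2 + (norm (fst (snd p)))\<^sup>2) \<le> t\<^sup>2 * ((norm (fst p))\<^sup>2 + (norm (fst (snd p)))\<^sup>2)"
          using t by (intro mult_right_mono) (auto simp: power2_eq_square mult_le_one mult_left_le)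
        then have "sqrt ((t\<^sup>2)\<^sup>2 * ((norm (fst p))\<^sup>2 + (norm (fst (snd p)))\<^sup>2 + (norm (snd (snd p)))\<^sup>2)) \<le> norm (dil t p)"
          unfolding nd by (intro real_sqrt_le_mono) (simp add: algebra_simps)
        then show ?thesis by (simp only: np real_sqrt_mult real_sqrt_pow2 real_sqrt_abs abs_power2)
      qed
      then have "(t * sqrt (norm p))\<^sup>2 \<le> 1\<^sup>2" using t by (simp add: power_mult_distrib)
      then have "t * sqrt (norm p) \<le> 1" by (rule power2_le_imp_le) simp
      have "N q * min (norm p) (sqrt (norm p)) \<le> N q * sqrt (norm p)"
        using \<open>N q > 0\<close> by (intro mult_left_mono) auto
      also have "\<dots> \<le> N (dil t p) * sqrt (norm p)"
        using t by (intro mult_right_mono qmin) auto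
      also have "\<dots> = (t * sqrt (norm p)) * N p"
        using \<open>t > 0\<close> by (simp add: hnorm_dil)
      also have "\<dots> \<le> 1 * N p"
        using \<open>t * sqrt (norm p) \<le> 1\<close> by (intro mult_right_mono) (auto simp: hnorm_nonneg)
      finally show ?thesis by simp
    next
      case less: False
      have ge: "t * norm p \<le> norm (dil t p)" if "t \<ge> 1" for t
      proof -
        have "t\<^sup>2 * 1 \<le> t\<^sup>2 * t\<^sup>2" using that by (intro mult_left_mono) auto
        then have "t\<^sup>2 * (norm (snd (snd p)))\<^sup>2 \<le> (t\<^sup>2)\<^sup>2 * (norm (snd (snd p)))\<^sup>2"
          by (intro mult_right_mono) (auto simp: power2_eq_square)
        then have "sqrt (t\<^sup>2 * ((norm (fst p))\<^sup>2 + (norm (fst (snd p)))\<^sup>2 + (norm (snd (snd p)))\<^sup>2)) \<le> norm (dil t p)"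
          unfolding nd by (intro real_sqrt_le_mono) (simp add: algebra_simps)
        then show ?thesis using that by (simp add: np real_sqrt_mult)
      qed
      have pos: "norm p > 0" using False by simp
      obtain t where t: "1 \<le> t" "norm (dil t p) = 1"
        using IVT'[of "\<lambda>t. norm (dil t p)" 1 1 "1 / norm p"] less pos cont ge[of "1 / norm p"]
        by (auto simp: field_simps)
      have "N q * min (norm p) (sqrt (norm p)) \<le> N q * norm p"
        using \<open>N q > 0\<close> by (intro mult_left_mono) auto
      also have "\<dots> \<le> N (dil t p) * norm p"
        using t by (intro mult_right_mono qmin) auto
      also have "\<dots> = (t * norm p) * N p"
        using t by (simp add: hnorm_dil)
      also have "\<dots> \<le> 1 * N p"
        using ge[of t] t by (intro mult_right_mono) (auto simp: hnorm_nonneg)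
      finally show ?thesis by simp
    qed
  qed simp
  ultimately show ?thesis by blast
qed

lemma hnorm_small_imp_norm_small:
  assumes "e > 0"
  obtains \<eta> where "\<eta> > 0" "\<And>p. N p < \<eta> \<Longrightarrow> norm p < e"
proof -
  obtain m where m: "m > 0" "\<And>p. m * min (norm p) (sqrt (norm p)) \<le> N p"
    using hnorm_lower by blast
  show thesis
  proof
    show "0 < m * min e (sqrt e)" using m assms by simp
    fix p assume p: "N p < m * min e (sqrt e)"
    then have "m * min (norm p) (sqrt (norm p)) < m * min e (sqrt e)"
      using m(2)[of p] by linarith
    then have "min (norm p) (sqrt (norm p)) < min e (sqrt e)"
      using m(1) by simp
    then show "norm p < e"
      by (smt (verit) real_sqrt_le_mono)
  qed
qed

lemma bounded_hnorm_le: "bounded {p. N p \<le> R}"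
proof -
  obtain m where m: "m > 0" "\<And>p. m * min (norm p) (sqrt (norm p)) \<le> N p"
    using hnorm_lower by blast
  have "norm p \<le> max 1 ((R / m)\<^sup>2)" if "N p \<le> R" for p
  proof (cases "norm p \<le> 1")
    case False
    then have "sqrt (norm p) \<le> norm p"
      using mult_right_mono[of 1 "norm p" "norm p"] by (intro real_le_lsqrt) (auto simp: power2_eq_square)
    then have "m * sqrt (norm p) \<le> R" using m(2)[of p] that by (simp add: min_absorb2)
    then have "sqrt (norm p) \<le> R / m" using m(1) by (simp add: field_simps)
    then have "(sqrt (norm p))\<^sup>2 \<le> (R / m)\<^sup>2" by (intro power_mono) auto
    then show ?thesis by simp
  qed simp
  then show ?thesis unfolding bounded_iff by blast
qed

lemma hdist_small_imp_dist_small: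
  assumes "e > 0"
  obtains \<eta> where "\<eta> > 0" "\<And>y. d x y < \<eta> \<Longrightarrow> dist x y < e"
proof -
  have "continuous_on UNIV (\<lambda>z. x \<cdot> z)" by (intro continuous_intros)
  then obtain e' where e': "e' > 0" "\<And>z. dist z 0 < e' \<Longrightarrow> dist (x \<cdot> z) (x \<cdot> 0) < e"
    using assms unfolding continuous_on_iff by (metis UNIV_I)
  then obtain \<eta> where \<eta>: "\<eta> > 0" "\<And>p. N p < \<eta> \<Longrightarrow> norm p < e'"
    using hnorm_small_imp_norm_small by blast
  show thesis
  proof
    fix y assume "d x y < \<eta>"
    then have "norm (hinv x \<cdot> y) < e'" using \<eta> by (simp add: dist_eq_hnorm')
    then show "dist x y < e" using e'(2)[of "hinv x \<cdot> y"] by (simp add: Real_Vector_Spaces.dist_commute)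
  qed (rule \<eta>(1))
qed

lemma hdist_closed_pos:
  assumes "closed K" "x \<notin> K"
  shows "\<exists>\<epsilon>>0. \<forall>y\<in>K. \<epsilon> \<le> d x y"
proof -
  obtain e where e: "e > 0" "ball x e \<subseteq> - K"
    using assms open_contains_ball[of "- K"] by auto
  then obtain \<eta> where "\<eta> > 0" "\<And>y. d x y < \<eta> \<Longrightarrow> dist x y < e"
    using hdist_small_imp_dist_small by blast
  with e show ?thesis
    by (intro exI[of _ \<eta>]) (force simp: subset_iff not_less[symmetric])
qed

lemma open_hball: "open {y. d x y < r}"
  by (intro open_Collect_less continuous_intros)

lemma closed_hcball: "closed (hcball d x r)"
  unfolding hcball_def by (intro closed_Collect_le continuous_intros)

lemma hcball_borel [measurable]: "hcball d x r \<in> sets borel"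
  using closed_hcball by simp

lemma open_contains_hcball:
  assumes "open S" "x \<in> S"
  obtains \<epsilon> where "\<epsilon> > 0" "hcball d x \<epsilon> \<subseteq> S"
proof -
  obtain e where e: "e > 0" "\<forall>y\<in>-S. e \<le> d x y"
    using hdist_closed_pos[of "- S" x] assms by auto
  then have "hcball d x (e / 2) \<subseteq> S"
    by (force simp: hcball_def)
  then show thesis using that[of "e / 2"] e by simp
qed

lemma hcball_dil: "r > 0 \<Longrightarrow> dil r y \<in> hcball d (dil r z) (r * s) \<longleftrightarrow> y \<in> hcball d z s"
  by (simp add: hcball_def dist_dil)

text \<open>The bound 2r is attained: for a horizontal p of norm r the square
  \<open>p \<cdot> p\<close> equals \<open>dil 2 p\<close>, so \<open>x \<cdot> p\<close> and
  \<open>x \<cdot> hinv p\<close> are 2r apart. Hence the cost of a ball in the spherical measure is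
  exactly a power of its radius.\<close>

lemma hdiam_hcball:
  assumes "r > 0"
  shows "hdiam d (hcball d x r) = 2 * r"
proof -
  obtain i :: 'n where True by simp
  define a :: "'n heis" where "a = (axis i 1, 0, 0)"
  have "a \<noteq> 0" by (simp add: a_def prod_eq_iff axis_eq_0_iff)
  then have a: "N a > 0" by (simp add: hnorm_pos_iff)
  define p where "p = dil (r / N a) a"
  have Np: "N p = r" using a assms by (simp add: p_def hnorm_dil)
  have pp: "p \<cdot> p = dil 2 p"
    by (simp add: p_def a_def dil_def hmul_components flip: scaleR_add_left)
  have "d (x \<cdot> p) (x \<cdot> hinv p) = N (p \<cdot> p)"
    unfolding dist_left_invariant by (simp add: dist_eq_hnorm)
  also have "\<dots> = 2 * r" by (simp add: pp hnorm_dil Np)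
  finally have *: "d (x \<cdot> p) (x \<cdot> hinv p) = 2 * r" .
  have "x \<cdot> p \<in> hcball d x r" "x \<cdot> hinv p \<in> hcball d x r"
    by (auto simp: hcball_def dist_eq_hnorm' Np hnorm_hinv)
  then have "2 * r \<in> {d y z | y z. y \<in> hcball d x r \<and> z \<in> hcball d x r}"
    using *[symmetric] by blast
  moreover have "s \<le> 2 * r" if "s \<in> {d y z | y z. y \<in> hcball d x r \<and> z \<in> hcball d x r}" for s
  proof -
    obtain y z where "s = d y z" "d x y \<le> r" "d x z \<le> r"
      using \<open>s \<in> _\<close> by (auto simp: hcball_def)
    then show ?thesis using dist_triangle[of y z x] dist_commute[of x y] by linarith
  qed
  ultimately show ?thesis
    unfolding hdiam_def by (intro cSup_eq_maximum)
qed

end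

sublocale homog_dist \<subseteq> spherical: metric_covering "hdiam d" "{hcball d x r | x r. r > 0}" "Suc \<alpha>" d
  for \<alpha>
proof
  fix C x y assume C: "C \<in> {hcball d x r | x r. r > 0}" "x \<in> C" "y \<in> C"
  then obtain z r where "C = hcball d z r" "r > 0" by auto
  with C show "d x y \<le> hdiam d C"
    using dist_triangle[of x y z] by (simp add: hdiam_hcball) (simp add: hcball_def dist_commute)
next
  fix \<epsilon> :: real assume "\<epsilon> > 0"
  then show "\<exists>C\<in>{hcball d x r | x r. r > 0}. hdiam d C \<le> \<epsilon>"
    by (intro bexI[of _ "hcball d 0 (\<epsilon> / 2)"]) (auto simp: hdiam_hcball intro!: exI[of _ "\<epsilon> / 2"])
qed (use dist_triangle in \<open>auto simp: hdiam_hcball dist_commute intro: hdist_closed_pos\<close>)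

section \<open>Spherical measure and densities\<close>

lemma ennreal_le_of_factors_gt_1:
  assumes "\<And>q::real. q > 1 \<Longrightarrow> x \<le> ennreal q * y"
  shows "x \<le> y"
proof (cases y)
  case (real b)
  have "x \<noteq> top" using assms[of 2] real by (auto simp: top_unique ennreal_mult_eq_top_iff)
  then obtain a where a: "x = ennreal a" "a \<ge> 0" by (cases x) auto
  have "a \<le> q * b" if "q > 1" for q
    using assms[OF that] a real that by (simp add: ennreal_mult[symmetric])
  then have "\<forall>\<^sub>F q in at_right 1. a \<le> q * b"
    by (auto simp: eventually_at_right_less intro!: eventually_at_rightI[of 1 2])
  moreover have "((\<lambda>q. q * b) \<longlongrightarrow> 1 * b) (at_right 1)"
    by (intro tendsto_intros)
  ultimately have "a \<le> 1 * b"
    by (intro tendsto_lowerbound) auto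
  then show ?thesis using a real by simp
qed simp

context homog_dist
begin

abbreviation hS :: "nat \<Rightarrow> 'n heis set \<Rightarrow> ennreal" where
  "hS \<equiv> covering_measure (hdiam d) {hcball d x r | x r. r > 0}"

abbreviation preS :: "nat \<Rightarrow> real \<Rightarrow> 'n heis set \<Rightarrow> ennreal" where
  "preS \<equiv> covering_premeasure (hdiam d) {hcball d x r | x r. r > 0}"

lemma emeasure_spherical:
  "A \<in> sets borel \<Longrightarrow> emeasure (spherical_measure d (Suc \<alpha>)) A = hS (Suc \<alpha>) A"
  unfolding spherical_measure_def by (rule spherical.emeasure_borel_restriction_cm)

lemma sets_spherical [simp, measurable_cong]: "sets (spherical_measure d \<alpha>) = sets borel"
  by (simp add: spherical_measure_def)

lemma space_spherical [simp]: "space (spherical_measure d \<alpha>) = UNIV"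
  by (simp add: spherical_measure_def)

text \<open>Balls are kept as pairs of centre and radius because the selection compares radii. A
  maximal admissible disjoint family replaces the greedy choice by size; it is countable since its
  members have disjoint nonempty interiors.\<close>

lemma Vitali_hcball:
  fixes I :: "('n heis \<times> real) set"
  assumes I: "\<And>b. b \<in> I \<Longrightarrow> 0 < snd b \<and> snd b \<le> R"
  obtains C where "C \<subseteq> I" "countable C"
    "disjoint_family_on (\<lambda>b. hcball d (fst b) (snd b)) C"
    "\<forall>b\<in>I. \<exists>c\<in>C. hcball d (fst b) (snd b) \<inter> hcball d (fst c) (snd c) \<noteq> {} \<and> snd b \<le> 2 * snd c"
proof -
  define D where "D b = hcball d (fst b) (snd b)" for b
  \<comment> \<open>The condition speaks only of balls that already meet a member, so that it
    survives unions of chains; maximality then shows that all balls meet a member.\<close>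
  define \<Omega> where "\<Omega> = {C. C \<subseteq> I \<and> disjoint_family_on D C \<and>
     (\<forall>b\<in>I. (\<exists>c\<in>C. D b \<inter> D c \<noteq> {}) \<longrightarrow> (\<exists>c\<in>C. D b \<inter> D c \<noteq> {} \<and> snd b \<le> 2 * snd c))}"
  have "\<exists>M\<in>\<Omega>. \<forall>X\<in>\<Omega>. M \<subseteq> X \<longrightarrow> X = M"
  proof (rule subset_Zorn')
    fix \<C> assume ch: "subset.chain \<Omega> \<C>"
    show "\<Union>\<C> \<in> \<Omega>"
      unfolding \<Omega>_def
    proof (intro CollectI conjI ballI impI)
      show "\<Union>\<C> \<subseteq> I" using ch by (auto simp: subset_chain_def \<Omega>_def)
      show "disjoint_family_on D (\<Union>\<C>)"
        unfolding disjoint_family_on_def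
      proof (intro ballI impI)
        fix b c assume "b \<in> \<Union>\<C>" "c \<in> \<Union>\<C>" "b \<noteq> c"
        then obtain X Y where XY: "X \<in> \<C>" "b \<in> X" "Y \<in> \<C>" "c \<in> Y" by blast
        then have "X \<subseteq> Y \<or> Y \<subseteq> X" using ch by (simp add: subset_chain_def)
        then obtain X where "X \<in> \<C>" "b \<in> X" "c \<in> X" using XY by blast
        then show "D b \<inter> D c = {}"
          using ch \<open>b \<noteq> c\<close> by (auto simp: subset_chain_def \<Omega>_def disjoint_family_on_def)
      qed
      fix b assume b: "b \<in> I" "\<exists>c\<in>\<Union>\<C>. D b \<inter> D c \<noteq> {}"
      then obtain X c where X: "X \<in> \<C>" "c \<in> X" "D b \<inter> D c \<noteq> {}" by blast
      then have "X \<in> \<Omega>" using ch by (auto simp: subset_chain_def)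
      then have "\<exists>c\<in>X. D b \<inter> D c \<noteq> {} \<and> snd b \<le> 2 * snd c"
        using b X unfolding \<Omega>_def by blast
      then show "\<exists>c\<in>\<Union>\<C>. D b \<inter> D c \<noteq> {} \<and> snd b \<le> 2 * snd c" using X by blast
    qed
  qed
  then obtain M where M: "M \<in> \<Omega>" and max: "\<And>X. X \<in> \<Omega> \<Longrightarrow> M \<subseteq> X \<Longrightarrow> X = M" by blast
  have center: "fst b \<in> D b" if "b \<in> I" for b
    using I[OF that] by (simp add: D_def hcball_def)
  have all: "\<exists>c\<in>M. D b \<inter> D c \<noteq> {}" if "b \<in> I" for b
  proof (rule ccontr)
    assume none: "\<not> (\<exists>c\<in>M. D b \<inter> D c \<noteq> {})"
    define J where "J = {b\<in>I. \<forall>c\<in>M. D b \<inter> D c = {}}"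
    have "b \<in> J" using none that by (auto simp: J_def)
    have bdd: "bdd_above (snd ` J)" using I by (auto simp: J_def intro!: bdd_aboveI[of _ R])
    then have "snd b \<le> Sup (snd ` J)" using \<open>b \<in> J\<close> by (intro cSup_upper) auto
    then have "Sup (snd ` J) / 2 < Sup (snd ` J)" using I[OF that] by linarith
    \<comment> \<open>A radius above half the supremum makes \<open>b0\<close> a valid witness for
      every ball that \<open>M\<close> misses and that \<open>b0\<close> meets.\<close>
    then obtain b0 where b0: "b0 \<in> J" "Sup (snd ` J) / 2 < snd b0"
      using less_cSup_iff[OF _ bdd] \<open>b \<in> J\<close> by blast
    have b0I: "b0 \<in> I" and b0M: "\<And>c. c \<in> M \<Longrightarrow> D b0 \<inter> D c = {}"
      using b0 by (auto simp: J_def)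
    have "insert b0 M \<in> \<Omega>"
      unfolding \<Omega>_def
    proof (intro CollectI conjI ballI impI)
      show "insert b0 M \<subseteq> I" using b0I M by (auto simp: \<Omega>_def)
      show "disjoint_family_on D (insert b0 M)"
        using M b0M unfolding \<Omega>_def disjoint_family_on_def by blast
      fix b' assume b': "b' \<in> I" "\<exists>c\<in>insert b0 M. D b' \<inter> D c \<noteq> {}"
      show "\<exists>c\<in>insert b0 M. D b' \<inter> D c \<noteq> {} \<and> snd b' \<le> 2 * snd c"
      proof (cases "\<exists>c\<in>M. D b' \<inter> D c \<noteq> {}")
        case True
        then show ?thesis using M b' unfolding \<Omega>_def by blast
      next
        case False
        then have "b' \<in> J" using b' by (auto simp: J_def)
        then have "snd b' \<le> Sup (snd ` J)" using bdd by (intro cSup_upper) auto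
        then show ?thesis using b0 b' False by auto
      qed
    qed
    then have "b0 \<in> M" using max by blast
    then show False using b0M[of b0] center[OF b0I] by blast
  qed
  have disj: "disjoint_family_on D M" and "M \<subseteq> I" using M by (auto simp: \<Omega>_def)
  have inj: "inj_on D M"
  proof (rule inj_onI, rule ccontr)
    fix b c assume "b \<in> M" "c \<in> M" "D b = D c" "b \<noteq> c"
    then have "D b = {}" using disj unfolding disjoint_family_on_def by blast
    then show False using center[of b] \<open>b \<in> M\<close> \<open>M \<subseteq> I\<close> by auto
  qed
  have "countable (D ` M)"
  proof (rule countable_disjoint_nonempty_interior_subsets)
    show "pairwise disjnt (D ` M)"
      by (intro pairwiseI, elim imageE) (use disj in \<open>simp only: disjnt_def disjoint_family_on_def, metis\<close>)
    fix S assume "S \<in> D ` M" "interior S = {}"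
    then obtain b where b: "b \<in> M" "S = D b" by blast
    have "{y. d (fst b) y < snd b} \<subseteq> interior S"
      using b by (intro interior_maximal) (auto simp: D_def hcball_def open_hball)
    moreover have "fst b \<in> {y. d (fst b) y < snd b}" using I[of b] b \<open>M \<subseteq> I\<close> by (simp add: subset_iff)
    ultimately show "S = {}" using \<open>interior S = {}\<close> by blast
  qed
  then have "countable M" using inj by (rule countable_image_inj_on)
  show thesis
  proof (rule that[of M])
    show "\<forall>b\<in>I. \<exists>c\<in>M. hcball d (fst b) (snd b) \<inter> hcball d (fst c) (snd c) \<noteq> {} \<and> snd b \<le> 2 * snd c"
      using all M unfolding \<Omega>_def D_def by blast
  qed (use \<open>M \<subseteq> I\<close> \<open>countable M\<close> disj in \<open>auto simp: D_def[abs_def]\<close>)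
qed

text \<open>On \<open>G m\<close> the density bound holds at all radii below
  \<open>1 / (m + 1)\<close>, so a cover of that mesh costs at least the \<mu>-measure divided by t.
  The sets \<open>G m\<close> increase and exhaust A.\<close>

lemma measure_le_spherical:
  fixes \<mu> :: "'n heis measure"
  assumes sets: "sets \<mu> = sets borel" and A: "A \<in> sets borel" and t: "t > 0"
    and dens: "\<And>x. x \<in> A \<Longrightarrow> \<exists>\<epsilon>>0. \<forall>y r. 0 < r \<and> r < \<epsilon> \<and> x \<in> hcball d y r \<longrightarrow>
                 emeasure \<mu> (hcball d y r) \<le> ennreal (t * r ^ Suc \<alpha>)"
  shows "emeasure \<mu> A \<le> ennreal t * hS (Suc \<alpha>) A"
proof -
  define G where "G m = {x. \<forall>y r. 0 < r \<and> r < 1 / real (Suc m) \<and> x \<in> hcball d y r \<longrightarrow>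
                 emeasure \<mu> (hcball d y r) \<le> ennreal (t * r ^ Suc \<alpha>)}" for m
  \<comment> \<open>A violating ball still violates the strict inequality when its radius grows from
    r to a slightly larger s. The enlarged ball contains a neighbourhood of x, so it is a violation
    for all points there. Thus \<open>G m\<close> is closed, hence Borel.\<close>
  have "open (- G m)" for m
  proof (subst open_subopen, intro ballI)
    fix x assume "x \<in> - G m"
    then obtain y r where yr: "0 < r" "r < 1 / real (Suc m)" "x \<in> hcball d y r"
      "ennreal (t * r ^ Suc \<alpha>) < emeasure \<mu> (hcball d y r)"
      by (auto simp: G_def not_le)
    have "((\<lambda>s. ennreal (t * s ^ Suc \<alpha>)) \<longlongrightarrow> ennreal (t * r ^ Suc \<alpha>)) (at_right r)"
      by (intro tendsto_intros)
    then have "\<forall>\<^sub>F s in at_right r. ennreal (t * s ^ Suc \<alpha>) < emeasure \<mu> (hcball d y r)"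
      using yr(4) by (rule order_tendstoD)
    moreover have "\<forall>\<^sub>F s in at_right r. s \<in> {r<..<1 / real (Suc m)}"
      using yr(2) by (rule eventually_at_right_real)
    ultimately have "\<forall>\<^sub>F s in at_right r. ennreal (t * s ^ Suc \<alpha>) < emeasure \<mu> (hcball d y r) \<and>
        s \<in> {r<..<1 / real (Suc m)}" by eventually_elim auto
    then obtain s where s: "ennreal (t * s ^ Suc \<alpha>) < emeasure \<mu> (hcball d y r)" "r < s" "s < 1 / real (Suc m)"
      using eventually_happens'[OF trivial_limit_at_right_real] by (metis (no_types, lifting) greaterThanLessThan_iff)
    show "\<exists>T. open T \<and> x \<in> T \<and> T \<subseteq> - G m"
    proof (intro exI conjI)
      show "open {x'. d x x' < s - r}" by (rule open_hball)
      show "x \<in> {x'. d x x' < s - r}" using s by simp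
      show "{x'. d x x' < s - r} \<subseteq> - G m"
      proof
        fix x' assume "x' \<in> {x'. d x x' < s - r}"
        then have "x' \<in> hcball d y s"
          using yr(3) dist_triangle[of y x' x] by (auto simp: hcball_def)
        moreover have "ennreal (t * s ^ Suc \<alpha>) < emeasure \<mu> (hcball d y s)"
          using s(2) by (intro less_le_trans[OF s(1)] emeasure_mono) (auto simp: sets hcball_borel, simp add: hcball_def)
        ultimately show "x' \<in> - G m"
          using s yr unfolding G_def by (auto simp: not_le intro!: exI[of _ y] exI[of _ s])
      qed
    qed
  qed
  then have G_borel: "G m \<in> sets borel" for m
    by (simp add: closed_def[symmetric])
  have G_mono: "G m \<subseteq> G m'" if "m \<le> m'" for m m'
  proof -
    have "1 / real (Suc m') \<le> 1 / real (Suc m)" using that by (intro divide_left_mono) auto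
    then show ?thesis unfolding G_def by fastforce
  qed
  have A_eq: "A = (\<Union>m. A \<inter> G m)"
  proof -
    have "\<exists>m. x \<in> G m" if x: "x \<in> A" for x
    proof -
      obtain \<epsilon> where "\<epsilon> > 0" and \<epsilon>: "\<forall>y r. 0 < r \<and> r < \<epsilon> \<and> x \<in> hcball d y r \<longrightarrow>
                 emeasure \<mu> (hcball d y r) \<le> ennreal (t * r ^ Suc \<alpha>)"
        using dens[OF x] by blast
      obtain m where "1 / real (Suc m) < \<epsilon>" using \<open>\<epsilon> > 0\<close> nat_approx_posE by blast
      then have "x \<in> G m" using \<epsilon> unfolding G_def by fastforce
      then show ?thesis ..
    qed
    then show ?thesis by auto
  qed
  have part: "emeasure \<mu> (A \<inter> G m) \<le> ennreal t * hS (Suc \<alpha>) A" for m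
  proof (rule ennreal_le_epsilon)
    fix e :: real assume "e > 0" and fin: "ennreal t * hS (Suc \<alpha>) A < top"
    define \<delta> where "\<delta> = 1 / real (Suc m)"
    have "\<delta> > 0" by (simp add: \<delta>_def)
    have le: "preS (Suc \<alpha>) \<delta> A \<le> hS (Suc \<alpha>) A"
      using \<open>\<delta> > 0\<close> by (rule covering_premeasure_le_covering_measure)
    have "hS (Suc \<alpha>) A < top" using fin t by (auto simp: ennreal_mult_less_top)
    then have "preS (Suc \<alpha>) \<delta> A < hS (Suc \<alpha>) A + ennreal (e / t)"
      using le \<open>e > 0\<close> t by (intro le_less_trans[OF le] ennreal_less_add_pos) auto
    then obtain C where C: "\<And>j. C j \<in> {hcball d x r | x r. r > 0}" "\<And>j. hdiam d (C j) \<le> \<delta>"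
      "A \<subseteq> (\<Union>j. C j)" "(\<Sum>j. ennreal ((hdiam d (C j) / 2) ^ Suc \<alpha>)) < hS (Suc \<alpha>) A + ennreal (e / t)"
      by (elim covering_premeasure_approx) blast
    \<comment> \<open>Only members that meet \<open>A \<inter> G m\<close> obey the density bound,
      so the others are dropped.\<close>
    define C' where "C' j = (if C j \<inter> (A \<inter> G m) = {} then {} else C j)" for j
    have C_borel: "C j \<in> sets borel" for j using C(1)[of j] by auto
    have "emeasure \<mu> (A \<inter> G m) \<le> emeasure \<mu> (\<Union>j. C' j)"
      using C(3) C_borel by (intro emeasure_mono) (auto simp: C'_def sets, blast)
    also have "\<dots> \<le> (\<Sum>j. emeasure \<mu> (C' j))"
      using C_borel by (intro emeasure_subadditive_countably) (auto simp: C'_def sets)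
    also have "\<dots> \<le> (\<Sum>j. ennreal t * ennreal ((hdiam d (C j) / 2) ^ Suc \<alpha>))"
    proof (intro suminf_le)
      fix j
      obtain y r where yr: "C j = hcball d y r" "r > 0" using C(1)[of j] by auto
      then have diam: "hdiam d (C j) = 2 * r" by (simp add: hdiam_hcball)
      show "emeasure \<mu> (C' j) \<le> ennreal t * ennreal ((hdiam d (C j) / 2) ^ Suc \<alpha>)"
      proof (cases "C j \<inter> (A \<inter> G m) = {}")
        case False
        then obtain x where "x \<in> hcball d y r" "x \<in> G m" using yr by auto
        moreover have "r < 1 / real (Suc m)" using C(2)[of j] yr diam by (simp add: \<delta>_def)
        ultimately have "emeasure \<mu> (hcball d y r) \<le> ennreal (t * r ^ Suc \<alpha>)"
          using yr(2) unfolding G_def by blast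
        then show ?thesis
          unfolding diam using False yr t by (simp add: C'_def ennreal_mult)
      qed (simp add: C'_def)
    qed auto
    also have "\<dots> = ennreal t * (\<Sum>j. ennreal ((hdiam d (C j) / 2) ^ Suc \<alpha>))"
      by (rule ennreal_suminf_cmult)
    also have "\<dots> \<le> ennreal t * (hS (Suc \<alpha>) A + ennreal (e / t))"
      using mult_left_mono[OF less_imp_le[OF C(4)]] by simp
    also have "\<dots> = ennreal t * hS (Suc \<alpha>) A + ennreal e"
      using t \<open>e > 0\<close> by (simp add: distrib_left ennreal_mult[symmetric])
    finally show "emeasure \<mu> (A \<inter> G m) \<le> ennreal t * hS (Suc \<alpha>) A + ennreal e" .
  qed
  have "emeasure \<mu> A = emeasure \<mu> (\<Union>m. A \<inter> G m)" using A_eq by simp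
  also have "\<dots> = (SUP m. emeasure \<mu> (A \<inter> G m))"
    using A G_borel G_mono by (intro SUP_emeasure_incseq[symmetric]) (auto simp: sets incseq_def)
  also have "\<dots> \<le> ennreal t * hS (Suc \<alpha>) A"
    by (intro SUP_least part)
  finally show ?thesis .
qed

text \<open>Vitali selects disjoint heavy balls inside Q, whose total mass is at most that of Q.
  Enlarging all of them by 5 would lose a constant factor; enlarging only those from a large index
  on costs arbitrarily little, because the series of masses converges.\<close>

lemma spherical_le_open:
  fixes \<mu> :: "'n heis measure"
  assumes sets: "sets \<mu> = sets borel" and t: "t > 0"
    and O: "open Q" "A \<subseteq> Q" "emeasure \<mu> Q < top"
    and dens: "\<And>x \<epsilon>. x \<in> A \<Longrightarrow> \<epsilon> > 0 \<Longrightarrow> \<exists>y r. 0 < r \<and> r < \<epsilon> \<and> x \<in> hcball d y r \<and>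
                 ennreal (t * r ^ Suc \<alpha>) \<le> emeasure \<mu> (hcball d y r)"
  shows "ennreal t * hS (Suc \<alpha>) A \<le> emeasure \<mu> Q"
proof -
  have "ennreal t * preS (Suc \<alpha>) \<delta> A \<le> emeasure \<mu> Q" if "\<delta> > 0" for \<delta>
  proof -
    \<comment> \<open>Radius at most \<open>\<delta> / 10\<close> keeps the diameter of a 5-fold
      enlargement at most \<delta>.\<close>
    define I where "I = {b :: 'n heis \<times> real. 0 < snd b \<and> snd b \<le> \<delta> / 10 \<and> hcball d (fst b) (snd b) \<subseteq> Q \<and>
        ennreal (t * snd b ^ Suc \<alpha>) \<le> emeasure \<mu> (hcball d (fst b) (snd b))}"
    have *: "0 < snd b \<and> snd b \<le> \<delta> / 10" if "b \<in> I" for b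
      using that by (simp add: I_def)
    obtain C where C: "C \<subseteq> I" "countable C"
      "disjoint_family_on (\<lambda>b. hcball d (fst b) (snd b)) C"
      "\<forall>b\<in>I. \<exists>c\<in>C. hcball d (fst b) (snd b) \<inter> hcball d (fst c) (snd c) \<noteq> {} \<and> snd b \<le> 2 * snd c"
      by (rule Vitali_hcball[of I "\<delta> / 10"], erule *, rule that)
    define J where "J = to_nat_on C ` C"
    define b where "b = from_nat_into C"
    have bC: "b j \<in> C" if "j \<in> J" for j
      using that C(2) by (auto simp: J_def b_def)
    have b_surj: "\<exists>j\<in>J. b j = c" if "c \<in> C" for c
      using that C(2) by (auto simp: J_def b_def)
    have b_inj: "i = j" if "i \<in> J" "j \<in> J" "b i = b j" for i j
      using that C(2) by (auto simp: J_def b_def)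
    define B where "B j = hcball d (fst (b j)) (snd (b j))" for j
    have bI: "0 < snd (b j)" "snd (b j) \<le> \<delta> / 10" "B j \<subseteq> Q" 
       "ennreal (t * snd (b j) ^ Suc \<alpha>) \<le> emeasure \<mu> (B j)" if "j \<in> J" for j
      using bC[OF that] C(1) by (auto simp: I_def B_def)
    define a where "a j = (if j \<in> J then t * snd (b j) ^ Suc \<alpha> else 0)" for j
    have a_nonneg: "0 \<le> a j" for j using bI(1)[of j] t by (auto simp: a_def)
    have "(\<Sum>j. ennreal (a j)) \<le> (\<Sum>j. emeasure \<mu> (if j \<in> J then B j else {}))"
      using bI(4) by (intro suminf_le) (auto simp: a_def)
    also have "\<dots> = emeasure \<mu> (\<Union>j. if j \<in> J then B j else {})"
    proof (rule suminf_emeasure)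
      show "disjoint_family (\<lambda>j. if j \<in> J then B j else {})"
        unfolding disjoint_family_on_def
      proof (intro ballI impI)
        fix i j :: nat assume "i \<noteq> j"
        then show "(if i \<in> J then B i else {}) \<inter> (if j \<in> J then B j else {}) = {}"
          using C(3) bC[of i] bC[of j] b_inj[of i j] by (auto simp: B_def disjoint_family_on_def)
      qed
    qed (auto simp: sets B_def)
    also have "\<dots> \<le> emeasure \<mu> Q"
      using bI(3) O(1) by (intro emeasure_mono) (auto simp: sets split: if_splits)
    finally have a_le: "(\<Sum>j. ennreal (a j)) \<le> emeasure \<mu> Q" .
    then have "summable a"
      using O(3) a_nonneg by (intro summable_suminf_not_top) (auto simp: top_unique)
    show ?thesis
    proof (rule ennreal_le_epsilon)
      fix e :: real assume "e > 0"
      \<comment> \<open>The cost factor of a 5-fold enlargement; the tail from \<open>M\<close> on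
        is therefore chosen with sum below \<open>e / K\<close>.\<close>
      define K where "K = (5 :: real) ^ Suc \<alpha>"
      have "K > 0" by (simp add: K_def)
      obtain M where M: "\<And>n. n \<ge> M \<Longrightarrow> norm (\<Sum>i. a (i + n)) < e / K"
        using suminf_exist_split[OF _ \<open>summable a\<close>, of "e / K"] \<open>e > 0\<close> \<open>K > 0\<close> by auto
      define r where "r j = (if j < M then snd (b j) else 5 * snd (b j))" for j
      have r: "0 < r j" "2 * r j \<le> \<delta>" if "j \<in> J" for j
        using bI[OF that] \<open>\<delta> > 0\<close> by (auto simp: r_def)
      have cover: "A \<subseteq> (\<Union>j\<in>J. hcball d (fst (b j)) (r j))"
      proof
        fix x assume "x \<in> A"
        show "x \<in> (\<Union>j\<in>J. hcball d (fst (b j)) (r j))"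
        proof (cases "\<exists>j\<in>J. j < M \<and> x \<in> B j")
          case True
          then show ?thesis by (auto simp: B_def r_def)
        next
          \<comment> \<open>A small heavy ball containing x avoids the finitely many closed balls
            with index below \<open>M\<close>. The selected ball that it meets thus has a later
            index and is one of those enlarged.\<close>
          case False
          define F where "F = (\<Union>j\<in>J \<inter> {..<M}. B j)"
          have "closed F" unfolding F_def B_def by (intro closed_UN ballI closed_hcball) auto
          moreover have "x \<notin> F" using False by (auto simp: F_def)
          ultimately have "open (Q - F)" "x \<in> Q - F" using O \<open>x \<in> A\<close> by auto
          then obtain \<epsilon> where \<epsilon>: "\<epsilon> > 0" "hcball d x \<epsilon> \<subseteq> Q - F"
            using open_contains_hcball by blast
          obtain y s where ys: "0 < s" "s < min (\<epsilon> / 2) (\<delta> / 10)" "x \<in> hcball d y s"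
            "ennreal (t * s ^ Suc \<alpha>) \<le> emeasure \<mu> (hcball d y s)"
            using dens[OF \<open>x \<in> A\<close>, of "min (\<epsilon> / 2) (\<delta> / 10)"] \<epsilon> \<open>\<delta> > 0\<close> by auto
          have sub: "hcball d y s \<subseteq> Q - F"
          proof
            fix z assume "z \<in> hcball d y s"
            then have "z \<in> hcball d x \<epsilon>"
              using ys dist_triangle[of x z y] dist_commute[of x y] by (auto simp: hcball_def)
            then show "z \<in> Q - F" using \<epsilon> by blast
          qed
          then have "(y, s) \<in> I" using ys by (auto simp: I_def)
          then obtain c where c: "c \<in> C" "hcball d y s \<inter> hcball d (fst c) (snd c) \<noteq> {}" "s \<le> 2 * snd c"
            using C(4)[rule_format, of "(y, s)"] by (simp only: fst_conv snd_conv) blast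
          then obtain j where j: "j \<in> J" "b j = c" using b_surj by blast
          have "\<not> j < M"
            using c(2) sub j by (auto simp: F_def B_def)
          obtain z where z: "d y z \<le> s" "d (fst c) z \<le> snd c" using c(2) by (auto simp: hcball_def)
          \<comment> \<open>5 = 1 + 2 + 2: one radius to the common point z, then two steps of
            length at most s, each bounded by \<open>2 * snd c\<close>.\<close>
          have "d (fst c) x \<le> d (fst c) z + d z y + d y x"
            using dist_triangle[of "fst c" x z] dist_triangle[of z x y] by linarith
          also have "\<dots> \<le> 5 * snd c"
            using z ys(3) c(3) dist_commute[of z y] by (auto simp: hcball_def)
          finally show ?thesis
            using j \<open>\<not> j < M\<close> by (auto simp: r_def hcball_def)
        qed
      qed
      have "preS (Suc \<alpha>) \<delta> A \<le> (\<Sum>j. if j \<in> J then ennreal ((hdiam d (hcball d (fst (b j)) (r j)) / 2) ^ Suc \<alpha>) else 0)"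
        using r \<open>\<delta> > 0\<close> cover by (intro spherical.premeasure_le_partial) (auto simp: hdiam_hcball)
      also have "\<dots> = (\<Sum>j. if j \<in> J then ennreal (r j ^ Suc \<alpha>) else 0)"
        using r(1) by (intro suminf_cong) (auto simp: hdiam_hcball)
      finally have "ennreal t * preS (Suc \<alpha>) \<delta> A \<le> ennreal t * (\<Sum>j. if j \<in> J then ennreal (r j ^ Suc \<alpha>) else 0)"
        by (rule mult_left_mono) simp
      also have "\<dots> = (\<Sum>j. if j \<in> J then ennreal (t * r j ^ Suc \<alpha>) else 0)"
        using t r(1) by (subst ennreal_suminf_cmult[symmetric], intro suminf_cong)
          (auto simp: ennreal_mult less_imp_le simp del: power_Suc)
      also have "\<dots> \<le> (\<Sum>j. ennreal (a j) + ennreal (if j < M then 0 else K * a j))"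
      proof (intro suminf_le)
        fix j
        show "(if j \<in> J then ennreal (t * r j ^ Suc \<alpha>) else 0) \<le> ennreal (a j) + ennreal (if j < M then 0 else K * a j)"
          using a_nonneg[of j] by (auto simp: a_def r_def K_def power_mult_distrib algebra_simps simp del: power_Suc
              intro: order_trans[OF _ add_increasing[OF zero_le order_refl]])
      qed auto
      also have "\<dots> = (\<Sum>j. ennreal (a j)) + (\<Sum>j. ennreal (if j < M then 0 else K * a j))"
        by (rule suminf_add[symmetric]) auto
      also have "(\<Sum>j. ennreal (if j < M then 0 else K * a j)) = (\<Sum>j. ennreal (K * a (j + M)))"
        using suminf_offset[of "\<lambda>j. ennreal (if j < M then 0 else K * a j)" M] by simp
      also have "\<dots> = ennreal (\<Sum>j. K * a (j + M))"
        using \<open>summable a\<close> a_nonneg \<open>K > 0\<close>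
        by (intro suminf_ennreal2) (auto simp: summable_iff_shift intro!: summable_mult)
      also have "\<dots> \<le> ennreal e"
      proof (rule ennreal_leI)
        have "(\<Sum>j. K * a (j + M)) = K * (\<Sum>j. a (j + M))"
          using \<open>summable a\<close> by (intro suminf_mult) (simp add: summable_iff_shift)
        also have "\<dots> \<le> K * (e / K)" using M[of M] \<open>K > 0\<close> by (intro mult_left_mono) auto
        finally show "(\<Sum>j. K * a (j + M)) \<le> e" using \<open>K > 0\<close> by simp
      qed
      finally show "ennreal t * preS (Suc \<alpha>) \<delta> A \<le> emeasure \<mu> Q + ennreal e"
        using a_le by (meson add_mono order_refl order_trans)
    qed
  qed
  then show ?thesis
    unfolding covering_measure_eq_SUP by (subst SUP_mult_left_ennreal) (auto intro!: SUP_least)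
qed

text \<open>The preceding lemma bounds by the mass of an open superset, and outer regularity shrinks
  that superset to A. Outer regularity is applied to finite measures, so A is cut along countably
  many open sets of finite mass and \<mu> is restricted to each.\<close>

lemma spherical_le_measure:
  fixes \<mu> :: "'n heis measure"
  assumes sets: "sets \<mu> = sets borel" and A: "A \<in> sets borel" and t: "t > 0"
    and fin: "\<And>x. x \<in> A \<Longrightarrow> \<exists>Q. open Q \<and> x \<in> Q \<and> emeasure \<mu> Q < top"
    and dens: "\<And>x \<epsilon>. x \<in> A \<Longrightarrow> \<epsilon> > 0 \<Longrightarrow> \<exists>y r. 0 < r \<and> r < \<epsilon> \<and> x \<in> hcball d y r \<and>
                 ennreal (t * r ^ Suc \<alpha>) \<le> emeasure \<mu> (hcball d y r)"
  shows "ennreal t * hS (Suc \<alpha>) A \<le> emeasure \<mu> A"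
proof -
  obtain \<Q> where \<Q>: "\<Q> \<subseteq> {Q. open Q \<and> emeasure \<mu> Q < top}" "countable \<Q>"
      "\<Union>\<Q> = \<Union>{Q. open Q \<and> emeasure \<mu> Q < top}"
    using Lindelof[of "{Q. open Q \<and> emeasure \<mu> Q < top}"] by blast
  define Q where "Q i = (if \<Q> = {} then {} else from_nat_into \<Q> i)" for i
  have Q: "open (Q i)" "emeasure \<mu> (Q i) < top" for i
    using from_nat_into[of \<Q> i] \<Q>(1) by (auto simp: Q_def)
  have cover: "A \<subseteq> (\<Union>i. Q i)"
  proof
    fix x assume "x \<in> A"
    then obtain X where "X \<in> \<Q>" "x \<in> X" using fin \<Q>(3) by blast
    then show "x \<in> (\<Union>i. Q i)"
      using from_nat_into_surj[OF \<Q>(2)] by (force simp: Q_def)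
  qed
  define E where "E i = A \<inter> disjointed Q i" for i
  have dQ: "disjointed Q i \<in> sets borel" for i
    using sets.range_disjointed_sets[of Q borel] Q(1) by (auto simp: image_subset_iff)
  have E_borel: "E i \<in> sets borel" for i
    using A dQ by (simp add: E_def)
  have E_sub: "E i \<subseteq> Q i" for i
    using disjointed_subset[of Q i] by (auto simp: E_def)
  have E_Un: "(\<Union>i. E i) = A"
    using cover UN_disjointed_eq[of Q] by (auto simp: E_def)
  have E_disj: "disjoint_family E"
    using disjoint_family_disjointed[of Q] by (auto simp: E_def disjoint_family_on_def)
  have part: "ennreal t * hS (Suc \<alpha>) (E i) \<le> emeasure \<mu> (E i)" for i
  proof -
    define \<mu>' where "\<mu>' = density \<mu> (indicator (Q i))"
    have ind: "indicator (Q i) \<in> borel_measurable \<mu>"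
      using Q(1)[of i] by (intro borel_measurable_indicator) (simp add: sets)
    have \<mu>': "emeasure \<mu>' X = emeasure \<mu> (Q i \<inter> X)" if "X \<in> sets borel" for X
      using that Q(1)[of i] unfolding \<mu>'_def
      by (subst emeasure_density[OF ind])
        (auto simp: sets Int_commute indicator_inter_arith[symmetric] intro!: nn_integral_indicator)
    have sets': "sets \<mu>' = sets borel" by (simp add: \<mu>'_def sets)
    have "emeasure \<mu>' (space \<mu>') \<noteq> \<infinity>"
      using \<mu>'[of UNIV] Q(2)[of i] sets_eq_imp_space_eq[OF sets'] by simp
    then have "emeasure \<mu>' (E i) = (INF U \<in> {U. E i \<subseteq> U \<and> open U}. emeasure \<mu>' U)"
      by (rule outer_regular[OF sets' _ E_borel])
    moreover have "ennreal t * hS (Suc \<alpha>) (E i) \<le> (INF U \<in> {U. E i \<subseteq> U \<and> open U}. emeasure \<mu>' U)"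
    proof (rule INF_greatest)
      fix U assume "U \<in> {U. E i \<subseteq> U \<and> open U}"
      then have U: "E i \<subseteq> U" "open U" by auto
      have "ennreal t * hS (Suc \<alpha>) (E i) \<le> emeasure \<mu> (Q i \<inter> U)"
      proof (rule spherical_le_open[OF sets t])
        show "open (Q i \<inter> U)" using Q U by auto
        show "E i \<subseteq> Q i \<inter> U" using E_sub U by auto
        have "emeasure \<mu> (Q i \<inter> U) \<le> emeasure \<mu> (Q i)"
          using Q(1) by (intro emeasure_mono) (auto simp: sets)
        then show "emeasure \<mu> (Q i \<inter> U) < top" using Q(2)[of i] by (rule le_less_trans)
      qed (rule dens, auto simp: E_def)
      then show "ennreal t * hS (Suc \<alpha>) (E i) \<le> emeasure \<mu>' U" using \<mu>' U by simp
    qed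
    moreover have "emeasure \<mu>' (E i) = emeasure \<mu> (E i)"
      using E_sub[of i] E_borel[of i] by (simp add: \<mu>' Int_absorb1)
    ultimately show ?thesis by simp
  qed
  have "ennreal t * hS (Suc \<alpha>) A \<le> ennreal t * (\<Sum>i. hS (Suc \<alpha>) (E i))"
    using spherical.cm_countably_subadditive[of \<alpha> E] by (intro mult_left_mono) (auto simp: E_Un)
  also have "\<dots> = (\<Sum>i. ennreal t * hS (Suc \<alpha>) (E i))"
    by simp
  also have "\<dots> \<le> (\<Sum>i. emeasure \<mu> (E i))"
    by (intro suminf_le part) auto
  also have "\<dots> = emeasure \<mu> A"
    using E_borel E_disj by (subst suminf_emeasure) (auto simp: sets E_Un)
  finally show ?thesis .
qed

text \<open>Since the upper density bound is locally uniform, \<open>\<beta>\<close> is upper semicontinuous on \<open>B\<close> and hence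
  measurable.\<close>

theorem measure_eq_integral_spherical_density:
  fixes \<mu> :: "'n heis measure" and \<beta> :: "'n heis \<Rightarrow> ennreal"
  assumes sets: "sets \<mu> = sets borel" and B: "B \<in> sets borel"
    and pos: "\<And>x. x \<in> B \<Longrightarrow> 0 < \<beta> x" and fin: "\<And>x. x \<in> B \<Longrightarrow> \<beta> x < top"
    and upper: "\<And>x t. x \<in> B \<Longrightarrow> t > 0 \<Longrightarrow> \<beta> x < ennreal t \<Longrightarrow>
      \<exists>\<epsilon>>0. \<forall>y r. 0 < r \<and> r < \<epsilon> \<and> d x y < \<epsilon> \<longrightarrow> emeasure \<mu> (hcball d y r) \<le> ennreal (t * r ^ Suc \<alpha>)"
    and lower: "\<And>x t \<epsilon>. x \<in> B \<Longrightarrow> t > 0 \<Longrightarrow> ennreal t < \<beta> x \<Longrightarrow> \<epsilon> > 0 \<Longrightarrow>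
      \<exists>y r. 0 < r \<and> r < \<epsilon> \<and> x \<in> hcball d y r \<and> ennreal (t * r ^ Suc \<alpha>) \<le> emeasure \<mu> (hcball d y r)"
  shows "emeasure \<mu> B = (\<integral>\<^sup>+ x \<in> B. \<beta> x \<partial>spherical_measure d (Suc \<alpha>))"
proof -
  have less_borel: "{x\<in>B. \<beta> x < c} \<in> sets borel" for c
  proof -
    have "\<exists>Q. open Q \<and> x \<in> Q \<and> (\<forall>x'\<in>Q \<inter> B. \<beta> x' < c)" if x: "x \<in> B" "\<beta> x < c" for x
    proof -
      obtain c' where c': "\<beta> x < c'" "c' < c" using dense x(2) by blast
      then have "0 < c'" "c' < top"
        using pos[OF x(1)] less_le_trans[OF c'(2) top_greatest] by auto
      then obtain t where t: "c' = ennreal t" "t > 0"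
        by (cases c') auto
      obtain \<epsilon> where \<epsilon>: "\<epsilon> > 0" "\<And>y r. 0 < r \<Longrightarrow> r < \<epsilon> \<Longrightarrow> d x y < \<epsilon> \<Longrightarrow>
          emeasure \<mu> (hcball d y r) \<le> ennreal (t * r ^ Suc \<alpha>)"
        using upper[OF x(1) t(2)] c' t by blast
      \<comment> \<open>All small balls near x have density at most t, which is below c. If \<beta>
        reached c at x', the lower bound there would give such a ball with density at least t' >
        t.\<close>
      have "\<beta> x' < c" if x': "x' \<in> B" "d x x' < \<epsilon> / 2" for x'
      proof (rule ccontr)
        assume "\<not> \<beta> x' < c"
        then have "ennreal t < \<beta> x'" using c' t by auto
        then obtain c'' where c'': "ennreal t < c''" "c'' < \<beta> x'" using dense by blast
        then obtain t' where t': "c'' = ennreal t'" "t < t'"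
          using t(2) by (cases c'') (auto simp: ennreal_less_iff)
        obtain y r where yr: "0 < r" "r < \<epsilon> / 2" "x' \<in> hcball d y r"
           "ennreal (t' * r ^ Suc \<alpha>) \<le> emeasure \<mu> (hcball d y r)"
          using lower[OF x'(1), of t' "\<epsilon> / 2"] c'' t' t(2) \<epsilon>(1) by auto
        have "d x y < \<epsilon>"
          using dist_triangle[of x y x'] dist_commute[of x' y] yr x' by (auto simp: hcball_def)
        then have "ennreal (t' * r ^ Suc \<alpha>) \<le> ennreal (t * r ^ Suc \<alpha>)"
          using yr \<epsilon> by (intro order_trans[OF yr(4) \<epsilon>(2)]) auto
        then have "t' * r ^ Suc \<alpha> \<le> t * r ^ Suc \<alpha>"
          using t(2) yr(1) by (subst (asm) ennreal_le_iff) auto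
        then show False using t'(2) yr(1) by simp
      qed
      then show ?thesis
        using \<epsilon>(1) by (intro exI[of _ "{x'. d x x' < \<epsilon> / 2}"] conjI open_hball) auto
    qed
    then obtain Q where Q: "\<And>x. x \<in> B \<Longrightarrow> \<beta> x < c \<Longrightarrow> open (Q x) \<and> x \<in> Q x \<and> (\<forall>x'\<in>Q x \<inter> B. \<beta> x' < c)"
      by metis
    have eq: "{x\<in>B. \<beta> x < c} = B \<inter> (\<Union>x\<in>{x\<in>B. \<beta> x < c}. Q x)"
      using Q by blast
    have "open (\<Union>x\<in>{x\<in>B. \<beta> x < c}. Q x)"
      using Q by (intro open_UN) auto
    then show ?thesis
      by (subst eq) (intro sets.Int B borel_open)
  qed
  define \<sigma> where "\<sigma> = spherical_measure d (Suc \<alpha>)"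
  have [simp]: "sets \<sigma> = sets borel" "space \<sigma> = UNIV" by (auto simp: \<sigma>_def)
  have meas: "(\<lambda>x. \<beta> x * indicator B x) \<in> borel_measurable \<sigma>"
  proof (rule borel_measurableI_less)
    fix c
    have "{x \<in> space \<sigma>. \<beta> x * indicator B x < c} = {x\<in>B. \<beta> x < c} \<union> (if 0 < c then - B else {})"
      by (auto simp: indicator_def split: if_splits)
    then show "{x \<in> space \<sigma>. \<beta> x * indicator B x < c} \<in> sets \<sigma>"
      using less_borel[of c] B by auto
  qed
  define \<tau> where "\<tau> = density \<sigma> (\<lambda>x. \<beta> x * indicator B x)"
  have sets_\<tau>: "sets \<tau> = sets borel" by (simp add: \<tau>_def)
  have \<tau>: "emeasure \<tau> E = (\<integral>\<^sup>+ x. \<beta> x * indicator E x \<partial>\<sigma>)" if "E \<in> sets borel" "E \<subseteq> B" for E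
    unfolding \<tau>_def using that meas
    by (subst emeasure_density) (auto intro!: nn_integral_cong simp: indicator_def)
  \<comment> \<open>The measures are compared on the layers where \<beta> lies between consecutive
    powers of q; letting q tend to 1 removes the loss.\<close>
  have bounds: "emeasure \<mu> B \<le> ennreal q * emeasure \<tau> B \<and> emeasure \<tau> B \<le> ennreal (q\<^sup>2) * emeasure \<mu> B"
    if q: "q > 1" for q
  proof -
    define c where "c j = q powr real_of_int j" for j
    have c_pos: "c j > 0" for j using q by (simp add: c_def)
    have c_Suc: "c (j + 1) = q * c j" and c_pred: "c (j - 1) = c j / q" for j
      using q by (simp_all add: c_def powr_add powr_diff)
    \<comment> \<open>Small values of \<beta> require negative exponents, so the layers are indexed
      by all integers; \<open>int_decode\<close> arranges them in a sequence.\<close>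
    define E where "E n = (let j = int_decode n in {x\<in>B. \<beta> x < ennreal (c (j + 1))} - {x\<in>B. \<beta> x < ennreal (c j)})" for n
    have E_borel: "E n \<in> sets borel" for n
      unfolding E_def Let_def by (intro sets.Diff less_borel)
    have E_sub: "E n \<subseteq> B" for n by (auto simp: E_def Let_def)
    have E_eq: "x \<in> E n \<longleftrightarrow> int_decode n = \<lfloor>log q (enn2real (\<beta> x))\<rfloor>" if x: "x \<in> B" for x n
    proof -
      obtain b where b: "\<beta> x = ennreal b" "b > 0"
        using pos[OF x] fin[OF x] by (cases "\<beta> x") auto
      have "x \<in> E n \<longleftrightarrow> c (int_decode n) \<le> b \<and> b < c (int_decode n + 1)"
        using x b c_pos by (auto simp: E_def Let_def ennreal_less_iff not_less)
      also have "\<dots> \<longleftrightarrow> int_decode n = \<lfloor>log q b\<rfloor>"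
        using q b unfolding c_def
        by (subst le_log_iff[symmetric], simp, simp, subst log_less_iff[symmetric], simp, simp) (simp add: floor_eq_iff eq_commute[of "int_decode n"])
      finally show ?thesis using b by simp
    qed
    have disj: "disjoint_family E"
      unfolding disjoint_family_on_def
    proof (intro ballI impI)
      fix m n :: nat assume "m \<noteq> n"
      then have ne: "int_decode m \<noteq> int_decode n" using inj_eq[OF inj_int_decode] by simp
      show "E m \<inter> E n = {}"
      proof (rule equals0I)
        fix x assume "x \<in> E m \<inter> E n"
        then have x: "x \<in> E m" "x \<in> E n" by simp_all
        then have "x \<in> B" using E_sub[of m] by (simp add: subset_iff)
        then show False using x ne by (simp only: E_eq)
      qed
    qed
    have Un: "(\<Union>n. E n) = B"
    proof (intro equalityI subsetI)
      fix x assume "x \<in> B"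
      then have "x \<in> E (int_encode \<lfloor>log q (enn2real (\<beta> x))\<rfloor>)" by (subst E_eq) auto
      then show "x \<in> (\<Union>n. E n)" by blast
    qed (use E_sub in blast)
    have E_bounds: "emeasure \<mu> (E n) \<le> ennreal q * emeasure \<tau> (E n) \<and> emeasure \<tau> (E n) \<le> ennreal (q\<^sup>2) * emeasure \<mu> (E n)" for n
    proof -
      define j where "j = int_decode n"
      have En: "x \<in> B" "\<beta> x < ennreal (c (j + 1))" "ennreal (c j) \<le> \<beta> x" if "x \<in> E n" for x
        using that by (auto simp: E_def j_def Let_def)
      have em: "emeasure \<sigma> (E n) = hS (Suc \<alpha>) (E n)"
        unfolding \<sigma>_def by (rule emeasure_spherical[OF E_borel])
      have 1: "emeasure \<mu> (E n) \<le> ennreal (c (j + 1)) * emeasure \<sigma> (E n)"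
        unfolding em
      proof (rule measure_le_spherical[OF sets E_borel c_pos])
        fix x assume x: "x \<in> E n"
        obtain \<epsilon> where \<epsilon>: "\<epsilon> > 0" "\<And>y r. 0 < r \<Longrightarrow> r < \<epsilon> \<Longrightarrow> d x y < \<epsilon> \<Longrightarrow>
            emeasure \<mu> (hcball d y r) \<le> ennreal (c (j + 1) * r ^ Suc \<alpha>)"
          using upper[OF En(1)[OF x] c_pos En(2)[OF x]] by blast
        then show "\<exists>\<epsilon>>0. \<forall>y r. 0 < r \<and> r < \<epsilon> \<and> x \<in> hcball d y r \<longrightarrow>
            emeasure \<mu> (hcball d y r) \<le> ennreal (c (j + 1) * r ^ Suc \<alpha>)"
          by (intro exI[of _ \<epsilon>]) (auto simp: hcball_def dist_commute)
      qed
      \<comment> \<open>The level is \<open>j - 1\<close> because \<open>lower\<close> needs a value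
        strictly below \<beta>, which may equal \<open>c j\<close>. This causes the square of q in
        the bound on \<tau>.\<close>
      have 2: "ennreal (c (j - 1)) * emeasure \<sigma> (E n) \<le> emeasure \<mu> (E n)"
        unfolding em
      proof (rule spherical_le_measure[OF sets E_borel c_pos])
        fix x assume x: "x \<in> E n"
        obtain \<epsilon> where \<epsilon>: "\<epsilon> > 0" "\<And>y r. 0 < r \<Longrightarrow> r < \<epsilon> \<Longrightarrow> d x y < \<epsilon> \<Longrightarrow>
            emeasure \<mu> (hcball d y r) \<le> ennreal (c (j + 1) * r ^ Suc \<alpha>)"
          using upper[OF En(1)[OF x] c_pos En(2)[OF x]] by blast
        have "emeasure \<mu> {y. d x y < \<epsilon> / 2} \<le> emeasure \<mu> (hcball d x (\<epsilon> / 2))"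
          by (rule emeasure_mono) (simp add: hcball_def subset_iff, simp add: sets hcball_borel)
        also have "\<dots> \<le> ennreal (c (j + 1) * (\<epsilon> / 2) ^ Suc \<alpha>)" using \<epsilon> by (intro \<epsilon>) auto
        also have "\<dots> < top" by simp
        finally show "\<exists>Q. open Q \<and> x \<in> Q \<and> emeasure \<mu> Q < top"
          using \<epsilon>(1) by (intro exI[of _ "{y. d x y < \<epsilon> / 2}"] conjI open_hball) auto
        fix \<epsilon> :: real assume "\<epsilon> > 0"
        have "ennreal (c (j - 1)) < ennreal (c j)"
          using q c_pos[of j] by (auto simp: c_pred ennreal_less_iff field_simps)
        then show "\<exists>y r. 0 < r \<and> r < \<epsilon> \<and> x \<in> hcball d y r \<and>
                 ennreal (c (j - 1) * r ^ Suc \<alpha>) \<le> emeasure \<mu> (hcball d y r)"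
          using En(3)[OF x] by (intro lower En(1)[OF x] c_pos \<open>\<epsilon> > 0\<close>) auto
      qed
      have 3: "ennreal (c j) * emeasure \<sigma> (E n) \<le> emeasure \<tau> (E n)"
      proof -
        have "ennreal (c j) * emeasure \<sigma> (E n) = (\<integral>\<^sup>+x. ennreal (c j) * indicator (E n) x \<partial>\<sigma>)"
          using E_borel by (subst nn_integral_cmult_indicator) auto
        also have "\<dots> \<le> emeasure \<tau> (E n)"
          unfolding \<tau>[OF E_borel E_sub] using En(3) by (intro nn_integral_mono) (auto simp: indicator_def)
        finally show ?thesis .
      qed
      have 4: "emeasure \<tau> (E n) \<le> ennreal (c (j + 1)) * emeasure \<sigma> (E n)"
      proof -
        have "ennreal (c (j + 1)) * emeasure \<sigma> (E n) = (\<integral>\<^sup>+x. ennreal (c (j + 1)) * indicator (E n) x \<partial>\<sigma>)"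
          using E_borel by (subst nn_integral_cmult_indicator) auto
        moreover have "emeasure \<tau> (E n) \<le> \<dots>"
          unfolding \<tau>[OF E_borel E_sub] using En(2) by (intro nn_integral_mono) (auto simp: indicator_def less_imp_le)
        ultimately show ?thesis by simp
      qed
      have "emeasure \<mu> (E n) \<le> ennreal q * (ennreal (c j) * emeasure \<sigma> (E n))"
        using 1 q c_pos[of j] by (simp add: c_Suc ennreal_mult mult.assoc)
      also have "\<dots> \<le> ennreal q * emeasure \<tau> (E n)"
        by (intro mult_left_mono 3) auto
      finally have "emeasure \<mu> (E n) \<le> ennreal q * emeasure \<tau> (E n)" .
      moreover have "c (j + 1) = q\<^sup>2 * c (j - 1)"
        using q by (simp add: c_Suc c_pred power2_eq_square)
      then have "emeasure \<tau> (E n) \<le> ennreal (q\<^sup>2) * (ennreal (c (j - 1)) * emeasure \<sigma> (E n))"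
        using 4 q c_pos[of "j - 1"] by (simp add: ennreal_mult mult.assoc)
      then have "emeasure \<tau> (E n) \<le> ennreal (q\<^sup>2) * emeasure \<mu> (E n)"
        by (rule order_trans) (intro mult_left_mono 2, auto)
      ultimately show ?thesis by simp
    qed
    have \<mu>B: "emeasure \<mu> B = (\<Sum>n. emeasure \<mu> (E n))" and \<tau>B: "emeasure \<tau> B = (\<Sum>n. emeasure \<tau> (E n))"
      using E_borel disj by (auto simp: sets sets_\<tau> Un[symmetric] image_subset_iff intro!: suminf_emeasure[symmetric])
    have "emeasure \<mu> B \<le> (\<Sum>n. ennreal q * emeasure \<tau> (E n))"
      unfolding \<mu>B using E_bounds by (intro suminf_le) auto
    moreover have "emeasure \<tau> B \<le> (\<Sum>n. ennreal (q\<^sup>2) * emeasure \<mu> (E n))"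
      unfolding \<tau>B using E_bounds by (intro suminf_le) auto
    ultimately show ?thesis by (simp add: \<mu>B[symmetric] \<tau>B[symmetric])
  qed
  have "emeasure \<mu> B = emeasure \<tau> B"
  proof (rule antisym)
    show "emeasure \<mu> B \<le> emeasure \<tau> B"
      by (rule ennreal_le_of_factors_gt_1) (rule bounds[THEN conjunct1])
    show "emeasure \<tau> B \<le> emeasure \<mu> B"
    proof (rule ennreal_le_of_factors_gt_1)
      fix q :: real assume "q > 1"
      then show "emeasure \<tau> B \<le> ennreal q * emeasure \<mu> B"
        using bounds[of "sqrt q", THEN conjunct2] by simp
    qed
  qed
  also have "\<dots> = (\<integral>\<^sup>+ x \<in> B. \<beta> x \<partial>\<sigma>)" using B by (intro \<tau>) auto
  finally show ?thesis by (simp add: \<sigma>_def)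
qed

end

section \<open>Euclidean Hausdorff measure on subspaces\<close>

abbreviation pre_hausdorff :: "nat \<Rightarrow> 'a::euclidean_space set \<Rightarrow> ennreal" where
  "pre_hausdorff p \<equiv> covering_measure diameter {C. bounded C} p"

lemma metric_covering_diameter:
  assumes "p > 0"
  shows "metric_covering diameter {C :: 'a::euclidean_space set. bounded C} p dist"
proof
  show "\<exists>C\<in>{C :: 'a set. bounded C}. diameter C \<le> \<epsilon>" if "\<epsilon> > 0" for \<epsilon> :: real
    using that by (intro bexI[of _ "{}"]) auto
  show "\<exists>\<epsilon>>0. \<forall>y\<in>K. \<epsilon> \<le> dist x y" if "closed K" "x \<notin> K" for K and x :: 'a
    using separate_point_closed[OF that] by blast
qed (use assms in \<open>auto intro: diameter_ge_0 diameter_bounded_bound Real_Vector_Spaces.dist_commute dist_triangle\<close>)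

text \<open>Phrased for two maps on one index set, so that no inverse of g is formed: a cover of the
  image of g is pulled back to X and pushed forward by f, and diameters grow at most by the factor
  c.\<close>

lemma pre_hausdorff_Lipschitz_le:
  fixes f :: "'b \<Rightarrow> 'a::euclidean_space" and g :: "'b \<Rightarrow> 'c::euclidean_space"
  assumes "c > 0" and Lip: "\<And>x y. x \<in> X \<Longrightarrow> y \<in> X \<Longrightarrow> dist (f x) (f y) \<le> c * dist (g x) (g y)"
  shows "pre_hausdorff p (f ` X) \<le> ennreal (c ^ p) * pre_hausdorff p (g ` X)"
proof (rule covering_measure_leI, rule ennreal_le_epsilon)
  fix \<delta> \<eta> :: real
  assume "\<delta> > 0" "\<eta> > 0" and fin: "ennreal (c ^ p) * pre_hausdorff p (g ` X) < top"
  have "pre_hausdorff p (g ` X) < top"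
    using fin \<open>c > 0\<close> by (auto simp: ennreal_mult_less_top)
  then have "covering_premeasure diameter {C. bounded C} p (\<delta> / c) (g ` X) < pre_hausdorff p (g ` X) + ennreal (\<eta> / c ^ p)"
    using \<open>c > 0\<close> \<open>\<delta> > 0\<close> \<open>\<eta> > 0\<close>
    by (intro le_less_trans[OF covering_premeasure_le_covering_measure ennreal_less_add_pos]) auto
  then obtain C where C: "\<And>j. C j \<in> {C. bounded C}" "\<And>j. diameter (C j) \<le> \<delta> / c" "g ` X \<subseteq> (\<Union>j. C j)"
    "(\<Sum>j. ennreal ((diameter (C j) / 2) ^ p)) < pre_hausdorff p (g ` X) + ennreal (\<eta> / c ^ p)"
    by (elim covering_premeasure_approx) blast
  define C' where "C' j = f ` (X \<inter> g -` C j)" for j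
  have dist_le: "dist x y \<le> c * diameter (C j)" if xy: "x \<in> C' j" "y \<in> C' j" for x y j
  proof -
    obtain x' y' where *: "x' \<in> X" "y' \<in> X" "g x' \<in> C j" "g y' \<in> C j" "x = f x'" "y = f y'"
      using xy by (auto simp: C'_def)
    have "dist x y \<le> c * dist (g x') (g y')" using * Lip by auto
    also have "\<dots> \<le> c * diameter (C j)"
      using * C(1)[of j] \<open>c > 0\<close> by (intro mult_left_mono diameter_bounded_bound) auto
    finally show ?thesis .
  qed
  have diam: "diameter (C' j) \<le> c * diameter (C j)" for j
    using C(1)[of j] \<open>c > 0\<close> dist_le
    by (intro diameter_le) (auto simp: dist_norm diameter_ge_0)
  have bdd: "bounded (C' j)" for j
  proof (cases "C' j = {}")
    case False
    then obtain x where "x \<in> C' j" by blast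
    then show ?thesis
      using dist_le unfolding bounded_def by blast
  qed simp
  have "covering_premeasure diameter {C. bounded C} p \<delta> (f ` X) \<le> (\<Sum>j. ennreal ((diameter (C' j) / 2) ^ p))"
  proof (rule covering_premeasure_le)
    show "C' j \<in> {C. bounded C}" for j using bdd by simp
    show "f ` X \<subseteq> (\<Union>j. C' j)" using C(3) by (fastforce simp: C'_def)
    show "diameter (C' j) \<le> \<delta>" for j
    proof -
      have "c * diameter (C j) \<le> c * (\<delta> / c)" using C(2)[of j] \<open>c > 0\<close> by (intro mult_left_mono) auto
      then show ?thesis using diam[of j] \<open>c > 0\<close> by simp
    qed
  qed
  also have "\<dots> \<le> (\<Sum>j. ennreal (c ^ p) * ennreal ((diameter (C j) / 2) ^ p))"
  proof (intro suminf_le)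
    fix j
    have "(diameter (C' j) / 2) ^ p \<le> (c * diameter (C j) / 2) ^ p"
      using diam[of j] bdd[of j] by (intro power_mono) (auto simp: diameter_ge_0)
    also have "\<dots> = c ^ p * (diameter (C j) / 2) ^ p" by (simp add: power_mult_distrib power_divide)
    finally show "ennreal ((diameter (C' j) / 2) ^ p) \<le> ennreal (c ^ p) * ennreal ((diameter (C j) / 2) ^ p)"
      using \<open>c > 0\<close> by (simp add: ennreal_mult'[symmetric] ennreal_leI)
  qed auto
  also have "\<dots> = ennreal (c ^ p) * (\<Sum>j. ennreal ((diameter (C j) / 2) ^ p))"
    by (rule ennreal_suminf_cmult)
  also have "\<dots> \<le> ennreal (c ^ p) * (pre_hausdorff p (g ` X) + ennreal (\<eta> / c ^ p))"
    by (rule mult_left_mono[OF less_imp_le[OF C(4)]]) simp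
  also have "\<dots> = ennreal (c ^ p) * pre_hausdorff p (g ` X) + ennreal \<eta>"
    using \<open>c > 0\<close> \<open>\<eta> > 0\<close> by (simp add: distrib_left ennreal_mult[symmetric])
  finally show "covering_premeasure diameter {C. bounded C} p \<delta> (f ` X) \<le>
      ennreal (c ^ p) * pre_hausdorff p (g ` X) + ennreal \<eta>" .
qed

lemma pre_hausdorff_similarity:
  fixes f :: "'b \<Rightarrow> 'a::euclidean_space" and g :: "'b \<Rightarrow> 'c::euclidean_space"
  assumes "c > 0" and sim: "\<And>x y. x \<in> X \<Longrightarrow> y \<in> X \<Longrightarrow> dist (f x) (f y) = c * dist (g x) (g y)"
  shows "pre_hausdorff p (f ` X) = ennreal (c ^ p) * pre_hausdorff p (g ` X)"
proof (rule antisym)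
  show "pre_hausdorff p (f ` X) \<le> ennreal (c ^ p) * pre_hausdorff p (g ` X)"
    using assms by (intro pre_hausdorff_Lipschitz_le) auto
  have "pre_hausdorff p (g ` X) \<le> ennreal ((1 / c) ^ p) * pre_hausdorff p (f ` X)"
    using assms by (intro pre_hausdorff_Lipschitz_le) auto
  then have "ennreal (c ^ p) * pre_hausdorff p (g ` X) \<le> ennreal (c ^ p) * (ennreal ((1 / c) ^ p) * pre_hausdorff p (f ` X))"
    by (rule mult_left_mono) simp
  also have "\<dots> = pre_hausdorff p (f ` X)"
    using \<open>c > 0\<close> by (simp add: mult.assoc[symmetric] ennreal_mult'[symmetric] power_divide)
  finally show "ennreal (c ^ p) * pre_hausdorff p (g ` X) \<le> pre_hausdorff p (f ` X)" .
qed

lemma hausdorff_E_similarity: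
  fixes f g :: "'b \<Rightarrow> 'a::euclidean_space"
  assumes "c > 0" and "\<And>x y. x \<in> X \<Longrightarrow> y \<in> X \<Longrightarrow> dist (f x) (f y) = c * dist (g x) (g y)"
  shows "hausdorff_E p (f ` X) = ennreal (c ^ p) * hausdorff_E p (g ` X)"
  unfolding hausdorff_E_def by (subst pre_hausdorff_similarity[OF assms]) (auto simp: ennreal_times_divide)

lemma hausdorff_E_isometry:
  fixes f g :: "'b \<Rightarrow> 'a::euclidean_space"
  assumes "\<And>x y. x \<in> X \<Longrightarrow> y \<in> X \<Longrightarrow> dist (f x) (f y) = dist (g x) (g y)"
  shows "hausdorff_E p (f ` X) = hausdorff_E p (g ` X)"
  using hausdorff_E_similarity[of 1 X f g p] assms by simp

lemma sets_hausdorff_measure_E [simp, measurable_cong]: "sets (hausdorff_measure_E p) = sets borel"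
  by (simp add: hausdorff_measure_E_def)

lemma space_hausdorff_measure_E [simp]: "space (hausdorff_measure_E p) = UNIV"
  by (simp add: hausdorff_measure_E_def)

lemma emeasure_hausdorff_measure_E:
  fixes A :: "'a::euclidean_space set"
  assumes "p > 0" "A \<in> sets borel"
  shows "emeasure (hausdorff_measure_E p) A = hausdorff_E p A"
proof -
  interpret metric_covering diameter "{C :: 'a set. bounded C}" p dist
    by (rule metric_covering_diameter) fact
  have ms: "measure_space UNIV (sets borel) (cm :: 'a set \<Rightarrow> ennreal)"
    by (rule measure_space_cm)
  have "countably_additive (sets borel) (hausdorff_E p :: 'a set \<Rightarrow> ennreal)"
    unfolding countably_additive_def
  proof (intro allI impI)
    fix F :: "nat \<Rightarrow> 'a set"
    assume "range F \<subseteq> sets borel" "disjoint_family F" "(\<Union>i. F i) \<in> sets borel"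
    then have "(\<Sum>i. cm (F i)) = cm (\<Union>i. F i)"
      using ms unfolding measure_space_def countably_additive_def by blast
    then show "(\<Sum>i. hausdorff_E p (F i)) = hausdorff_E p (\<Union>i. F i)"
      by (simp add: hausdorff_E_def divide_ennreal_def ennreal_suminf_multc)
  qed
  then show ?thesis
    unfolding hausdorff_measure_E_def borel_restriction_def
    using ms assms(2)
    by (intro emeasure_measure_of_sigma) (auto simp: measure_space_def positive_def hausdorff_E_def)
qed

text \<open>If the normalizing unit cube had measure \<open>0\<close> or \<open>\<infinity>\<close>, then \<open>hausdorff_E p\<close> would vanish on
  the subspace (division by \<open>0\<close> included), so that no case distinction is visible in the result.\<close>

lemma hausdorff_E_bounded_subspace:
  fixes P :: "'a::euclidean_space set"
  assumes P: "subspace P" and S: "bounded S" "S \<subseteq> P"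
  shows "hausdorff_E (dim P) S < top"
proof -
  define p where "p = dim P"
  define K where "K = pre_hausdorff p (unit_cube p :: 'a set)"
  \<comment> \<open>The same choice term as in the definition of \<open>unit_cube\<close>, so T is
    the coordinate set of that very cube.\<close>
  define T where "T = (SOME S. S \<subseteq> (Basis :: 'a set) \<and> card S = p)"
  have "p \<le> card (Basis :: 'a set)"
    using dim_subset_UNIV[of P] by (simp add: p_def)
  then obtain T' where "T' \<subseteq> (Basis :: 'a set)" "card T' = p"
    using obtain_subset_with_card_n by blast
  then have "T \<subseteq> Basis \<and> card T = p"
    unfolding T_def by (intro someI[of "\<lambda>S. S \<subseteq> (Basis :: 'a set) \<and> card S = p"] conjI)
  then have T: "T \<subseteq> Basis" "card T = p" by blast+
  have finT: "finite T" using T(1) by (rule finite_subset) (rule finite_Basis)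
  have cube: "unit_cube p = {x :: 'a. (\<forall>b\<in>T. 0 \<le> inner x b \<and> inner x b \<le> 1) \<and> (\<forall>b\<in>Basis - T. inner x b = 0)}"
    by (simp add: unit_cube_def T_def Let_def)
  have "independent T" by (rule independent_mono[OF independent_Basis T(1)])
  then have "dim (span T) = dim P"
    using T(2) by (simp add: dim_eq_card p_def)
  then obtain f where f: "linear f" "f ` span T = P" "\<And>x. x \<in> span T \<Longrightarrow> norm (f x) = norm x"
    using isometries_subspaces[OF subspace_span P] by metis
  obtain R where R: "R > 0" "\<And>x. x \<in> S \<Longrightarrow> norm x \<le> R"
    using S(1) bounded_pos by blast
  \<comment> \<open>\<open>h\<close> maps the unit cube onto the cube of side 2R centred at 0 in the
    span of T, and f carries the latter isometrically into P, where its image contains S.\<close>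
  define h where "h x = (2 * R) *\<^sub>R x - (\<Sum>b\<in>T. R *\<^sub>R b)" for x :: 'a
  have inner_T: "inner (\<Sum>b\<in>T. c b *\<^sub>R b) b' = (if b' \<in> T then c b' else 0)" if "b' \<in> Basis" for b' and c :: "'a \<Rightarrow> real"
    using that T(1) finT by (auto simp: inner_sum_left inner_Basis subset_iff if_distrib[of "(*) _"] sum.delta cong: if_cong)
  have cube_span: "unit_cube p \<subseteq> span T"
  proof
    fix x :: 'a assume "x \<in> unit_cube p"
    then have x0: "inner x b = 0" if "b \<in> Basis - T" for b
      using that unfolding cube by blast
    have "x = (\<Sum>b\<in>T. inner x b *\<^sub>R b)"
    proof (rule euclidean_eqI)
      fix b :: 'a assume b: "b \<in> Basis"
      show "inner x b = inner (\<Sum>b\<in>T. inner x b *\<^sub>R b) b"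
        unfolding inner_T[OF b] using x0[of b] b by (cases "b \<in> T") simp_all
    qed
    moreover have "(\<Sum>b\<in>T. inner x b *\<^sub>R b) \<in> span T"
      by (intro span_sum span_scale span_base)
    ultimately show "x \<in> span T" by (rule ssubst[where P = "\<lambda>y. y \<in> span T"])
  qed
  have sub: "S \<subseteq> (f \<circ> h) ` unit_cube p"
  proof
    fix s assume "s \<in> S"
    then obtain x where x: "x \<in> span T" "s = f x" using f(2) S(2) by blast
    define y where "y = (1 / (2 * R)) *\<^sub>R (x + (\<Sum>b\<in>T. R *\<^sub>R b))"
    have "norm x \<le> R" using f(3)[OF x(1)] R(2)[OF \<open>s \<in> S\<close>] x by simp
    then have bound: "\<bar>inner x b\<bar> \<le> R" if "b \<in> Basis" for b
      using Basis_le_norm[OF that, of x] by linarith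
    have "inner x b = 0" if "b \<in> Basis - T" for b
    proof -
      have "inner b t = 0" if "t \<in> T" for t
        using \<open>b \<in> Basis - T\<close> that T(1) by (auto simp: inner_Basis)
      then have "span T \<subseteq> {x. inner b x = 0}"
        by (intro span_minimal subspace_hyperplane) auto
      then show ?thesis using x(1) by (auto simp: inner_commute)
    qed
    moreover have "0 \<le> inner y b \<and> inner y b \<le> 1" if "b \<in> T" for b
      using bound[of b] that T(1) R(1) by (auto simp: y_def inner_add_left inner_T subset_iff field_simps abs_le_iff)
    ultimately have "y \<in> unit_cube p"
      by (auto simp: cube y_def inner_add_left inner_T)
    moreover have "h y = x" using R(1) by (simp add: h_def y_def)
    ultimately show "s \<in> (f \<circ> h) ` unit_cube p" using x(2) by auto
  qed
  have "pre_hausdorff p ((f \<circ> h) ` unit_cube p) = ennreal ((2 * R) ^ p) * pre_hausdorff p ((\<lambda>x. x) ` (unit_cube p :: 'a set))"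
  proof (rule pre_hausdorff_similarity)
    fix x y :: 'a assume xy: "x \<in> unit_cube p" "y \<in> unit_cube p"
    have "(f \<circ> h) x - (f \<circ> h) y = f ((2 * R) *\<^sub>R (x - y))"
      by (simp add: h_def linear_diff[OF f(1)] algebra_simps linear_scale[OF f(1)])
    moreover have "norm (f ((2 * R) *\<^sub>R (x - y))) = norm ((2 * R) *\<^sub>R (x - y))"
      using xy cube_span by (intro f(3) span_scale span_diff) auto
    ultimately show "dist ((f \<circ> h) x) ((f \<circ> h) y) = 2 * R * dist x y"
      using R(1) by (simp add: dist_norm)
  qed (use R in simp)
  then have "pre_hausdorff p S \<le> ennreal ((2 * R) ^ p) * K"
    using covering_measure_mono[OF sub, of diameter "{C. bounded C}" p] by (simp only: K_def image_ident)
  then have "hausdorff_E p S \<le> ennreal ((2 * R) ^ p) * K / K"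
    unfolding hausdorff_E_def K_def[symmetric] by (rule divide_right_mono_ennreal)
  also have "\<dots> < top"
  proof (cases K)
    case (real k)
    then show ?thesis
      using R(1) by (cases "k = 0") (auto simp: ennreal_mult'[symmetric] divide_ennreal)
  qed (use R(1) in \<open>auto simp: divide_ennreal_def\<close>)
  finally show ?thesis by (simp add: p_def)
qed

section \<open>The measure on a fixed subspace: invariance, slicing and stretching\<close>

locale euclidean_subspace =
  fixes P :: "'a::euclidean_space set" and p :: nat
  assumes P: "subspace P" and p: "dim P = p" "p > 0"
begin

text \<open>A density rather than a restricted space keeps the Borel sets of the ambient space, so
  that maps of the whole space can be integrated directly.\<close>

definition \<nu> :: "'a measure" where
  "\<nu> = density (hausdorff_measure_E p) (indicator P)"

lemma P_borel [measurable, simp]: "P \<in> sets borel"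
  using closed_subspace[OF P] by simp

lemma sets_nu [simp, measurable_cong]: "sets \<nu> = sets borel"
  and space_nu [simp]: "space \<nu> = UNIV"
  by (simp_all add: \<nu>_def)

lemma emeasure_nu: "S \<in> sets borel \<Longrightarrow> emeasure \<nu> S = hausdorff_E p (P \<inter> S)"
  unfolding \<nu>_def using p
  by (subst emeasure_density) (auto simp: indicator_inter_arith[symmetric] emeasure_hausdorff_measure_E)

lemma emeasure_nu_subset: "S \<in> sets borel \<Longrightarrow> S \<subseteq> P \<Longrightarrow> emeasure \<nu> S = hausdorff_E p S"
  by (simp add: emeasure_nu Int_absorb1)

lemma nn_integral_nu:
  assumes "f \<in> borel_measurable borel"
  shows "(\<integral>\<^sup>+x. f x \<partial>\<nu>) = (\<integral>\<^sup>+x\<in>P. f x \<partial>hausdorff_measure_E p)"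
  unfolding \<nu>_def using assms
  by (subst nn_integral_density) (auto intro!: nn_integral_cong simp: indicator_def)

lemma emeasure_nu_bounded: "S \<in> sets borel \<Longrightarrow> bounded S \<Longrightarrow> emeasure \<nu> S < top"
  using hausdorff_E_bounded_subspace[OF P, of "P \<inter> S"] p(1)
  by (simp add: emeasure_nu bounded_Int)

lemma sigma_finite_nu: "sigma_finite_measure \<nu>"
proof
  show "\<exists>A. countable A \<and> A \<subseteq> sets \<nu> \<and> \<Union> A = space \<nu> \<and> (\<forall>a\<in>A. emeasure \<nu> a \<noteq> \<infinity>)"
  proof (intro exI conjI ballI)
    show "countable (range (\<lambda>n::nat. cball (0::'a) (real n)))" by simp
    show "range (\<lambda>n::nat. cball (0::'a) (real n)) \<subseteq> sets \<nu>" by auto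
    show "\<Union> (range (\<lambda>n::nat. cball (0::'a) (real n))) = space \<nu>"
      by (auto simp: real_arch_simple)
    fix S assume "S \<in> range (\<lambda>n::nat. cball (0::'a) (real n))"
    then have "emeasure \<nu> S < top" by (intro emeasure_nu_bounded) auto
    then show "emeasure \<nu> S \<noteq> \<infinity>" by simp
  qed
qed

lemma distr_nu_translate:
  assumes "a \<in> P"
  shows "distr \<nu> borel (\<lambda>x. x + a) = \<nu>"
proof (rule measure_eqI)
  fix S assume "S \<in> sets (distr \<nu> borel (\<lambda>x. x + a))"
  then have S: "S \<in> sets borel" by simp
  then have S': "(\<lambda>x. x + a) -` S \<in> sets borel"
    using measurable_sets[of "\<lambda>x. x + a" borel borel S] by simp
  have "emeasure (distr \<nu> borel (\<lambda>x. x + a)) S = hausdorff_E p (P \<inter> (\<lambda>x. x + a) -` S)"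
    using S S' by (simp add: emeasure_distr emeasure_nu)
  also have "P \<inter> (\<lambda>x. x + a) -` S = (\<lambda>x. x - a) ` (P \<inter> S)"
    using assms P by (auto simp: image_iff subspace_add subspace_diff intro!: bexI[of _ "_ + a"])
  also have "hausdorff_E p \<dots> = hausdorff_E p ((\<lambda>x. x) ` (P \<inter> S))"
    by (rule hausdorff_E_isometry) (simp add: dist_norm)
  finally show "emeasure (distr \<nu> borel (\<lambda>x. x + a)) S = emeasure \<nu> S"
    using S by (simp add: emeasure_nu)
qed simp

lemma nn_integral_nu_translate:
  assumes "a \<in> P" "f \<in> borel_measurable borel"
  shows "(\<integral>\<^sup>+x. f (x + a) \<partial>\<nu>) = (\<integral>\<^sup>+x. f x \<partial>\<nu>)"
  using assms(2) by (subst (2) distr_nu_translate[OF assms(1), symmetric]) (simp add: nn_integral_distr)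

text \<open>Fubini along \<open>e\<close> without a product structure: insert \<open>1 = \<integral> g (x + t e) dt\<close>, where \<open>g\<close> is the
  indicator of a slab of width 1, and use the translation invariance of \<open>\<nu>\<close>.\<close>

lemma nn_integral_disintegrate:
  assumes e: "e \<in> P" "norm e = 1" and f [measurable]: "f \<in> borel_measurable borel"
  shows "(\<integral>\<^sup>+x. f x \<partial>\<nu>) =
    (\<integral>\<^sup>+x. indicator {x. 0 \<le> inner x e \<and> inner x e < 1} x *
       (\<integral>\<^sup>+t. f (x - inner x e *\<^sub>R e + t *\<^sub>R e) \<partial>lborel) \<partial>\<nu>)"
proof -
  interpret \<nu>: sigma_finite_measure \<nu> by (rule sigma_finite_nu)
  interpret pair_sigma_finite \<nu> lborel ..
  define g :: "'a \<Rightarrow> ennreal" where "g = indicator {x. 0 \<le> inner x e \<and> inner x e < 1}"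
  have [measurable]: "g \<in> borel_measurable borel"
    unfolding g_def by measurable
  have ee: "inner e e = 1" using e(2) by (simp add: dot_square_norm)
  have g_int: "(\<integral>\<^sup>+t. g (x + t *\<^sub>R e) \<partial>lborel) = 1" for x
  proof -
    have "(\<integral>\<^sup>+t. g (x + t *\<^sub>R e) \<partial>lborel) = (\<integral>\<^sup>+t. indicator {- inner x e..<1 - inner x e} t \<partial>lborel)"
      by (intro nn_integral_cong) (auto simp: g_def indicator_def inner_add_left ee)
    then show ?thesis by simp
  qed
  have "(\<integral>\<^sup>+x. f x \<partial>\<nu>) = (\<integral>\<^sup>+x. f x * (\<integral>\<^sup>+t. g (x + t *\<^sub>R e) \<partial>lborel) \<partial>\<nu>)"
    by (simp add: g_int)
  also have "\<dots> = (\<integral>\<^sup>+x. (\<integral>\<^sup>+t. f x * g (x + t *\<^sub>R e) \<partial>lborel) \<partial>\<nu>)"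
    by (intro nn_integral_cong nn_integral_cmult[symmetric]) measurable
  also have "\<dots> = (\<integral>\<^sup>+t. (\<integral>\<^sup>+x. f x * g (x + t *\<^sub>R e) \<partial>\<nu>) \<partial>lborel)"
    by (intro Fubini'[symmetric]) measurable
  also have "\<dots> = (\<integral>\<^sup>+t. (\<integral>\<^sup>+x. f (x - t *\<^sub>R e) * g x \<partial>\<nu>) \<partial>lborel)"
  proof (rule nn_integral_cong)
    fix t :: real
    show "(\<integral>\<^sup>+x. f x * g (x + t *\<^sub>R e) \<partial>\<nu>) = (\<integral>\<^sup>+x. f (x - t *\<^sub>R e) * g x \<partial>\<nu>)"
      using nn_integral_nu_translate[of "t *\<^sub>R e" "\<lambda>x. f (x - t *\<^sub>R e) * g x"] e(1) P
      by (simp add: subspace_scale)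
  qed
  also have "\<dots> = (\<integral>\<^sup>+x. (\<integral>\<^sup>+t. f (x - t *\<^sub>R e) * g x \<partial>lborel) \<partial>\<nu>)"
    by (intro Fubini') measurable
  also have "\<dots> = (\<integral>\<^sup>+x. g x * (\<integral>\<^sup>+t. f (x - t *\<^sub>R e) \<partial>lborel) \<partial>\<nu>)"
    by (rule nn_integral_cong) (subst nn_integral_multc, simp, simp add: mult.commute)
  also have "\<dots> = (\<integral>\<^sup>+x. g x * (\<integral>\<^sup>+t. f (x - inner x e *\<^sub>R e + t *\<^sub>R e) \<partial>lborel) \<partial>\<nu>)"
  proof (intro nn_integral_cong)
    \<comment> \<open>Reflection of the line: t is replaced by \<open>inner x e - t\<close>.\<close>
    fix x
    have "(\<integral>\<^sup>+t. f (x - inner x e *\<^sub>R e + t *\<^sub>R e) \<partial>lborel) =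
       (\<integral>\<^sup>+t. f (x - inner x e *\<^sub>R e + (inner x e + (-1) * t) *\<^sub>R e) \<partial>lborel)"
      by (subst nn_integral_real_affine[of _ "-1" "inner x e"]) auto
    then show "g x * (\<integral>\<^sup>+t. f (x - t *\<^sub>R e) \<partial>lborel) = g x * (\<integral>\<^sup>+t. f (x - inner x e *\<^sub>R e + t *\<^sub>R e) \<partial>lborel)"
      by (simp add: algebra_simps)
  qed
  finally show ?thesis by (simp add: g_def)
qed

text \<open>Since \<open>q\<close> is constant along e, the map acts on each line parallel to e as
  an affine map of slope s, and slicing reduces the claim to substitution in one variable. The lemma
  later serves for stretches, vertical shears and the vertical part of dilations.\<close>

lemma nn_integral_shear_stretch:
  assumes e: "e \<in> P" "norm e = 1" and f [measurable]: "f \<in> borel_measurable borel" and "s > 0"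
    and q [measurable]: "q \<in> borel_measurable borel" and q_inv: "\<And>x t. q (x + t *\<^sub>R e) = q x"
  shows "ennreal s * (\<integral>\<^sup>+x. f (x + (q x + (s - 1) * inner x e) *\<^sub>R e) \<partial>\<nu>) = (\<integral>\<^sup>+x. f x \<partial>\<nu>)"
proof -
  interpret \<nu>: sigma_finite_measure \<nu> by (rule sigma_finite_nu)
  interpret pair_sigma_finite \<nu> lborel ..
  define g :: "'a \<Rightarrow> ennreal" where "g = indicator {x. 0 \<le> inner x e \<and> inner x e < 1}"
  have [measurable]: "g \<in> borel_measurable borel"
    unfolding g_def by measurable
  have ee: "inner e e = 1" using e(2) by (simp add: dot_square_norm)
  define T where "T x = x + (q x + (s - 1) * inner x e) *\<^sub>R e" for x
  have [measurable]: "T \<in> borel_measurable borel" unfolding T_def by measurable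
  have T_eq: "T (x - inner x e *\<^sub>R e + t *\<^sub>R e) = x - inner x e *\<^sub>R e + (q x + s * t) *\<^sub>R e" for x t
  proof -
    have "x - inner x e *\<^sub>R e + t *\<^sub>R e = x + (t - inner x e) *\<^sub>R e" by (simp add: algebra_simps)
    moreover have "q (x + (t - inner x e) *\<^sub>R e) = q x" by (rule q_inv)
    ultimately show ?thesis
      by (simp add: T_def inner_add_left inner_diff_left ee algebra_simps)
  qed
  have "ennreal s * (\<integral>\<^sup>+x. f (T x) \<partial>\<nu>) =
     ennreal s * (\<integral>\<^sup>+x. g x * (\<integral>\<^sup>+t. f (T (x - inner x e *\<^sub>R e + t *\<^sub>R e)) \<partial>lborel) \<partial>\<nu>)"
    by (subst nn_integral_disintegrate[OF e]) (auto simp: g_def)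
  also have "\<dots> = (\<integral>\<^sup>+x. ennreal s * (g x * (\<integral>\<^sup>+t. f (T (x - inner x e *\<^sub>R e + t *\<^sub>R e)) \<partial>lborel)) \<partial>\<nu>)"
    by (intro nn_integral_cmult[symmetric]) measurable
  also have "\<dots> = (\<integral>\<^sup>+x. g x * (\<integral>\<^sup>+t. f (x - inner x e *\<^sub>R e + t *\<^sub>R e) \<partial>lborel) \<partial>\<nu>)"
  proof (intro nn_integral_cong)
    fix x
    have "(\<integral>\<^sup>+t. f (x - inner x e *\<^sub>R e + t *\<^sub>R e) \<partial>lborel) =
       ennreal s * (\<integral>\<^sup>+t. f (x - inner x e *\<^sub>R e + (q x + s * t) *\<^sub>R e) \<partial>lborel)"
      using \<open>s > 0\<close> by (subst nn_integral_real_affine[of _ s "q x"]) auto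
    then show "ennreal s * (g x * (\<integral>\<^sup>+t. f (T (x - inner x e *\<^sub>R e + t *\<^sub>R e)) \<partial>lborel)) =
       g x * (\<integral>\<^sup>+t. f (x - inner x e *\<^sub>R e + t *\<^sub>R e) \<partial>lborel)"
      by (simp only: T_eq mult.left_commute)
  qed
  also have "\<dots> = (\<integral>\<^sup>+x. f x \<partial>\<nu>)"
    by (subst (2) nn_integral_disintegrate[OF e]) (auto simp: g_def)
  finally show ?thesis by (simp add: T_def)
qed

text \<open>On \<open>P\<close> this map has the same metric distortion as the stretch of \<open>P\<close> along \<open>g\<close> by the factor
  \<open>\<surd>(1 + |g|\<^sup>2)\<close>.\<close>

lemma hausdorff_E_rank_one:
  assumes g: "g \<in> P" and v: "norm v = 1" "\<And>x. x \<in> P \<Longrightarrow> inner x v = 0" and X: "compact X" "X \<subseteq> P"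
  shows "hausdorff_E p ((\<lambda>x. x + inner g x *\<^sub>R v) ` X) = ennreal (sqrt (1 + (norm g)\<^sup>2)) * hausdorff_E p X"
proof (cases "g = 0")
  case False
  define e where "e = (1 / norm g) *\<^sub>R g"
  have e: "e \<in> P" "norm e = 1" "g = norm g *\<^sub>R e" using False g P by (auto simp: e_def subspace_scale)
  have ee: "inner e e = 1" using e(2) by (simp add: dot_square_norm)
  define s where "s = sqrt (1 + (norm g)\<^sup>2)"
  have s: "s > 0" "s\<^sup>2 = 1 + (norm g)\<^sup>2" by (simp_all add: s_def add_pos_nonneg)
  define T where "T x = x + (0 + (s - 1) * inner x e) *\<^sub>R e" for x
  have T_inj: "x = y" if "T x = T y" for x y
  proof -
    have "inner (T x) e = inner (T y) e" using that by simp
    then have "s * inner x e = s * inner y e" by (simp add: T_def inner_add_left ee algebra_simps)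
    then show ?thesis using that s(1) by (simp add: T_def)
  qed
  have "continuous_on X T" unfolding T_def by (intro continuous_intros)
  then have TX: "compact (T ` X)" using X(1) by (rule compact_continuous_image)
  have T_sub: "T ` X \<subseteq> P" using X(2) e(1) P by (auto simp: T_def intro!: subspace_add subspace_scale)
  have "ennreal s * (\<integral>\<^sup>+x. indicator (T ` X) (T x) \<partial>\<nu>) = (\<integral>\<^sup>+x. indicator (T ` X) x \<partial>\<nu>)"
    unfolding T_def using TX[unfolded T_def]
    by (intro nn_integral_shear_stretch[OF e(1,2)]) (auto simp: s borel_compact intro: borel_measurable_indicator)
  also have "(\<lambda>x. indicator (T ` X) (T x) :: ennreal) = indicator X"
    using T_inj by (auto simp: indicator_def fun_eq_iff)
  finally have *: "ennreal s * hausdorff_E p X = hausdorff_E p (T ` X)"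
    using X TX T_sub by (simp add: emeasure_nu_subset borel_compact)
  have "hausdorff_E p ((\<lambda>x. x + inner g x *\<^sub>R v) ` X) = hausdorff_E p (T ` X)"
  proof (rule hausdorff_E_isometry)
    fix x y assume "x \<in> X" "y \<in> X"
    define z where "z = x - y"
    have z: "z \<in> P" unfolding z_def using \<open>x \<in> X\<close> \<open>y \<in> X\<close> X(2) by (intro subspace_diff[OF P]) auto
    have "(norm (z + inner g z *\<^sub>R v))\<^sup>2 = (norm z)\<^sup>2 + (inner g z)\<^sup>2"
      using v(2)[OF z] v(1)[unfolded norm_eq_1] unfolding power2_norm_eq_inner
      by (simp add: inner_add_left inner_add_right inner_commute[of v z] power2_eq_square)
    also have "(inner g z)\<^sup>2 = (norm g)\<^sup>2 * (inner z e)\<^sup>2"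
      by (subst e(3)) (simp add: power_mult_distrib inner_commute)
    also have "(norm z)\<^sup>2 + \<dots> = (norm (z + ((s - 1) * inner z e) *\<^sub>R e))\<^sup>2"
    proof -
      have "(norm (z + ((s - 1) * inner z e) *\<^sub>R e))\<^sup>2 = (norm z)\<^sup>2 + (s\<^sup>2 - 1) * (inner z e)\<^sup>2"
        unfolding power2_norm_eq_inner
        by (simp add: inner_add_left inner_add_right inner_commute[of e z] ee power2_eq_square algebra_simps)
      then show ?thesis by (simp add: s)
    qed
    finally have "norm (z + inner g z *\<^sub>R v) = norm (z + ((s - 1) * inner z e) *\<^sub>R e)"
      by simp
    moreover have "x + inner g x *\<^sub>R v - (y + inner g y *\<^sub>R v) = z + inner g z *\<^sub>R v"
      by (simp add: z_def inner_diff_right algebra_simps)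
    moreover have "T x - T y = z + ((s - 1) * inner z e) *\<^sub>R e"
      by (simp add: z_def T_def inner_diff_left algebra_simps)
    ultimately show "dist (x + inner g x *\<^sub>R v) (y + inner g y *\<^sub>R v) = dist (T x) (T y)"
      by (simp add: dist_norm)
  qed
  then show ?thesis using * by (simp add: s_def)
qed simp

end

section \<open>Determinants of perturbations of the identity\<close>

text \<open>An arbitrary index set J allows minors to be expanded and regrouped without renumbering
  rows and columns.\<close>

definition set_det :: "nat set \<Rightarrow> (nat \<Rightarrow> nat \<Rightarrow> real) \<Rightarrow> real" where
  "set_det J M = (\<Sum>\<pi> | \<pi> permutes J. of_int (sign \<pi>) * (\<Prod>a\<in>J. M a (\<pi> a)))"

definition row_index :: "nat set \<Rightarrow> nat set \<Rightarrow> nat \<Rightarrow> nat" where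
  "row_index I J a = pick I (card {b\<in>J. b < a})"

text \<open>The rows \<open>I\<close> and the columns \<open>J\<close> are matched by the order preserving bijection.\<close>

definition minor_det :: "(nat \<Rightarrow> nat \<Rightarrow> real) \<Rightarrow> nat set \<Rightarrow> nat set \<Rightarrow> real" where
  "minor_det A I J = set_det J (\<lambda>a. A (row_index I J a))"

lemma bij_betw_pick:
  assumes "finite S"
  shows "bij_betw (pick S) {0..<card S} S"
proof -
  have inj: "inj_on (pick S) {0..<card S}"
    by (intro inj_onI) (metis atLeastLessThan_iff linorder_neqE_nat nat_neq_iff pick_mono_le)
  moreover have "pick S ` {0..<card S} \<subseteq> S" by (auto intro: pick_in_set_le)
  moreover have "card (pick S ` {0..<card S}) = card S" using inj by (simp add: card_image)
  ultimately show ?thesis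
    using assms by (simp add: bij_betw_def card_subset_eq)
qed

lemma row_index_pick: "i < card J \<Longrightarrow> row_index I J (pick J i) = pick I i"
  by (simp add: row_index_def card_pick_le)

lemma bij_betw_row_index:
  assumes "finite I" "finite J" "card I = card J"
  shows "bij_betw (row_index I J) J I"
proof -
  have "bij_betw (row_index I J \<circ> pick J) {0..<card J} I"
    using bij_betw_pick[OF assms(1)] assms(3)
    by (subst bij_betw_cong[of _ _ "pick I"]) (auto simp: row_index_pick)
  then show ?thesis
    using bij_betw_comp_iff[OF bij_betw_pick[OF assms(2)]] by blast
qed

text \<open>Relabelling J by its increasing enumeration conjugates each permutation, which preserves
  signs and only reorders the products.\<close>

lemma set_det_eq_det:
  assumes "finite J" "card J = r"
  shows "set_det J M = Determinant.det (Matrix.mat r r (\<lambda>(i, j). M (pick J i) (pick J j)))"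
proof -
  have bij: "bij_betw (pick J) {0..<r} J" using bij_betw_pick assms by blast
  then have inj: "inj_on (pick J) {0..<r}" and im: "pick J ` {0..<r} = J" by (auto simp: bij_betw_def)
  define g where "g = inv_into {0..<r} (pick J)"
  have bij': "bij_betw g J {0..<r}" using bij by (simp add: g_def bij_betw_inv_into)
  have gp: "g (pick J i) = i" if "i \<in> {0..<r}" for i
    using that inj by (simp add: g_def)
  have pg: "pick J (g a) = a" if "a \<in> J" for a
    using that im by (simp add: g_def f_inv_into_f)
  have "set_det J M = (\<Sum>p | p permutes {0..<r}. of_int (sign p) * (\<Prod>i=0..<r. M (pick J i) (pick J (p i))))"
    unfolding set_det_def
  proof (rule sum.reindex_bij_witness[of _ "map_permutation {0..<r} (pick J)" "map_permutation J g"])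
    fix \<pi> assume \<pi>: "\<pi> \<in> {\<pi>. \<pi> permutes J}"
    then show "map_permutation J g \<pi> \<in> {p. p permutes {0..<r}}"
      using bij' by (auto intro: map_permutation_permutes)
    show "map_permutation {0..<r} (pick J) (map_permutation J g \<pi>) = \<pi>"
      using \<pi> bij' pg by (intro map_permutation_compose_inv[where A = J]) auto
    have "(\<Prod>i=0..<r. M (pick J i) (pick J (map_permutation J g \<pi> i))) = (\<Prod>a\<in>J. M a (\<pi> a))"
    proof (rule prod.reindex_bij_witness[of _ g "pick J"])
      fix i assume i: "i \<in> {0..<r}"
      then have J: "pick J i \<in> J" using im by blast
      have "map_permutation J g \<pi> i = g (\<pi> (pick J i))"
        using map_permutation_apply[of g J "pick J i" \<pi>] bij' J gp[OF i] by (simp add: bij_betw_def)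
      moreover have "\<pi> (pick J i) \<in> J" using \<pi> J permutes_in_image by fastforce
      ultimately show "M (pick J i) (\<pi> (pick J i)) = M (pick J i) (pick J (map_permutation J g \<pi> i))"
        by (simp add: pg)
    qed (use gp pg im bij' in \<open>auto simp: bij_betw_def\<close>)
    moreover have "sign (map_permutation J g \<pi>) = sign \<pi>"
      using \<pi> bij' assms by (intro sign_map_permutation) (auto simp: bij_betw_def)
    ultimately show "of_int (sign (map_permutation J g \<pi>)) *
          (\<Prod>i=0..<r. M (pick J i) (pick J (map_permutation J g \<pi> i))) =
        of_int (sign \<pi>) * (\<Prod>a\<in>J. M a (\<pi> a))" by simp
  next
    fix p assume p: "p \<in> {p. p permutes {0..<r}}"
    then show "map_permutation {0..<r} (pick J) p \<in> {\<pi>. \<pi> permutes J}"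
      using bij by (auto intro: map_permutation_permutes)
    show "map_permutation J g (map_permutation {0..<r} (pick J) p) = p"
      using p bij gp by (intro map_permutation_compose_inv[where A = "{0..<r}"]) auto
  qed
  also have "\<dots> = (\<Sum>p | p permutes {0..<r}. of_int (sign p) *
       (\<Prod>i=0..<r. Matrix.mat r r (\<lambda>(i, j). M (pick J i) (pick J j)) $$ (i, p i)))"
  proof (intro sum.cong refl arg_cong2[where f = "(*)"] prod.cong)
    fix p i assume "p \<in> {p. p permutes {0..<r}}" "i \<in> {0..<r}"
    then have "p i \<in> {0..<r}" using permutes_in_image by fastforce
    then show "M (pick J i) (pick J (p i)) = Matrix.mat r r (\<lambda>(i, j). M (pick J i) (pick J j)) $$ (i, p i)"
      using \<open>i \<in> {0..<r}\<close> by simp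
  qed
  also have "\<dots> = Determinant.det (Matrix.mat r r (\<lambda>(i, j). M (pick J i) (pick J j)))"
    by (subst det_def'[of _ r]) auto
  finally show ?thesis .
qed

lemma det_submatrix:
  fixes D :: "real mat"
  assumes "D \<in> carrier_mat k m" "I \<subseteq> {..<k}" "J \<subseteq> {..<m}" "card I = card J"
  shows "Determinant.det (submatrix D I J) = minor_det (\<lambda>i j. D $$ (i, j)) I J"
proof -
  define r where "r = card J"
  have fin: "finite J" using assms(3) finite_subset by blast
  have I: "{i. i < k \<and> i \<in> I} = I" and J: "{j. j < m \<and> j \<in> J} = J" using assms by auto
  have "submatrix D I J = Matrix.mat r r (\<lambda>(i, j). D $$ (row_index I J (pick J i), pick J j))"
    using assms(1,4) unfolding submatrix_def
    by (intro eq_matI) (auto simp: I J r_def row_index_pick)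
  then show ?thesis
    unfolding minor_det_def by (subst set_det_eq_det[OF fin, of r]) (auto simp: r_def)
qed

text \<open>Each row is a unit row plus a row of M. Once the set J of rows where M is taken is
  chosen, only permutations fixing its complement contribute, so the principal minors of M
  remain.\<close>

lemma det_id_plus:
  "Determinant.det (Matrix.mat m m (\<lambda>(i, j). (if i = j then 1 else 0) + M i j)) = (\<Sum>J\<in>Pow {0..<m}. set_det J M)"
proof -
  define \<delta> where "\<delta> i j = (if i = j then 1 else 0 :: real)" for i j :: nat
  have "Determinant.det (Matrix.mat m m (\<lambda>(i, j). (if i = j then 1 else 0) + M i j)) =
     (\<Sum>p | p permutes {0..<m}. of_int (sign p) *
       (\<Prod>i=0..<m. Matrix.mat m m (\<lambda>(i, j). (if i = j then 1 else 0) + M i j) $$ (i, p i)))"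
    by (subst det_def'[of _ m]) auto
  also have "\<dots> = (\<Sum>p | p permutes {0..<m}. of_int (sign p) * (\<Prod>i=0..<m. M i (p i) + \<delta> i (p i)))"
  proof (intro sum.cong refl arg_cong2[where f = "(*)"] prod.cong)
    fix p i assume "p \<in> {p. p permutes {0..<m}}" "i \<in> {0..<m}"
    then have "p i \<in> {0..<m}" using permutes_in_image by fastforce
    then show "Matrix.mat m m (\<lambda>(i, j). (if i = j then 1 else 0) + M i j) $$ (i, p i) = M i (p i) + \<delta> i (p i)"
      using \<open>i \<in> {0..<m}\<close> by (simp add: \<delta>_def)
  qed
  also have "\<dots> = (\<Sum>p | p permutes {0..<m}. \<Sum>J\<in>Pow {0..<m}.
      of_int (sign p) * ((\<Prod>i\<in>J. M i (p i)) * (\<Prod>i\<in>{0..<m} - J. \<delta> i (p i))))"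
    by (simp add: prod_add sum_distrib_left)
  also have "\<dots> = (\<Sum>J\<in>Pow {0..<m}. \<Sum>p | p permutes {0..<m}.
      of_int (sign p) * ((\<Prod>i\<in>J. M i (p i)) * (\<Prod>i\<in>{0..<m} - J. \<delta> i (p i))))"
    by (rule sum.swap)
  also have "\<dots> = (\<Sum>J\<in>Pow {0..<m}. set_det J M)"
  proof (rule sum.cong[OF refl])
    fix J assume J: "J \<in> Pow {0..<m}"
    have "(\<Sum>p | p permutes {0..<m}. of_int (sign p) * ((\<Prod>i\<in>J. M i (p i)) * (\<Prod>i\<in>{0..<m} - J. \<delta> i (p i)))) =
      (\<Sum>p | p permutes J. of_int (sign p) * ((\<Prod>i\<in>J. M i (p i)) * (\<Prod>i\<in>{0..<m} - J. \<delta> i (p i))))"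
    proof (rule sum.mono_neutral_right)
      show "finite {p. p permutes {0..<m}}" by (rule finite_permutations) simp
      show "{p. p permutes J} \<subseteq> {p. p permutes {0..<m}}" using J by (auto intro: permutes_subset)
      show "\<forall>p\<in>{p. p permutes {0..<m}} - {p. p permutes J}.
         of_int (sign p) * ((\<Prod>i\<in>J. M i (p i)) * (\<Prod>i\<in>{0..<m} - J. \<delta> i (p i))) = 0"
      proof
        fix p assume p: "p \<in> {p. p permutes {0..<m}} - {p. p permutes J}"
        then obtain i where i: "i \<in> {0..<m} - J" "p i \<noteq> i"
          using permutes_superset[of p "{0..<m}" J] by blast
        then have "\<delta> i (p i) = 0"
          by (simp add: \<delta>_def)
        then have "(\<Prod>i\<in>{0..<m} - J. \<delta> i (p i)) = 0"
          using i(1) by (intro prod_zero) auto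
        then show "of_int (sign p) * ((\<Prod>i\<in>J. M i (p i)) * (\<Prod>i\<in>{0..<m} - J. \<delta> i (p i))) = 0"
          by simp
      qed
    qed
    also have "\<dots> = set_det J M"
      unfolding set_det_def
    proof (rule sum.cong[OF refl])
      fix p assume "p \<in> {p. p permutes J}"
      then have "(\<Prod>i\<in>{0..<m} - J. \<delta> i (p i)) = 1"
        by (intro prod.neutral) (auto simp: \<delta>_def permutes_not_in)
      then show "of_int (sign p) * ((\<Prod>i\<in>J. M i (p i)) * (\<Prod>i\<in>{0..<m} - J. \<delta> i (p i))) =
          of_int (sign p) * (\<Prod>i\<in>J. M i (p i))" by simp
    qed
    finally show "(\<Sum>p | p permutes {0..<m}. of_int (sign p) * ((\<Prod>i\<in>J. M i (p i)) * (\<Prod>i\<in>{0..<m} - J. \<delta> i (p i)))) = set_det J M" .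
  qed
  finally show ?thesis .
qed

section \<open>The Cauchy-Binet formula and Gram determinants\<close>

lemma set_det_repeated_rows:
  assumes "finite J" "a \<in> J" "b \<in> J" "a \<noteq> b" "M a = M b"
  shows "set_det J M = 0"
proof -
  define \<tau> where "\<tau> = Transposition.transpose a b"
  have \<tau>: "\<tau> permutes J" using assms by (auto simp: \<tau>_def intro: permutes_swap_id)
  have "set_det J M = (\<Sum>\<pi> | \<pi> permutes J. of_int (sign (\<pi> \<circ> \<tau>)) * (\<Prod>c\<in>J. M c ((\<pi> \<circ> \<tau>) c)))"
    unfolding set_det_def by (rule sum_permutations_compose_right[OF \<tau>])
  also have "\<dots> = (\<Sum>\<pi> | \<pi> permutes J. - (of_int (sign \<pi>) * (\<Prod>c\<in>J. M c (\<pi> c))))"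
  proof (rule sum.cong[OF refl])
    fix \<pi> assume "\<pi> \<in> {\<pi>. \<pi> permutes J}"
    then have "permutation \<pi>" "permutation \<tau>" using assms(1) \<tau> permutation_permutes by blast+
    then have "sign (\<pi> \<circ> \<tau>) = - sign \<pi>"
      using assms(4) by (simp add: sign_compose \<tau>_def sign_swap_id)
    moreover have "(\<Prod>c\<in>J. M c ((\<pi> \<circ> \<tau>) c)) = (\<Prod>c\<in>J. M (\<tau> c) (\<pi> (\<tau> c)))"
      using assms(5) by (intro prod.cong) (auto simp: \<tau>_def Transposition.transpose_def)
    moreover have "\<dots> = (\<Prod>c\<in>J. M c (\<pi> c))"
      using prod.permute[OF \<tau>, of "\<lambda>c. M c (\<pi> c)"] by (simp add: o_def)
    ultimately show "of_int (sign (\<pi> \<circ> \<tau>)) * (\<Prod>c\<in>J. M c ((\<pi> \<circ> \<tau>) c)) = - (of_int (sign \<pi>) * (\<Prod>c\<in>J. M c (\<pi> c)))"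
      by simp
  qed
  also have "\<dots> = - set_det J M" by (simp add: set_det_def sum_negf)
  finally show ?thesis by simp
qed

lemma set_det_permute_rows:
  assumes "finite J" "\<rho> permutes J"
  shows "set_det J (\<lambda>a. M (\<rho> a)) = of_int (sign \<rho>) * set_det J M"
proof -
  have "set_det J (\<lambda>a. M (\<rho> a)) = (\<Sum>\<pi> | \<pi> permutes J. of_int (sign (\<pi> \<circ> \<rho>)) * (\<Prod>c\<in>J. M (\<rho> c) ((\<pi> \<circ> \<rho>) c)))"
    unfolding set_det_def by (rule sum_permutations_compose_right[OF assms(2)])
  also have "\<dots> = (\<Sum>\<pi> | \<pi> permutes J. of_int (sign \<rho>) * (of_int (sign \<pi>) * (\<Prod>c\<in>J. M c (\<pi> c))))"
  proof (rule sum.cong[OF refl])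
    fix \<pi> assume "\<pi> \<in> {\<pi>. \<pi> permutes J}"
    then have "permutation \<pi>" "permutation \<rho>" using assms permutation_permutes by blast+
    then have "sign (\<pi> \<circ> \<rho>) = sign \<rho> * sign \<pi>" by (simp add: sign_compose)
    moreover have "(\<Prod>c\<in>J. M (\<rho> c) ((\<pi> \<circ> \<rho>) c)) = (\<Prod>c\<in>J. M c (\<pi> c))"
      using prod.permute[OF assms(2), of "\<lambda>c. M c (\<pi> c)"] by (simp add: o_def)
    ultimately show "of_int (sign (\<pi> \<circ> \<rho>)) * (\<Prod>c\<in>J. M (\<rho> c) ((\<pi> \<circ> \<rho>) c)) =
        of_int (sign \<rho>) * (of_int (sign \<pi>) * (\<Prod>c\<in>J. M c (\<pi> c)))" by simp
  qed
  finally show ?thesis by (simp add: set_det_def sum_distrib_left)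
qed

lemma set_det_transpose:
  assumes "finite J"
  shows "set_det J (\<lambda>a b. M b a) = set_det J M"
proof -
  have "set_det J M = (\<Sum>\<pi> | \<pi> permutes J. of_int (sign (inv_into UNIV \<pi>)) * (\<Prod>c\<in>J. M c (inv_into UNIV \<pi> c)))"
    unfolding set_det_def by (rule sum_permutations_inverse)
  also have "\<dots> = (\<Sum>\<pi> | \<pi> permutes J. of_int (sign \<pi>) * (\<Prod>c\<in>J. M (\<pi> c) c))"
  proof (rule sum.cong[OF refl])
    fix \<pi> assume \<pi>: "\<pi> \<in> {\<pi>. \<pi> permutes J}"
    then have "permutation \<pi>" using assms permutation_permutes by blast
    then have "sign (inv_into UNIV \<pi>) = sign \<pi>" by (rule sign_inverse)
    moreover have "(\<Prod>c\<in>J. M c (inv_into UNIV \<pi> c)) = (\<Prod>c\<in>J. M (\<pi> c) c)"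
      using \<pi> prod.permute[of \<pi> J "\<lambda>c. M c (inv_into UNIV \<pi> c)"] by (simp add: o_def permutes_inverses)
    ultimately show "of_int (sign (inv_into UNIV \<pi>)) * (\<Prod>c\<in>J. M c (inv_into UNIV \<pi> c)) = of_int (sign \<pi>) * (\<Prod>c\<in>J. M (\<pi> c) c)"
      by simp
  qed
  finally show ?thesis by (simp add: set_det_def)
qed

text \<open>Both factors are indexed with R first, so this concerns the transpose of A times B.
  Expanding the products chooses an index \<open>f a\<close> in R for each a in J; choices with
  repetitions give equal rows and vanish, and the injective ones are grouped by their image
  I.\<close>

theorem Cauchy_Binet_set_det:
  assumes J: "finite J" and R: "finite R"
  shows "set_det J (\<lambda>a b. \<Sum>i\<in>R. A i a * B i b) =
    (\<Sum>I | I \<subseteq> R \<and> card I = card J. minor_det A I J * minor_det B I J)"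
proof -
  define G where "G f = set_det J (\<lambda>a. B (f a))" for f
  have "set_det J (\<lambda>a b. \<Sum>i\<in>R. A i a * B i b) =
     (\<Sum>\<pi> | \<pi> permutes J. \<Sum>f\<in>J \<rightarrow>\<^sub>E R. of_int (sign \<pi>) * (\<Prod>a\<in>J. A (f a) a * B (f a) (\<pi> a)))"
    unfolding set_det_def using J R by (simp add: prod_sum_PiE sum_distrib_left)
  also have "\<dots> = (\<Sum>f\<in>J \<rightarrow>\<^sub>E R. (\<Prod>a\<in>J. A (f a) a) * G f)"
    by (subst sum.swap) (simp add: G_def set_det_def sum_distrib_left prod.distrib mult.left_commute)
  also have "\<dots> = (\<Sum>f\<in>{f \<in> J \<rightarrow>\<^sub>E R. inj_on f J}. (\<Prod>a\<in>J. A (f a) a) * G f)"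
  proof (rule sum.mono_neutral_right)
    show "\<forall>f\<in>(J \<rightarrow>\<^sub>E R) - {f \<in> J \<rightarrow>\<^sub>E R. inj_on f J}. (\<Prod>a\<in>J. A (f a) a) * G f = 0"
    proof
      fix f assume "f \<in> (J \<rightarrow>\<^sub>E R) - {f \<in> J \<rightarrow>\<^sub>E R. inj_on f J}"
      then obtain a b where "a \<in> J" "b \<in> J" "a \<noteq> b" "f a = f b" by (auto simp: inj_on_def)
      then have "G f = 0" unfolding G_def by (intro set_det_repeated_rows[OF J, of a b]) auto
      then show "(\<Prod>a\<in>J. A (f a) a) * G f = 0" by simp
    qed
  qed (use finite_PiE[OF J, of "\<lambda>_. R"] R in auto)
  also have "\<dots> = (\<Sum>I | I \<subseteq> R \<and> card I = card J. \<Sum>f\<in>{f \<in> {f \<in> J \<rightarrow>\<^sub>E R. inj_on f J}. f ` J = I}. (\<Prod>a\<in>J. A (f a) a) * G f)"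
  proof (rule sum.group[symmetric])
    show "finite {f \<in> J \<rightarrow>\<^sub>E R. inj_on f J}" using finite_PiE[OF J, of "\<lambda>_. R"] R by auto
    show "(\<lambda>f. f ` J) ` {f \<in> J \<rightarrow>\<^sub>E R. inj_on f J} \<subseteq> {I. I \<subseteq> R \<and> card I = card J}"
      by (auto simp: card_image)
    show "finite {I. I \<subseteq> R \<and> card I = card J}"
      using R by (auto intro: finite_subset[of _ "Pow R"])
  qed
  also have "\<dots> = (\<Sum>I | I \<subseteq> R \<and> card I = card J. minor_det A I J * minor_det B I J)"
  proof (rule sum.cong[OF refl])
    fix I assume "I \<in> {I. I \<subseteq> R \<and> card I = card J}"
    then have I: "I \<subseteq> R" "card I = card J" by auto
    have finI: "finite I" using I(1) R finite_subset by blast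
    define e where "e = row_index I J"
    have e: "bij_betw e J I" unfolding e_def using finI J I(2) by (rule bij_betw_row_index)
    define e' where "e' = inv_into J e"
    have e'e: "e' (e a) = a" if "a \<in> J" for a using that e by (simp add: e'_def bij_betw_def)
    have ee': "e (e' i) = i" "e' i \<in> J" if "i \<in> I" for i
      using that e by (auto simp: e'_def bij_betw_def f_inv_into_f inv_into_into)
    have eI: "e a \<in> I" if "a \<in> J" for a using that e by (auto simp: bij_betw_def)
    have "(\<Sum>f\<in>{f \<in> {f \<in> J \<rightarrow>\<^sub>E R. inj_on f J}. f ` J = I}. (\<Prod>a\<in>J. A (f a) a) * G f) =
      (\<Sum>\<rho> | \<rho> permutes J. (\<Prod>a\<in>J. A (e (\<rho> a)) a) * set_det J (\<lambda>a. B (e (\<rho> a))))"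
    \<comment> \<open>An injective f with image I is the increasing bijection e preceded by a
      permutation \<rho> of J.\<close>
    proof (rule sum.reindex_bij_witness[of _ "\<lambda>\<rho>. restrict (\<lambda>a. e (\<rho> a)) J" "\<lambda>f a. if a \<in> J then e' (f a) else a"])
      fix f assume "f \<in> {f \<in> {f \<in> J \<rightarrow>\<^sub>E R. inj_on f J}. f ` J = I}"
      then have f: "f \<in> J \<rightarrow>\<^sub>E R" "inj_on f J" "f ` J = I" by auto
      have fI: "f a \<in> I" if "a \<in> J" for a using that f(3) by blast
      have "bij_betw (\<lambda>a. if a \<in> J then e' (f a) else a) J J"
      proof (rule bij_betw_imageI)
        show "inj_on (\<lambda>a. if a \<in> J then e' (f a) else a) J"
        proof (rule inj_onI)
          fix a b assume ab: "a \<in> J" "b \<in> J" "(if a \<in> J then e' (f a) else a) = (if b \<in> J then e' (f b) else b)"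
          then have "e (e' (f a)) = e (e' (f b))" by simp
          then have "f a = f b" using ee'(1) fI ab by simp
          then show "a = b" using f(2) ab by (auto dest: inj_onD)
        qed
        then show "(\<lambda>a. if a \<in> J then e' (f a) else a) ` J = J"
          using J by (intro endo_inj_surj) (use fI ee'(2) in auto)
      qed
      then show "(\<lambda>a. if a \<in> J then e' (f a) else a) \<in> {\<rho>. \<rho> permutes J}"
        by (auto intro!: bij_imp_permutes)
      show "restrict (\<lambda>a. e (if a \<in> J then e' (f a) else a)) J = f"
      proof (rule ext)
        fix a show "restrict (\<lambda>a. e (if a \<in> J then e' (f a) else a)) J a = f a"
          using PiE_arb[OF f(1), of a] ee'(1)[OF fI, of a] by (cases "a \<in> J") auto
      qed
      have "set_det J (\<lambda>a. B (e (if a \<in> J then e' (f a) else a))) = G f"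
        unfolding G_def set_det_def using fI by (intro sum.cong refl arg_cong2[where f = "(*)"] prod.cong) (auto simp: ee')
      then show "(\<Prod>a\<in>J. A (e (if a \<in> J then e' (f a) else a)) a) *
           set_det J (\<lambda>a. B (e (if a \<in> J then e' (f a) else a))) = (\<Prod>a\<in>J. A (f a) a) * G f"
        using fI by (intro arg_cong2[where f = "(*)"] prod.cong) (auto simp: ee')
    next
      fix \<rho> assume "\<rho> \<in> {\<rho>. \<rho> permutes J}"
      then have \<rho>: "\<rho> permutes J" by simp
      have \<rho>J: "\<rho> a \<in> J" if "a \<in> J" for a using that permutes_in_image[OF \<rho>] by simp
      show "(\<lambda>a. if a \<in> J then e' (restrict (\<lambda>a. e (\<rho> a)) J a) else a) = \<rho>"
        using \<rho> \<rho>J by (auto simp: fun_eq_iff e'e permutes_not_in)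
      have "(\<lambda>a. e (\<rho> a)) ` J = e ` (\<rho> ` J)" by (simp add: image_image)
      also have "\<dots> = I" using e permutes_image[OF \<rho>] by (simp add: bij_betw_def)
      finally have im: "(\<lambda>a. e (\<rho> a)) ` J = I" .
      have "inj_on (\<lambda>a. e (\<rho> a)) J"
      proof (rule inj_onI)
        fix a b assume "a \<in> J" "b \<in> J" "e (\<rho> a) = e (\<rho> b)"
        then have "\<rho> a = \<rho> b" using e \<rho>J by (auto simp: bij_betw_def dest: inj_onD)
        then show "a = b" using permutes_inj[OF \<rho>] by (auto dest: injD)
      qed
      then show "restrict (\<lambda>a. e (\<rho> a)) J \<in> {f \<in> {f \<in> J \<rightarrow>\<^sub>E R. inj_on f J}. f ` J = I}"
        using im I(1) eI \<rho>J by (auto simp: inj_on_restrict_eq)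
    qed
    also have "\<dots> = (\<Sum>\<rho> | \<rho> permutes J. of_int (sign \<rho>) * (\<Prod>a\<in>J. A (e (\<rho> a)) a)) * set_det J (\<lambda>a. B (e a))"
      unfolding sum_distrib_right
    proof (rule sum.cong[OF refl])
      fix \<rho> assume "\<rho> \<in> {\<rho>. \<rho> permutes J}"
      then show "(\<Prod>a\<in>J. A (e (\<rho> a)) a) * set_det J (\<lambda>a. B (e (\<rho> a))) =
          of_int (sign \<rho>) * (\<Prod>a\<in>J. A (e (\<rho> a)) a) * set_det J (\<lambda>a. B (e a))"
        using set_det_permute_rows[OF J, of \<rho> "\<lambda>a. B (e a)"] by simp
    qed
    also have "(\<Sum>\<rho> | \<rho> permutes J. of_int (sign \<rho>) * (\<Prod>a\<in>J. A (e (\<rho> a)) a)) = set_det J (\<lambda>a. A (e a))"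
      using set_det_transpose[OF J, of "\<lambda>a. A (e a)"] by (simp add: set_det_def)
    finally show "(\<Sum>f\<in>{f \<in> {f \<in> J \<rightarrow>\<^sub>E R. inj_on f J}. f ` J = I}. (\<Prod>a\<in>J. A (f a) a) * G f) =
        minor_det A I J * minor_det B I J"
      by (simp add: minor_det_def e_def)
  qed
  finally show ?thesis .
qed

text \<open>A rank-one matrix is a product through a one-element index set, so Cauchy-Binet leaves
  no term in its minors of size at least 2. Only the empty set and the singletons
  contribute.\<close>

lemma det_id_plus_rank_one:
  fixes x l :: "nat \<Rightarrow> real"
  shows "Determinant.det (Matrix.mat m m (\<lambda>(i, j). (if i = j then 1 else 0) + x i * l j)) = 1 + (\<Sum>i<m. x i * l i)"
proof -
  have "set_det J (\<lambda>a b. x a * l b) = (if J = {} then 1 else if card J = 1 then (\<Sum>i\<in>J. x i * l i) else 0)"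
    if J: "J \<subseteq> {0..<m}" for J
  proof -
    have fin: "finite J" using J finite_subset by blast
    consider "J = {}" | i where "J = {i}" | "card J \<ge> 2"
      using fin by (metis One_nat_def Suc_leI card_0_eq card_1_singletonE less_2_cases linorder_not_le)
    then show ?thesis
    proof cases
      case 3
      have "set_det J (\<lambda>a b. x a * l b) = set_det J (\<lambda>a b. \<Sum>i\<in>{0::nat}. x a * l b)" by simp
      also have "\<dots> = (\<Sum>I | I \<subseteq> {0::nat} \<and> card I = card J. minor_det (\<lambda>i. x) I J * minor_det (\<lambda>i. l) I J)"
        by (rule Cauchy_Binet_set_det[OF fin]) simp
      also have "{I. I \<subseteq> {0::nat} \<and> card I = card J} = {}"
      proof -
        have ne: "card I \<noteq> card J" if "I \<subseteq> {0::nat}" for I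
          using card_mono[OF _ that] 3 by simp
        show ?thesis
        proof (rule equals0I)
          fix I assume "I \<in> {I. I \<subseteq> {0::nat} \<and> card I = card J}"
          then show False using ne[of I] by simp
        qed
      qed
      finally show ?thesis using 3 by auto
    qed (auto simp: set_det_def)
  qed
  then have "(\<Sum>J\<in>Pow {0..<m}. set_det J (\<lambda>a b. x a * l b)) =
     (\<Sum>J\<in>Pow {0..<m}. if J = {} then 1 else if card J = 1 then (\<Sum>i\<in>J. x i * l i) else 0)"
    by (intro sum.cong) auto
  also have "\<dots> = (\<Sum>J\<in>insert {} ((\<lambda>i. {i}) ` {0..<m}). if J = {} then 1 else if card J = 1 then (\<Sum>i\<in>J. x i * l i) else 0)"
  proof (rule sum.mono_neutral_right)
    show "\<forall>J\<in>Pow {0..<m} - insert {} ((\<lambda>i. {i}) ` {0..<m}).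
        (if J = {} then 1 else if card J = 1 then (\<Sum>i\<in>J. x i * l i) else 0) = 0"
    proof
      fix J assume J: "J \<in> Pow {0..<m} - insert {} ((\<lambda>i. {i}) ` {0..<m})"
      then have "card J \<noteq> 1" by (auto simp: card_1_singleton_iff)
      then show "(if J = {} then 1 else if card J = 1 then (\<Sum>i\<in>J. x i * l i) else 0) = 0"
        using J by simp
    qed
  qed auto
  also have "\<dots> = 1 + (\<Sum>i<m. x i * l i)"
    by (subst sum.insert) (auto simp: sum.reindex lessThan_atLeast0)
  finally show ?thesis by (simp add: det_id_plus)
qed

text \<open>By Cauchy-Binet, the principal minor with index set J of the transpose of D times D is
  the sum of the squared minors of D with columns J. The right-hand side is the radicand of the
  intrinsic Jacobian, which is thereby a Gram determinant.\<close>

theorem det_id_plus_Gram_eq_sum_minors: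
  fixes D :: "real mat"
  assumes D: "D \<in> carrier_mat k m"
  shows "Determinant.det (Matrix.mat m m (\<lambda>(a, b). (if a = b then 1 else 0) + (\<Sum>i<k. D $$ (i, a) * D $$ (i, b)))) =
    1 + (\<Sum>l = 1..k. \<Sum>(I, J) \<in> {(I, J). I \<subseteq> {..<k} \<and> J \<subseteq> {..<m} \<and> card I = l \<and> card J = l}.
          (Determinant.det (submatrix D I J))\<^sup>2)"
proof -
  define A where "A i j = D $$ (i, j)" for i j
  define S where "S = {(J, I). J \<subseteq> {..<m} \<and> I \<subseteq> {..<k} \<and> card I = card J}"
  have finS: "finite S"
    by (rule finite_subset[of _ "Pow {..<m} \<times> Pow {..<k}"]) (auto simp: S_def)
  have "Determinant.det (Matrix.mat m m (\<lambda>(a, b). (if a = b then 1 else 0) + (\<Sum>i<k. D $$ (i, a) * D $$ (i, b)))) =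
    (\<Sum>J\<in>Pow {0..<m}. set_det J (\<lambda>a b. \<Sum>i\<in>{..<k}. A i a * A i b))"
    unfolding A_def by (rule det_id_plus)
  also have "\<dots> = (\<Sum>J\<in>Pow {0..<m}. \<Sum>I | I \<subseteq> {..<k} \<and> card I = card J. (minor_det A I J)\<^sup>2)"
    by (intro sum.cong refl) (subst Cauchy_Binet_set_det, auto simp: power2_eq_square intro: finite_subset)
  also have "\<dots> = (\<Sum>(J, I)\<in>Sigma (Pow {0..<m}) (\<lambda>J. {I. I \<subseteq> {..<k} \<and> card I = card J}). (minor_det A I J)\<^sup>2)"
    by (intro sum.Sigma) (auto intro: finite_subset[of _ "Pow {..<k}"])
  also have "Sigma (Pow {0..<m}) (\<lambda>J. {I. I \<subseteq> {..<k} \<and> card I = card J}) = S"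
    by (auto simp: S_def)
  also have "(\<Sum>(J, I)\<in>S. (minor_det A I J)\<^sup>2) =
     (\<Sum>l\<in>{0..k}. \<Sum>(J, I)\<in>{x\<in>S. card (fst x) = l}. (minor_det A I J)\<^sup>2)"
  proof (rule sum.group[symmetric, OF finS])
    show "(\<lambda>x. card (fst x)) ` S \<subseteq> {0..k}"
    proof -
      have "card I \<le> k" if "I \<subseteq> {..<k}" for I
        using card_mono[OF _ that] by simp
      then show ?thesis by (auto simp: S_def) metis
    qed
  qed simp
  also have "\<dots> = (\<Sum>l\<in>{0..k}. \<Sum>(I, J) \<in> {(I, J). I \<subseteq> {..<k} \<and> J \<subseteq> {..<m} \<and> card I = l \<and> card J = l}.
          (Determinant.det (submatrix D I J))\<^sup>2)"
  proof (rule sum.cong[OF refl])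
    fix l
    show "(\<Sum>(J, I)\<in>{x\<in>S. card (fst x) = l}. (minor_det A I J)\<^sup>2) =
      (\<Sum>(I, J) \<in> {(I, J). I \<subseteq> {..<k} \<and> J \<subseteq> {..<m} \<and> card I = l \<and> card J = l}. (Determinant.det (submatrix D I J))\<^sup>2)"
      by (rule sum.reindex_bij_witness[of _ prod.swap prod.swap])
        (auto simp: S_def A_def[abs_def] det_submatrix[OF D])
  qed
  \<comment> \<open>The term l = 0 is the empty minor, equal to 1: it is the separate summand 1 of
    the Jacobian.\<close>
  also have "\<dots> = (\<Sum>(I, J) \<in> {(I, J). I \<subseteq> {..<k} \<and> J \<subseteq> {..<m} \<and> card I = 0 \<and> card J = 0}.
          (Determinant.det (submatrix D I J))\<^sup>2) + (\<Sum>l = 1..k. \<Sum>(I, J) \<in> {(I, J). I \<subseteq> {..<k} \<and> J \<subseteq> {..<m} \<and> card I = l \<and> card J = l}.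
          (Determinant.det (submatrix D I J))\<^sup>2)"
    by (subst sum.atLeast_Suc_atMost) auto
  also have "{(I, J). I \<subseteq> {..<k} \<and> J \<subseteq> {..<m} \<and> card I = 0 \<and> card J = 0} = {({}, {})}"
    by (auto dest: finite_subset[OF _ finite_lessThan])
  also have "(\<Sum>(I, J) \<in> {({}, {})}. (Determinant.det (submatrix D I J))\<^sup>2) = 1"
    by (simp add: det_submatrix[OF D] minor_det_def set_det_def)
  finally show ?thesis .
qed

section \<open>Linear intrinsic graphs\<close>

context euclidean_subspace
begin

lemma nn_integral_nu_scale:
  assumes "r > 0" and f [measurable]: "f \<in> borel_measurable borel"
  shows "ennreal (r ^ p) * (\<integral>\<^sup>+x. f (r *\<^sub>R x) \<partial>\<nu>) = (\<integral>\<^sup>+x. f x \<partial>\<nu>)"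
proof -
  have "density (distr \<nu> borel (\<lambda>x. r *\<^sub>R x)) (\<lambda>_. ennreal (r ^ p)) = \<nu>"
  proof (rule measure_eqI)
    fix S assume "S \<in> sets (density (distr \<nu> borel (\<lambda>x. r *\<^sub>R x)) (\<lambda>_. ennreal (r ^ p)))"
    then have S: "S \<in> sets borel" by simp
    then have S': "(\<lambda>x. r *\<^sub>R x) -` S \<in> sets borel"
      using measurable_sets[of "\<lambda>x. r *\<^sub>R x" borel borel S] by simp
    have eq: "(\<lambda>x. r *\<^sub>R x) ` (P \<inter> (\<lambda>x. r *\<^sub>R x) -` S) = P \<inter> S"
    proof (intro equalityI subsetI)
      fix y assume "y \<in> P \<inter> S"
      then have "(1 / r) *\<^sub>R y \<in> P \<inter> (\<lambda>x. r *\<^sub>R x) -` S"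
        using \<open>r > 0\<close> P by (auto simp: subspace_scale)
      then show "y \<in> (\<lambda>x. r *\<^sub>R x) ` (P \<inter> (\<lambda>x. r *\<^sub>R x) -` S)"
        using \<open>r > 0\<close> by (intro image_eqI[of _ _ "(1 / r) *\<^sub>R y"]) auto
    qed (use P in \<open>auto simp: subspace_scale\<close>)
    have "emeasure (density (distr \<nu> borel (\<lambda>x. r *\<^sub>R x)) (\<lambda>_. ennreal (r ^ p))) S =
        ennreal (r ^ p) * hausdorff_E p (P \<inter> (\<lambda>x. r *\<^sub>R x) -` S)"
      using S S' by (simp add: emeasure_density_const emeasure_distr emeasure_nu)
    also have "\<dots> = ennreal (r ^ p) * hausdorff_E p ((\<lambda>x. x) ` (P \<inter> (\<lambda>x. r *\<^sub>R x) -` S))"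
      by simp
    also have "\<dots> = hausdorff_E p ((\<lambda>x. r *\<^sub>R x) ` (P \<inter> (\<lambda>x. r *\<^sub>R x) -` S))"
      using \<open>r > 0\<close> by (intro hausdorff_E_similarity[symmetric]) (auto simp: dist_norm simp flip: scaleR_diff_right)
    also have "\<dots> = hausdorff_E p (P \<inter> S)" by (simp only: eq)
    finally show "emeasure (density (distr \<nu> borel (\<lambda>x. r *\<^sub>R x)) (\<lambda>_. ennreal (r ^ p))) S = emeasure \<nu> S"
      using S by (simp add: emeasure_nu)
  qed simp
  then have "(\<integral>\<^sup>+x. f x \<partial>\<nu>) = (\<integral>\<^sup>+x. f x \<partial>density (distr \<nu> borel (\<lambda>x. r *\<^sub>R x)) (\<lambda>_. ennreal (r ^ p)))"
    by simp
  also have "\<dots> = ennreal (r ^ p) * (\<integral>\<^sup>+x. f (r *\<^sub>R x) \<partial>\<nu>)"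
    by (simp add: nn_integral_density nn_integral_distr nn_integral_cmult)
  finally show ?thesis by simp
qed

end

lemma euclidean_orthogonal_projection:
  fixes P :: "'a::euclidean_space set"
  assumes "subspace P"
  obtains g where "g \<in> P" "\<And>y. y \<in> P \<Longrightarrow> inner g y = inner c y"
proof -
  obtain y z where yz: "y \<in> span P" "\<And>w. w \<in> span P \<Longrightarrow> real_inner_class.orthogonal z w" "c = y + z"
    using orthogonal_subspace_decomp_exists[of P c] by metis
  show thesis
  proof (rule that)
    show "y \<in> P" using yz(1) assms by (simp add: span_eq_iff[THEN iffD2])
    fix x assume "x \<in> P"
    then show "inner y x = inner c x"
      using yz(2)[of x] by (simp add: yz(3) span_base real_inner_class.orthogonal_def inner_add_left)
  qed
qed

section \<open>Coordinates and projections for an orthogonal splitting\<close>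

locale adapted_splitting = homog_dist d
  for d :: "'n::finite heis \<Rightarrow> 'n heis \<Rightarrow> real" +
  fixes k :: nat and W V :: "'n heis set" and v w :: "nat \<Rightarrow> 'n heis"
    and m p :: nat
  assumes m: "m = 2 * CARD('n) - k" and p: "p = 2 * CARD('n) + 1 - k"
    and k: "1 \<le> k" "k \<le> CARD('n)"
    and orth: "\<And>a b. a \<in> W \<Longrightarrow> b \<in> V \<Longrightarrow> inner a b = 0"
    and basis: "adapted_basis k W V v w"
begin

text \<open>The order is that of the columns of \<open>h_matrix\<close>, so column j of a matrix
  refers to \<open>b j\<close>.\<close>

definition b :: "nat \<Rightarrow> 'n heis" where
  "b j = (if j < CARD('n) - k then v (k + j) else w (j - (CARD('n) - k)))"

text \<open>\<open>m\<close> counts the horizontal directions of W and \<open>p\<close> is its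
  linear dimension; \<open>Suc p\<close>, the exponent of the spherical measure, is its homogeneous
  dimension.\<close>

lemma p_eq: "p = Suc m" and dims: "2 * CARD('n) + 2 - k = Suc p"
  using k by (auto simp: m p)

lemma V_eq: "V = span (v ` {..<k})"
  and W_eq0: "W = span (v ` {k..<CARD('n)} \<union> w ` {..<CARD('n)} \<union> {e_last})"
  and hb: "heisenberg_basis v w"
  using basis by (auto simp: adapted_basis_def)

lemma W_eq: "W = span (b ` {..<m} \<union> {e_last})"
proof -
  have "b ` {..<m} = v ` {k..<CARD('n)} \<union> w ` {..<CARD('n)}"
  proof (intro equalityI subsetI)
    fix x assume "x \<in> b ` {..<m}"
    then obtain j where j: "j < m" "x = b j" by auto
    show "x \<in> v ` {k..<CARD('n)} \<union> w ` {..<CARD('n)}"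
    proof (cases "j < CARD('n) - k")
      case True
      then show ?thesis using j by (auto simp: b_def)
    next
      case False
      then have "j - (CARD('n) - k) < CARD('n)" using j k by (auto simp: m)
      then show ?thesis using j False by (auto simp: b_def)
    qed
  next
    fix x assume "x \<in> v ` {k..<CARD('n)} \<union> w ` {..<CARD('n)}"
    then consider i where "k \<le> i" "i < CARD('n)" "x = v i" | i where "i < CARD('n)" "x = w i" by auto
    then show "x \<in> b ` {..<m}"
    proof cases
      case 1
      then show ?thesis by (intro image_eqI[of _ _ "i - k"]) (auto simp: b_def m)
    next
      case 2
      then show ?thesis using k by (intro image_eqI[of _ _ "i + (CARD('n) - k)"]) (auto simp: b_def m)
    qed
  qed
  then show ?thesis by (simp add: W_eq0)
qed

lemma subspace_W: "subspace W" and subspace_V: "subspace V"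
  by (simp_all add: W_eq0 V_eq)

lemma v_in_V: "i < k \<Longrightarrow> v i \<in> V" and b_in_W: "j < m \<Longrightarrow> b j \<in> W" and e_last_in_W: "e_last \<in> W"
  by (auto simp: V_eq W_eq intro: span_base)

lemma H1_iff: "x \<in> H1 \<longleftrightarrow> inner x e_last = 0"
  by (auto simp: H1_def e_last_def inner_prod_def)

lemma b_H1: "j < m \<Longrightarrow> inner (b j) e_last = 0"
  using hb k by (auto simp: heisenberg_basis_def H1_iff b_def m)

lemma e_last_b: "j < m \<Longrightarrow> inner e_last (b j) = 0"
  using b_H1[of j] by (simp add: inner_commute[of e_last "b j"])

lemma inner_e_last: "inner e_last (e_last :: 'n heis) = 1"
  by (simp add: e_last_def inner_prod_def)

lemma norm_e_last: "norm (e_last :: 'n heis) = 1"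
  by (simp add: norm_eq_sqrt_inner inner_e_last)

lemma inner_v: "i < k \<Longrightarrow> i' < k \<Longrightarrow> inner (v i) (v i') = (if i = i' then 1 else 0)"
  using hb k by (auto simp: heisenberg_basis_def)

lemma inner_b: "j < m \<Longrightarrow> j' < m \<Longrightarrow> inner (b j) (b j') = (if j = j' then 1 else 0)"
proof -
  have *: "inner (w i) (v i') = 0" if "i < CARD('n)" "i' < CARD('n)" for i i'
    using hb that by (simp add: heisenberg_basis_def inner_commute[of "w i"])
  assume "j < m" "j' < m"
  then show ?thesis
    using hb k by (auto simp: heisenberg_basis_def b_def m *)
qed

lemma inner_W_v: "u \<in> W \<Longrightarrow> i < k \<Longrightarrow> inner u (v i) = 0"
  using orth v_in_V by blast

lemma inner_b_v: "j < m \<Longrightarrow> i < k \<Longrightarrow> inner (b j) (v i) = 0"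
  using inner_W_v b_in_W by blast

lemma V_expand: "x \<in> V \<Longrightarrow> x = (\<Sum>i<k. inner x (v i) *\<^sub>R v i)"
  unfolding V_eq
proof (induction rule: span_induct)
  case base
  show ?case
  proof (rule subspaceI)
    show "0 \<in> {x. x = (\<Sum>i<k. inner x (v i) *\<^sub>R v i)}" by simp
    fix x y assume xy: "x \<in> {x. x = (\<Sum>i<k. inner x (v i) *\<^sub>R v i)}" "y \<in> {x. x = (\<Sum>i<k. inner x (v i) *\<^sub>R v i)}"
    have "(\<Sum>i<k. inner (x + y) (v i) *\<^sub>R v i) = (\<Sum>i<k. inner x (v i) *\<^sub>R v i) + (\<Sum>i<k. inner y (v i) *\<^sub>R v i)"
      by (simp add: inner_add_left scaleR_add_left sum.distrib)
    also have "\<dots> = x + y" using xy by simp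
    finally show "x + y \<in> {x. x = (\<Sum>i<k. inner x (v i) *\<^sub>R v i)}" by simp
  next
    fix c x assume x: "x \<in> {x. x = (\<Sum>i<k. inner x (v i) *\<^sub>R v i)}"
    have "(\<Sum>i<k. inner (c *\<^sub>R x) (v i) *\<^sub>R v i) = c *\<^sub>R (\<Sum>i<k. inner x (v i) *\<^sub>R v i)"
      by (simp add: scaleR_sum_right)
    also have "\<dots> = c *\<^sub>R x" using x by simp
    finally show "c *\<^sub>R x \<in> {x. x = (\<Sum>i<k. inner x (v i) *\<^sub>R v i)}" by simp
  qed
next
  case (step x)
  then obtain i where i: "i < k" "x = v i" by auto
  have "(\<Sum>j<k. inner x (v j) *\<^sub>R v j) = (\<Sum>j<k. if i = j then v j else 0)"
    using i by (intro sum.cong) (auto simp: inner_v)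
  then show ?case using i by simp
qed

lemma W_expand: "x \<in> W \<Longrightarrow> x = (\<Sum>j<m. inner x (b j) *\<^sub>R b j) + inner x e_last *\<^sub>R e_last"
  unfolding W_eq
proof (induction rule: span_induct)
  case base
  show ?case
  proof (rule subspaceI)
    show "0 \<in> {x. x = (\<Sum>j<m. inner x (b j) *\<^sub>R b j) + inner x e_last *\<^sub>R e_last}" by simp
    fix x y assume xy: "x \<in> {x. x = (\<Sum>j<m. inner x (b j) *\<^sub>R b j) + inner x e_last *\<^sub>R e_last}"
       "y \<in> {x. x = (\<Sum>j<m. inner x (b j) *\<^sub>R b j) + inner x e_last *\<^sub>R e_last}"
    have "(\<Sum>j<m. inner (x + y) (b j) *\<^sub>R b j) + inner (x + y) e_last *\<^sub>R e_last =
       ((\<Sum>j<m. inner x (b j) *\<^sub>R b j) + inner x e_last *\<^sub>R e_last) +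
       ((\<Sum>j<m. inner y (b j) *\<^sub>R b j) + inner y e_last *\<^sub>R e_last)"
      by (simp add: inner_add_left scaleR_add_left sum.distrib)
    also have "\<dots> = x + y" using xy by simp
    finally show "x + y \<in> {x. x = (\<Sum>j<m. inner x (b j) *\<^sub>R b j) + inner x e_last *\<^sub>R e_last}" by simp
  next
    fix c x assume x: "x \<in> {x. x = (\<Sum>j<m. inner x (b j) *\<^sub>R b j) + inner x e_last *\<^sub>R e_last}"
    have "(\<Sum>j<m. inner (c *\<^sub>R x) (b j) *\<^sub>R b j) + inner (c *\<^sub>R x) e_last *\<^sub>R e_last =
       c *\<^sub>R ((\<Sum>j<m. inner x (b j) *\<^sub>R b j) + inner x e_last *\<^sub>R e_last)"
      by (simp add: scaleR_sum_right scaleR_add_right)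
    also have "\<dots> = c *\<^sub>R x" using x by simp
    finally show "c *\<^sub>R x \<in> {x. x = (\<Sum>j<m. inner x (b j) *\<^sub>R b j) + inner x e_last *\<^sub>R e_last}" by simp
  qed
next
  case (step x)
  then consider j where "j < m" "x = b j" | "x = e_last" by auto
  then show ?case
  proof cases
    case 1
    have "(\<Sum>c<m. inner x (b c) *\<^sub>R b c) = (\<Sum>c<m. if j = c then b c else 0)"
      using 1 by (intro sum.cong) (auto simp: inner_b)
    then show ?thesis using 1 by (simp add: b_H1)
  next
    case 2
    then show ?thesis
      by (simp add: inner_e_last e_last_b)
  qed
qed

lemma sum_v_V: "i \<le> k \<Longrightarrow> (\<Sum>r<i. c r *\<^sub>R v r) \<in> V"
  by (intro subspace_sum[OF subspace_V] subspace_scale[OF subspace_V] v_in_V) auto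

text \<open>The orthogonal projection onto V. It kills \<open>e_last\<close>, hence is additive on
  group products, and so coincides with the group component \<open>proj_V\<close> (see
  \<open>proj_V_eq\<close>).\<close>

definition PV :: "'n heis \<Rightarrow> 'n heis" where
  "PV x = (\<Sum>i<k. inner x (v i) *\<^sub>R v i)"

lemma PV_V: "PV x \<in> V"
  unfolding PV_def by (rule sum_v_V) simp

lemma PV_eq: "x \<in> V \<Longrightarrow> PV x = x"
  using V_expand[of x] by (simp add: PV_def)

lemma PV_W: "x \<in> W \<Longrightarrow> PV x = 0"
  by (simp add: PV_def inner_W_v)

lemma PV_add: "PV (x + y) = PV x + PV y" and PV_scale: "PV (c *\<^sub>R x) = c *\<^sub>R PV x"
  and PV_minus: "PV (- x) = - PV x"
  by (simp_all add: PV_def inner_add_left scaleR_add_left sum.distrib scaleR_sum_right sum_negf)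

lemma PV_e_last: "PV e_last = 0"
  by (rule PV_W[OF e_last_in_W])

lemma continuous_on_PV [continuous_intros]: "continuous_on A f \<Longrightarrow> continuous_on A (\<lambda>x. PV (f x))"
  unfolding PV_def by (intro continuous_intros)

lemma PV_hmul: "PV (x \<cdot> y) = PV x + PV y"
  by (simp add: hmul_eq PV_add PV_scale PV_e_last)

lemma minus_PV_W: "x - PV x \<in> W"
proof -
  have "span (v ` {..<CARD('n)} \<union> w ` {..<CARD('n)} \<union> {e_last}) = UNIV"
    using hb by (simp add: heisenberg_basis_def)
  moreover have "v ` {..<CARD('n)} \<union> w ` {..<CARD('n)} \<union> {e_last} \<subseteq> v ` {..<k} \<union> (v ` {k..<CARD('n)} \<union> w ` {..<CARD('n)} \<union> {e_last})"
    by force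
  ultimately have "x \<in> span (v ` {..<k} \<union> (v ` {k..<CARD('n)} \<union> w ` {..<CARD('n)} \<union> {e_last}))"
    using span_mono by blast
  then obtain a c where ac: "a \<in> V" "c \<in> W" "x = a + c"
    unfolding span_Un V_eq W_eq0 by blast
  then show ?thesis by (simp add: PV_add PV_eq PV_W)
qed

lemma W_iff: "x \<in> W \<longleftrightarrow> PV x = 0"
  by (metis PV_W diff_zero minus_PV_W)

lemma hmul_W: "x \<in> W \<Longrightarrow> y \<in> W \<Longrightarrow> x \<cdot> y \<in> W"
  by (simp add: W_iff PV_hmul)

lemma omega_V: "x \<in> V \<Longrightarrow> y \<in> V \<Longrightarrow> omega x y = 0"
proof -
  have vv: "omega (v i) (v j) = 0" if "i < k" "j < k" for i j
    using hb k that by (auto simp: heisenberg_basis_def)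
  have lin: "subspace {x. omega x y = 0}" "subspace {x. omega y x = 0}" for y :: "'n heis"
    by (auto simp: subspace_def)
  assume "x \<in> V" "y \<in> V"
  have "v ` {..<k} \<subseteq> {x. omega x (v j) = 0}" if "j < k" for j using vv that by auto
  then have "V \<subseteq> {x. omega x (v j) = 0}" if "j < k" for j
    unfolding V_eq using that lin by (intro span_minimal) auto
  then have "v ` {..<k} \<subseteq> {y. omega x y = 0}"
    using \<open>x \<in> V\<close> by (intro image_subsetI) (simp add: subset_iff)
  then have "V \<subseteq> {y. omega x y = 0}"
    unfolding V_eq using lin by (intro span_minimal) auto
  then show ?thesis using \<open>y \<in> V\<close> by auto
qed

lemma hmul_V: "x \<in> V \<Longrightarrow> y \<in> V \<Longrightarrow> x \<cdot> y = x + y"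
  by (simp add: hmul_eq omega_V)

lemma V_H1: "x \<in> V \<Longrightarrow> inner x e_last = 0"
  by (metis e_last_in_W inner_commute orth)

lemma snd_snd_eq: "snd (snd x) = inner x e_last"
  by (simp add: e_last_def inner_prod_def)

lemma dil_V: "x \<in> V \<Longrightarrow> dil t x = t *\<^sub>R x"
  by (simp add: dil_eq snd_snd_eq V_H1)

lemma PV_dil: "PV (dil t x) = t *\<^sub>R PV x"
  by (simp add: dil_eq PV_add PV_scale PV_e_last)

lemma dil_in_W: "x \<in> W \<Longrightarrow> dil t x \<in> W"
  by (simp add: W_iff PV_dil)

lemma closed_W: "closed W"
  using closed_subspace[OF subspace_W] .

lemma proj_V_eq: "proj_V W V x = PV x"
  unfolding proj_V_def
proof (rule the_equality)
  have "PV (x \<cdot> hinv (PV x)) = 0"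
    by (simp add: PV_hmul hinv_def PV_minus PV_eq[OF PV_V])
  moreover have "x = (x \<cdot> hinv (PV x)) \<cdot> PV x"
    by (simp add: hmul_assoc)
  ultimately show "PV x \<in> V \<and> (\<exists>u\<in>W. x = u \<cdot> PV x)"
    using PV_V W_iff by blast
  fix y assume "y \<in> V \<and> (\<exists>u\<in>W. x = u \<cdot> y)"
  then obtain u where "y \<in> V" "u \<in> W" "x = u \<cdot> y" by blast
  then show "y = PV x" by (simp add: PV_hmul PV_W PV_eq)
qed

text \<open>The group component in W. Unlike \<open>PV\<close> it is not linear: it differs from
  \<open>x - PV x\<close> by a vertical term.\<close>

definition PW :: "'n heis \<Rightarrow> 'n heis" where
  "PW x = x \<cdot> hinv (PV x)"

lemma PW_W: "PW x \<in> W"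
  by (simp add: PW_def W_iff PV_hmul hinv_def PV_minus PV_eq[OF PV_V])

lemma PW_PV: "PW x \<cdot> PV x = x"
  by (simp add: PW_def hmul_assoc)

lemma PW_hmul: "u \<in> W \<Longrightarrow> y \<in> V \<Longrightarrow> PW (u \<cdot> y) = u" 
  and PV_hmul': "u \<in> W \<Longrightarrow> y \<in> V \<Longrightarrow> PV (u \<cdot> y) = y"
  by (simp_all add: PW_def PV_hmul PV_W PV_eq hmul_assoc)

lemma continuous_on_PW [continuous_intros]: "continuous_on A f \<Longrightarrow> continuous_on A (\<lambda>x. PW (f x))"
  unfolding PW_def by (intro continuous_intros)

lemma conj_W:
  assumes "u \<in> W"
  shows "x \<cdot> u \<cdot> hinv (PV x) \<in> W"
  using assms by (simp add: W_iff PV_hmul hinv_def PV_minus PV_eq[OF PV_V])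

text \<open>The map \<open>W \<rightarrow> V\<close> with matrix \<open>D\<close>, extended by zero to the orthogonal complement \<open>V\<close> of \<open>W\<close>.\<close>

definition lin :: "real mat \<Rightarrow> 'n heis \<Rightarrow> 'n heis" where
  "lin D x = (\<Sum>i<k. (\<Sum>j<m. D $$ (i, j) * inner x (b j)) *\<^sub>R v i)"

lemma lin_add: "lin D (x + y) = lin D x + lin D y"
  and lin_scale: "lin D (c *\<^sub>R x) = c *\<^sub>R lin D x"
  by (simp_all add: lin_def inner_add_left scaleR_add_left sum.distrib distrib_left scaleR_sum_right
      sum_distrib_left mult.left_commute)

lemma lin_minus: "lin D (- x) = - lin D x"
  using lin_scale[of D "-1" x] by simp

lemma lin_diff: "lin D (x - y) = lin D x - lin D y"
  using lin_add[of D x "- y"] by (simp add: lin_minus)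

lemma lin_e_last: "lin D e_last = 0"
  by (simp add: lin_def e_last_b)

lemma lin_V: "lin D x \<in> V"
  unfolding lin_def by (rule sum_v_V) simp

lemma lin_hmul: "lin D (x \<cdot> y) = lin D x + lin D y"
  by (simp add: hmul_eq lin_add lin_scale lin_e_last)

lemma lin_dil: "lin D (dil t x) = t *\<^sub>R lin D x"
  by (simp add: dil_eq lin_add lin_scale lin_e_last)

lemma lin_dil': "lin D (dil t x) = dil t (lin D x)"
  by (simp add: lin_dil dil_V[OF lin_V])

lemma lin_0: "lin D 0 = 0"
  by (simp add: lin_def)

lemma continuous_on_lin [continuous_intros]: "continuous_on A f \<Longrightarrow> continuous_on A (\<lambda>x. lin D (f x))"
  unfolding lin_def by (intro continuous_intros)

lemma h_homomorphism_lin: "h_homomorphism W V (lin D)"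
  by (auto simp: h_homomorphism_def lin_V lin_hmul hmul_V lin_dil')

text \<open>Homogeneity forces L to vanish on the centre. Modulo the centre the product is vector
  addition, so L is linear on W and determined by its values on the vectors
  \<open>b j\<close>.\<close>

lemma h_homomorphism_eq_lin:
  assumes L: "h_homomorphism W V L" and u: "u \<in> W"
  shows "L u = lin (h_matrix k v w L) u"
proof -
  have LV: "L x \<in> V" if "x \<in> W" for x using L that by (simp add: h_homomorphism_def)
  have Lmul: "L (x \<cdot> y) = L x + L y" if "x \<in> W" "y \<in> W" for x y
    using L that LV by (simp add: h_homomorphism_def hmul_V)
  have Ldil: "L (dil t x) = t *\<^sub>R L x" if "t > 0" "x \<in> W" for t x
    using L that LV by (simp add: h_homomorphism_def dil_V)
  have eW: "c *\<^sub>R e_last \<in> W" for c using e_last_in_W subspace_W by (simp add: subspace_scale)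
  \<comment> \<open>\<open>dil 2\<close> multiplies a vertical vector by 4, so the result is a
    product of four copies: homogeneity gives the factor 2, multiplicativity the factor 4.\<close>
  have Le: "L (c *\<^sub>R e_last) = 0" for c
  proof -
    have "2 *\<^sub>R L (c *\<^sub>R e_last) = L (dil 2 (c *\<^sub>R e_last))" by (rule Ldil[OF _ eW, symmetric]) simp
    also have "dil 2 (c *\<^sub>R e_last) = (c *\<^sub>R e_last \<cdot> c *\<^sub>R e_last) \<cdot> (c *\<^sub>R e_last \<cdot> c *\<^sub>R e_last)"
      by (simp add: dil_def e_last_def hmul_components)
    also have "L ((c *\<^sub>R e_last \<cdot> c *\<^sub>R e_last) \<cdot> (c *\<^sub>R e_last \<cdot> c *\<^sub>R e_last)) = 4 *\<^sub>R L (c *\<^sub>R e_last)"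
      using eW[of c] by (simp add: Lmul hmul_W scaleR_add_left[symmetric] flip: scaleR_2)
    finally have "2 *\<^sub>R L (c *\<^sub>R e_last) = 4 *\<^sub>R L (c *\<^sub>R e_last)" .
    then have "(4 - 2) *\<^sub>R L (c *\<^sub>R e_last) = 0" by (simp only: scaleR_diff_left) simp
    then show ?thesis by simp
  qed
  have Ladd: "L (x + y) = L x + L y" if xy: "x \<in> W" "y \<in> W" for x y
  proof -
    have "x + y = (x \<cdot> y) \<cdot> ((- omega x y / 2) *\<^sub>R e_last)"
      by (simp add: hmul_eq)
    then have "L (x + y) = L (x \<cdot> y) + L ((- omega x y / 2) *\<^sub>R e_last)"
      by (subst \<open>x + y = _\<close>) (rule Lmul[OF hmul_W[OF xy] eW])
    then show ?thesis using xy by (simp only: Lmul Le add_0_right)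
  qed
  have Lscale: "L (t *\<^sub>R x) = t *\<^sub>R L x" if x: "x \<in> W" "inner x e_last = 0" for t x
  proof -
    have pos: "L (t *\<^sub>R x) = t *\<^sub>R L x" if "t > 0" for t
      using Ldil[OF that x(1)] x(2) by (simp add: dil_eq snd_snd_eq)
    have L0: "L 0 = 0" using Le[of 0] by simp
    have sx: "c *\<^sub>R x \<in> W" for c using x subspace_W by (simp add: subspace_scale)
    consider "t > 0" | "t = 0" | "t < 0" by linarith
    then show ?thesis
    proof cases
      case 3
      have "L (t *\<^sub>R x + (- t) *\<^sub>R x) = L (t *\<^sub>R x) + L ((- t) *\<^sub>R x)" by (intro Ladd sx)
      then have "0 = L (t *\<^sub>R x) + (- t) *\<^sub>R L x" using pos[of "- t"] 3 L0 by simp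
      then show ?thesis by (simp add: eq_neg_iff_add_eq_0)
    qed (auto simp: pos L0)
  qed
  have Lsum: "L (\<Sum>j\<in>S. inner u (b j) *\<^sub>R b j) = (\<Sum>j\<in>S. inner u (b j) *\<^sub>R L (b j))
      \<and> (\<Sum>j\<in>S. inner u (b j) *\<^sub>R b j) \<in> W" if "finite S" "S \<subseteq> {..<m}" for S
    using that
  proof (induction S rule: finite_induct)
    case empty
    show ?case using Le[of 0] subspace_0[OF subspace_W] by simp
  next
    case (insert j S)
    then have "b j \<in> W" "inner (b j) e_last = 0" by (auto simp: b_in_W b_H1)
    then show ?case
      using insert subspace_W by (simp add: Ladd Lscale subspace_scale subspace_add)
  qed
  have "L u = L ((\<Sum>j<m. inner u (b j) *\<^sub>R b j) + inner u e_last *\<^sub>R e_last)"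
    using W_expand[OF u] by simp
  also have "\<dots> = (\<Sum>j<m. inner u (b j) *\<^sub>R L (b j))"
    using Lsum[of "{..<m}"] eW by (simp add: Ladd Le)
  also have "\<dots> = (\<Sum>j<m. inner u (b j) *\<^sub>R (\<Sum>i<k. inner (L (b j)) (v i) *\<^sub>R v i))"
    using V_expand[OF LV[OF b_in_W]] by (intro sum.cong refl) auto
  also have "\<dots> = (\<Sum>j<m. \<Sum>i<k. (h_matrix k v w L $$ (i, j) * inner u (b j)) *\<^sub>R v i)"
    unfolding scaleR_sum_right
  proof (intro sum.cong refl)
    fix i j assume "j \<in> {..<m}" "i \<in> {..<k}"
    then have "h_matrix k v w L $$ (i, j) = inner (L (b j)) (v i)"
      by (simp add: h_matrix_def b_def m inner_commute)
    then show "inner u (b j) *\<^sub>R inner (L (b j)) (v i) *\<^sub>R v i = (h_matrix k v w L $$ (i, j) * inner u (b j)) *\<^sub>R v i"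
      by simp
  qed
  also have "\<dots> = lin (h_matrix k v w L) u"
    unfolding lin_def by (subst sum.swap) (simp add: scaleR_sum_left)
  finally show ?thesis .
qed

lemma dim_W: "dim W = p"
proof -
  define B where "B = insert e_last (b ` {..<m})"
  have inj: "inj_on b {..<m}"
  proof (rule inj_onI)
    fix i j assume "i \<in> {..<m}" "j \<in> {..<m}" "b i = b j"
    then show "i = j" using inner_b[of i j] inner_b[of i i] by (auto split: if_splits)
  qed
  have "e_last \<notin> b ` {..<m}"
  proof
    assume "e_last \<in> b ` {..<m}"
    then obtain j where j: "j < m" "e_last = b j" by auto
    have "inner e_last (e_last :: 'n heis) = 0"
      by (subst (1) j(2)) (rule b_H1[OF j(1)])
    then show False using inner_e_last by simp
  qed
  then have card: "card B = p"
    using inj by (simp add: B_def card_image p_eq)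
  have "pairwise real_inner_class.orthogonal B"
    by (auto simp: pairwise_def B_def real_inner_class.orthogonal_def b_H1 inner_b e_last_b)
  moreover have "0 \<notin> B"
  proof
    assume "0 \<in> B"
    then consider "e_last = (0 :: 'n heis)" | j where "j < m" "b j = 0" by (auto simp: B_def)
    then show False
    proof cases
      case 1
      then show False using norm_e_last by (metis norm_zero zero_neq_one)
    next
      case 2
      then show False using inner_b[of j j] by simp
    qed
  qed
  ultimately have "independent B" by (rule pairwise_orthogonal_independent)
  moreover have "W = span B" by (simp add: W_eq B_def)
  ultimately show ?thesis using card by (simp add: dim_eq_card)
qed

sublocale Ws: euclidean_subspace W p
  by unfold_locales (use subspace_W dim_W p_eq in auto)

section \<open>Area formula for linear graphs\<close>

definition minor_jacobian :: "real mat \<Rightarrow> real" where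
  "minor_jacobian D = sqrt (1 + (\<Sum>l = 1..k.
        \<Sum>(I, J) \<in> {(I, J). I \<subseteq> {..<k} \<and> J \<subseteq> {..<m} \<and> card I = l \<and> card J = l}.
          (Determinant.det (submatrix D I J))\<^sup>2))"

lemma minor_jacobian_ge_1: "minor_jacobian D \<ge> 1"
  unfolding minor_jacobian_def by (auto intro!: sum_nonneg)

text \<open>The graph is built up one row of \<open>D\<close> at a time. Each step is a map \<open>y \<mapsto> y + \<langle>g, y\<rangle> v\<^sub>i\<close> on the
  previous graph, which scales the measure by \<open>\<surd>(1 + |g|\<^sup>2)\<close>, while the Gram determinant is multiplied
  by \<open>1 + |g|\<^sup>2\<close>.\<close>

lemma hausdorff_E_linear_graph:
  assumes D: "D \<in> carrier_mat k m" and S: "compact S" "S \<subseteq> W"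
  shows "hausdorff_E p ((\<lambda>u. u + lin D u) ` S) = ennreal (minor_jacobian D) * hausdorff_E p S"
proof -
  define l where "l i y = (\<Sum>j<m. D $$ (i, j) * inner y (b j))" for i and y :: "'n heis"
  define A where "A i y = y + (\<Sum>r<i. l r y *\<^sub>R v r)" for i y
  define G where "G i = Matrix.mat m m (\<lambda>(a, c). (if a = c then 1 else 0) + (\<Sum>r<i. D $$ (r, a) * D $$ (r, c)))" for i
  have l_add: "l i (x + y) = l i x + l i y" and l_scale: "l i (c *\<^sub>R x) = c * l i x" for i c x y
    by (simp_all add: l_def inner_add_left sum.distrib distrib_left sum_distrib_left mult.left_commute)
  have A_lin: "linear (A i)" for i
    by (rule linearI) (simp_all add: A_def l_add l_scale scaleR_add_left sum.distrib scaleR_sum_right scaleR_add_right)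
  have inner_A_b: "inner (A i y) (b j) = inner y (b j)" if "j < m" "i \<le> k" for i j y
    using that by (simp add: A_def inner_add_left inner_sum_left inner_b_v inner_commute[of "v _"])
  have l_A: "l r (A i y) = l r y" if "i \<le> k" for r i y
    using that by (simp add: l_def inner_A_b)
  have inner_A: "inner (A i y) (A i z) = inner y z + (\<Sum>r<i. l r y * l r z)" if i: "i \<le> k" and yz: "y \<in> W" "z \<in> W" for i y z
  proof -
    have 1: "inner y (\<Sum>r<i. l r z *\<^sub>R v r) = 0"
      using i yz by (simp add: inner_sum_right inner_W_v)
    have 2: "inner (\<Sum>r<i. l r y *\<^sub>R v r) z = 0"
      using i yz by (simp add: inner_sum_left inner_W_v inner_commute[of "v _"])
    have "inner (\<Sum>r<i. l r y *\<^sub>R v r) (\<Sum>r<i. l r z *\<^sub>R v r) = (\<Sum>r<i. \<Sum>s<i. if r = s then l r y * l s z else 0)"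
      unfolding inner_sum_left inner_sum_right using i by (intro sum.cong refl) (auto simp: inner_v)
    also have "\<dots> = (\<Sum>r<i. l r y * l r z)" by simp
    finally show ?thesis by (simp add: A_def inner_add_left inner_add_right 1 2)
  qed
  have "hausdorff_E p (A i ` S) = ennreal (sqrt (Determinant.det (G i))) * hausdorff_E p S" if "i \<le> k" for i
    using that
  proof (induction i)
    case 0
    have "G 0 = 1\<^sub>m m" by (auto simp: G_def intro!: eq_matI)
    then show ?case by (simp add: A_def)
  next
    case (Suc i)
    then have i: "i < k" by simp
    define P where "P = A i ` W"
    have P: "subspace P" unfolding P_def using A_lin subspace_W by (rule linear_subspace_image)
    have "inj_on (A i) W"
    proof (rule inj_onI)
      fix x y assume xy: "x \<in> W" "y \<in> W" "A i x = A i y"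
      have "A i (x - y) = 0" using xy by (simp add: linear_diff[OF A_lin])
      moreover have "PV (A i (x - y)) = A i (x - y) - (x - y)"
        using xy i PV_eq[OF sum_v_V[of i "\<lambda>r. l r (x - y)"]]
        by (simp add: A_def PV_add PV_W subspace_diff[OF subspace_W])
      ultimately show "x = y" by (simp add: PV_def)
    qed
    then have "dim P = dim W"
      unfolding P_def using subspace_W A_lin by (intro dim_image_eq) (auto simp: span_eq_iff[THEN iffD2])
    then interpret P: euclidean_subspace P p
      by unfold_locales (use P dim_W p_eq in auto)
    \<comment> \<open>The vector of row i lies in W and not in general in the graph P; its
      projection g represents the same functional on P.\<close>
    obtain g where g: "g \<in> P" "\<And>y. y \<in> P \<Longrightarrow> inner g y = inner (\<Sum>j<m. D $$ (i, j) *\<^sub>R b j) y"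
      using euclidean_orthogonal_projection[OF P] by blast
    have gl: "inner g y = l i y" if "y \<in> P" for y
      using g(2)[OF that] by (simp add: l_def inner_sum_left inner_commute[of "b _" y])
    obtain x where x: "x \<in> W" "g = A i x" using g(1) by (auto simp: P_def)
    define \<xi> where "\<xi> j = inner x (b j)" for j
    \<comment> \<open>The coordinates \<xi> of the preimage of g under \<open>A i\<close> solve the
      linear system with matrix \<open>G i\<close> and right-hand side row i of D.\<close>
    have G\<xi>: "(\<Sum>c<m. G i $$ (a, c) * \<xi> c) = D $$ (i, a)" if a: "a < m" for a
    proof -
      have lb: "l r (b a) = D $$ (r, a)" for r
      proof -
        have "l r (b a) = (\<Sum>j<m. if a = j then D $$ (r, j) else 0)"
          unfolding l_def using a by (intro sum.cong) (auto simp: inner_b)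
        then show ?thesis using a by simp
      qed
      have "(\<Sum>c<m. G i $$ (a, c) * \<xi> c) = (\<Sum>c<m. (if a = c then \<xi> c else 0) + (\<Sum>r<i. D $$ (r, a) * D $$ (r, c)) * \<xi> c)"
        using a by (intro sum.cong) (auto simp: G_def distrib_right)
      also have "\<dots> = \<xi> a + (\<Sum>c<m. \<Sum>r<i. D $$ (r, a) * (D $$ (r, c) * \<xi> c))"
        using a by (simp add: sum.distrib sum_distrib_right mult.assoc)
      also have "(\<Sum>c<m. \<Sum>r<i. D $$ (r, a) * (D $$ (r, c) * \<xi> c)) = (\<Sum>r<i. l r x * l r (b a))"
      proof -
        have lx: "l r x = (\<Sum>c<m. D $$ (r, c) * \<xi> c)" for r
          by (simp add: l_def \<xi>_def)
        show ?thesis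
          by (subst sum.swap) (simp only: lb lx sum_distrib_left[symmetric] mult.commute)
      qed
      also have "\<xi> a + \<dots> = inner (A i x) (A i (b a))"
        using i a x by (simp add: inner_A b_in_W \<xi>_def)
      also have "\<dots> = l i (b a)"
        using gl[of "A i (b a)"] x i a by (simp add: P_def b_in_W l_A)
      finally show ?thesis by (simp add: lb)
    qed
    have norm_g: "(norm g)\<^sup>2 = (\<Sum>j<m. \<xi> j * D $$ (i, j))"
      using gl[OF g(1)] x(2) i by (simp add: power2_norm_eq_inner l_A) (simp add: l_def \<xi>_def mult.commute)
    \<comment> \<open>Row i adds a rank-one matrix to the Gram matrix. By the system for \<xi>,
      factoring out \<open>G i\<close> leaves the identity plus a rank-one matrix, whose determinant
      is 1 + |g|^2.\<close>
    have G_Suc: "G (Suc i) = G i * Matrix.mat m m (\<lambda>(a, c). (if a = c then 1 else 0) + \<xi> a * D $$ (i, c))"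
    proof (rule eq_matI)
      fix a c assume "a < dim_row (G i * Matrix.mat m m (\<lambda>(a, c). (if a = c then 1 else 0) + \<xi> a * D $$ (i, c)))"
        "c < dim_col (G i * Matrix.mat m m (\<lambda>(a, c). (if a = c then 1 else 0) + \<xi> a * D $$ (i, c)))"
      then have ac: "a < m" "c < m" by (auto simp: G_def)
      have "(G i * Matrix.mat m m (\<lambda>(a, c). (if a = c then 1 else 0) + \<xi> a * D $$ (i, c))) $$ (a, c) =
        (\<Sum>e<m. G i $$ (a, e) * ((if e = c then 1 else 0) + \<xi> e * D $$ (i, c)))"
        using ac by (simp add: scalar_prod_def G_def lessThan_atLeast0)
      also have "\<dots> = (\<Sum>e<m. (if e = c then G i $$ (a, e) else 0) + (G i $$ (a, e) * \<xi> e) * D $$ (i, c))"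
        by (intro sum.cong) (auto simp: distrib_left)
      also have "\<dots> = G i $$ (a, c) + (\<Sum>e<m. G i $$ (a, e) * \<xi> e) * D $$ (i, c)"
        using ac by (simp add: sum.distrib sum_distrib_right)
      also have "\<dots> = G (Suc i) $$ (a, c)"
        using ac by (subst G\<xi>) (auto simp: G_def)
      finally show "G (Suc i) $$ (a, c) = (G i * Matrix.mat m m (\<lambda>(a, c). (if a = c then 1 else 0) + \<xi> a * D $$ (i, c))) $$ (a, c)" ..
    qed (auto simp: G_def)
    have "Determinant.det (G (Suc i)) = Determinant.det (G i) *
        Determinant.det (Matrix.mat m m (\<lambda>(a, c). (if a = c then 1 else 0) + \<xi> a * D $$ (i, c)))"
      by (subst G_Suc, subst det_mult[of _ m]) (auto simp: G_def)
    then have det_Suc: "Determinant.det (G (Suc i)) = Determinant.det (G i) * (1 + (norm g)\<^sup>2)"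
      by (simp add: det_id_plus_rank_one norm_g)
    have "A (Suc i) ` S = (\<lambda>y. y + inner g y *\<^sub>R v i) ` (A i ` S)"
      unfolding image_image
    proof (rule image_cong[OF refl])
      fix u assume "u \<in> S"
      then have "inner g (A i u) = l i u" using gl[of "A i u"] S(2) i by (auto simp: P_def l_A)
      then show "A (Suc i) u = A i u + inner g (A i u) *\<^sub>R v i" by (simp add: A_def)
    qed
    also have "hausdorff_E p \<dots> = ennreal (sqrt (1 + (norm g)\<^sup>2)) * hausdorff_E p (A i ` S)"
    proof (rule P.hausdorff_E_rank_one[OF g(1)])
      show "norm (v i) = 1" using i by (simp add: norm_eq_sqrt_inner inner_v)
      show "compact (A i ` S)"
        using S(1) A_lin by (intro compact_continuous_image linear_continuous_on) (auto simp: linear_conv_bounded_linear)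
      show "A i ` S \<subseteq> P" using S(2) by (auto simp: P_def)
      fix y assume "y \<in> P"
      then obtain u where "u \<in> W" "y = A i u" by (auto simp: P_def)
      then show "inner y (v i) = 0"
        using i by (simp add: A_def inner_add_left inner_sum_left inner_W_v inner_v)
    qed
    also have "\<dots> = ennreal (sqrt (Determinant.det (G (Suc i)))) * hausdorff_E p S"
      using Suc.IH i by (simp add: det_Suc real_sqrt_mult ennreal_mult'' mult.assoc[symmetric] mult.commute)
    finally show ?case .
  qed
  from this[of k] have "hausdorff_E p (A k ` S) = ennreal (sqrt (Determinant.det (G k))) * hausdorff_E p S" by simp
  moreover have "A k = (\<lambda>u. u + lin D u)" by (simp add: A_def lin_def l_def fun_eq_iff)
  moreover have "sqrt (Determinant.det (G k)) = minor_jacobian D"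
    unfolding G_def minor_jacobian_def by (subst det_id_plus_Gram_eq_sum_minors[OF D]) simp
  ultimately show ?thesis by simp
qed

section \<open>Intrinsic linear graphs and tangent subgroups\<close>

definition Gr :: "real mat \<Rightarrow> 'n heis \<Rightarrow> 'n heis" where
  "Gr D u = u \<cdot> lin D u"

definition shear :: "real mat \<Rightarrow> 'n heis \<Rightarrow> 'n heis" where
  "shear D u = u + (omega u (lin D u) / 2) *\<^sub>R e_last"

lemma shear_inj: "shear D x = shear D y \<Longrightarrow> x = y"
proof -
  assume eq: "shear D x = shear D y"
  define t where "t = (omega y (lin D y) / 2) - (omega x (lin D x) / 2)"
  have x: "x = y + t *\<^sub>R e_last" using eq by (simp add: shear_def t_def algebra_simps)
  have "omega x (lin D x) = omega y (lin D y)"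
    by (simp add: x lin_add lin_scale lin_e_last)
  then have "t = 0" by (simp add: t_def)
  then show ?thesis using x by simp
qed

text \<open>\<open>lin D\<close> kills \<open>e_last\<close>, so the vertical term of the product
  can be moved into the argument: an intrinsic graph is an ordinary linear graph preceded by a
  vertical shear of W.\<close>

lemma Gr_eq_shear: "Gr D u = shear D u + lin D (shear D u)"
  by (simp add: Gr_def shear_def hmul_eq lin_add lin_scale lin_e_last algebra_simps)

lemma shear_W: "u \<in> W \<Longrightarrow> shear D u \<in> W"
  using subspace_W e_last_in_W by (simp add: shear_def subspace_add subspace_scale)

lemma continuous_on_shear: "continuous_on A (shear D)"
  unfolding shear_def omega_altdef by (intro continuous_intros) auto

text \<open>The vertical displacement does not depend on the vertical coordinate, so the stretch
  lemma applies along \<open>e_last\<close> with factor 1.\<close>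

lemma hausdorff_E_shear:
  assumes S: "compact S" "S \<subseteq> W"
  shows "hausdorff_E p (shear D ` S) = hausdorff_E p S"
proof -
  have TS: "compact (shear D ` S)"
    using S(1) by (intro compact_continuous_image continuous_on_shear)
  have sub: "shear D ` S \<subseteq> W" using S(2) shear_W by blast
  define q where "q u = omega u (lin D u) / 2" for u
  have q: "q \<in> borel_measurable borel"
    unfolding q_def omega_altdef by (intro borel_measurable_continuous_onI continuous_intros) auto
  have "ennreal 1 * (\<integral>\<^sup>+x. indicator (shear D ` S) (x + (q x + (1 - 1) * inner x e_last) *\<^sub>R e_last) \<partial>Ws.\<nu>) =
      (\<integral>\<^sup>+x. indicator (shear D ` S) x \<partial>Ws.\<nu>)"
    using TS q[unfolded q_def] by (intro Ws.nn_integral_shear_stretch e_last_in_W norm_e_last)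
      (auto simp: q_def lin_add lin_scale lin_e_last borel_compact intro: borel_measurable_indicator)
  also have "(\<lambda>x. indicator (shear D ` S) (x + (q x + (1 - 1) * inner x e_last) *\<^sub>R e_last) :: ennreal) = indicator S"
  proof (rule ext)
    fix x
    have "inj (shear D)" by (rule injI) (rule shear_inj)
    moreover have "x + (q x + (1 - 1) * inner x e_last) *\<^sub>R e_last = shear D x"
      by (simp add: q_def shear_def)
    ultimately show "indicator (shear D ` S) (x + (q x + (1 - 1) * inner x e_last) *\<^sub>R e_last) = (indicator S x :: ennreal)"
      by (simp add: indicator_def inj_image_mem_iff)
  qed
  finally show ?thesis
    using S TS sub by (simp add: Ws.emeasure_nu_subset borel_compact)
qed

lemma hausdorff_E_Gr:
  assumes D: "D \<in> carrier_mat k m" and S: "compact S" "S \<subseteq> W"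
  shows "hausdorff_E p (Gr D ` S) = ennreal (minor_jacobian D) * hausdorff_E p S"
proof -
  have "Gr D ` S = (\<lambda>u. u + lin D u) ` (shear D ` S)"
    by (simp add: image_image Gr_eq_shear)
  also have "hausdorff_E p \<dots> = ennreal (minor_jacobian D) * hausdorff_E p (shear D ` S)"
    using S shear_W by (intro hausdorff_E_linear_graph[OF D] compact_continuous_image continuous_on_shear) auto
  finally show ?thesis by (simp add: hausdorff_E_shear[OF S])
qed

lemma continuous_on_Gr [continuous_intros]: "continuous_on A f \<Longrightarrow> continuous_on A (\<lambda>x. Gr D (f x))"
  unfolding Gr_def by (intro continuous_intros)

lemma PW_Gr: "u \<in> W \<Longrightarrow> PW (Gr D u) = u"
  unfolding Gr_def by (rule PW_hmul[OF _ lin_V])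

lemma dil_Gr: "dil t (Gr D u) = Gr D (dil t u)"
  by (simp add: Gr_def dil_hmul lin_dil')

definition tangent :: "real mat \<Rightarrow> 'n heis set" where
  "tangent D = Gr D ` W"

text \<open>The shear is a bijection of W, undone by subtracting the same vertical term. This form
  exhibits the tangent subgroup as a linear subspace, whose dimension enters
  \<open>spherical_factor\<close>.\<close>

lemma tangent_eq_linear: "tangent D = (\<lambda>u. u + lin D u) ` W"
proof -
  have "shear D ` W = W"
  proof (intro equalityI subsetI)
    fix u assume u: "u \<in> W"
    define u' where "u' = u + (- (omega u (lin D u) / 2)) *\<^sub>R e_last"
    have "u' \<in> W" unfolding u'_def using u subspace_W e_last_in_W by (intro subspace_add subspace_scale)
    moreover have "shear D u' = u"
      by (simp add: shear_def u'_def lin_add lin_diff lin_minus lin_scale lin_e_last)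
    ultimately show "u \<in> shear D ` W" by blast
  qed (auto intro: shear_W)
  then have "(\<lambda>u. u + lin D u) ` W = (\<lambda>u. u + lin D u) ` (shear D ` W)" by simp
  then show ?thesis by (simp add: tangent_def image_image Gr_eq_shear)
qed

lemma dim_tangent: "dim (tangent D) = p"
proof -
  have lin: "linear (\<lambda>u. u + lin D u)"
    by (rule linearI) (simp_all add: lin_add lin_scale scaleR_add_right)
  have "inj_on (\<lambda>u. u + lin D u) W"
  proof (rule inj_onI)
    fix x y assume xy: "x \<in> W" "y \<in> W" "x + lin D x = y + lin D y"
    have "PV (x + lin D x) = lin D x" "PV (y + lin D y) = lin D y"
      using xy(1,2) by (simp_all only: PV_add PV_W PV_eq lin_V add_0)
    then have "lin D x = lin D y" using xy(3) by simp
    then show "x = y" using xy(3) by simp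
  qed
  then have "dim ((\<lambda>u. u + lin D u) ` W) = dim W"
    using subspace_W lin by (intro dim_image_eq) (auto simp: span_eq_iff[THEN iffD2])
  then show ?thesis by (simp add: tangent_eq_linear dim_W)
qed

text \<open>Intersections of the tangent subgroup with balls are measured through their parameter
  sets in W. The radius is variable because the blow-up replaces 1 by some s slightly above
  1.\<close>

definition slice :: "real mat \<Rightarrow> 'n heis \<Rightarrow> real \<Rightarrow> 'n heis set" where
  "slice D z s = {u\<in>W. Gr D u \<in> hcball d z s}"

lemma hcball_compact: "compact (hcball d x r)"
proof -
  have "hcball d x r \<subseteq> (\<lambda>z. x \<cdot> z) ` {z. N z \<le> r}"
  proof
    fix y assume "y \<in> hcball d x r"
    then show "y \<in> (\<lambda>z. x \<cdot> z) ` {z. N z \<le> r}"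
      by (intro image_eqI[of _ _ "hinv x \<cdot> y"]) (auto simp: hcball_def dist_eq_hnorm')
  qed
  moreover have "compact {z. N z \<le> r}"
    using bounded_hnorm_le by (auto simp: compact_eq_bounded_closed intro!: closed_Collect_le continuous_intros)
  then have "compact ((\<lambda>z. x \<cdot> z) ` {z. N z \<le> r})"
    by (intro compact_continuous_image continuous_intros)
  ultimately show ?thesis
    by (meson bounded_subset closed_hcball compact_eq_bounded_closed)
qed

lemma compact_slice: "compact (slice D z s)"
proof -
  have "slice D z s \<subseteq> PW ` hcball d z s"
  proof
    fix u assume "u \<in> slice D z s"
    then show "u \<in> PW ` hcball d z s"
      by (intro image_eqI[of _ _ "Gr D u"]) (simp_all add: slice_def PW_Gr)
  qed
  moreover have "compact (PW ` hcball d z s)"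
    by (intro compact_continuous_image hcball_compact continuous_intros)
  moreover have "closed (slice D z s)"
  proof -
    have "slice D z s = W \<inter> {u. d z (Gr D u) \<le> s}" by (auto simp: slice_def hcball_def)
    moreover have "closed {u. d z (Gr D u) \<le> s}" by (intro closed_Collect_le continuous_intros)
    ultimately show ?thesis by (simp only: closed_Int closed_W)
  qed
  ultimately show ?thesis
    by (meson bounded_subset compact_eq_bounded_closed)
qed

lemma slice_W: "slice D z s \<subseteq> W"
  by (auto simp: slice_def)

lemma slice_borel [measurable]: "slice D z s \<in> sets borel"
  by (intro borel_compact compact_slice)

lemma emeasure_slice_finite: "emeasure Ws.\<nu> (slice D z s) < \<infinity>"
  using Ws.emeasure_nu_bounded[OF slice_borel compact_imp_bounded[OF compact_slice]] by simp

lemma spherical_factor_tangent: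
  assumes D: "D \<in> carrier_mat k m"
  shows "spherical_factor d (tangent D) =
    (SUP z\<in>hcball d 0 1. ennreal (minor_jacobian D) * emeasure Ws.\<nu> (slice D z 1))"
  unfolding spherical_factor_def
proof (rule SUP_cong[OF refl])
  fix z :: "'n heis"
  have "tangent D \<inter> hcball d z 1 = Gr D ` slice D z 1"
    by (auto simp: tangent_def slice_def)
  then show "hausdorff_E (dim (tangent D)) (tangent D \<inter> hcball d z 1) =
      ennreal (minor_jacobian D) * emeasure Ws.\<nu> (slice D z 1)"
    by (simp add: dim_tangent hausdorff_E_Gr[OF D compact_slice slice_W]
        Ws.emeasure_nu_subset slice_W)
qed

section \<open>Change of variables by translations and dilations\<close>

lemma sigma_tr_eq: "sigma_tr W V x u = x \<cdot> u \<cdot> hinv (PV x)"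
  by (simp add: sigma_tr_def proj_V_eq)

lemma sigma_tr_W: "u \<in> W \<Longrightarrow> sigma_tr W V x u \<in> W"
  unfolding sigma_tr_eq by (rule conj_W)

lemma continuous_on_sigma_tr [continuous_intros]:
  "continuous_on A f \<Longrightarrow> continuous_on A (\<lambda>y. sigma_tr W V x (f y))"
  unfolding sigma_tr_eq by (intro continuous_intros)

text \<open>In W the translation acts as a vertical shear followed by addition of
  \<open>PW x\<close>. The dilation is a stretch by r along \<open>e_last\<close> followed by
  scaling by r, of Jacobian \<open>r ^ p\<close>; hence the exponent p + 1.\<close>

lemma nn_integral_sigma_tr_dil:
  assumes "r > 0" and f [measurable]: "f \<in> borel_measurable borel"
  shows "ennreal (r ^ Suc p) * (\<integral>\<^sup>+u. f (sigma_tr W V x (dil r u)) \<partial>Ws.\<nu>) = (\<integral>\<^sup>+u. f u \<partial>Ws.\<nu>)"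
proof -
  \<comment> \<open>Conjugation by \<open>PV x\<close> contributes all of
    \<open>omega (PV x) u\<close>, multiplication by \<open>PW x\<close> only half of
    \<open>omega (PW x) u\<close>.\<close>
  define q where "q u = omega (PV x + (1/2) *\<^sub>R PW x) u" for u
  have q [measurable]: "q \<in> borel_measurable borel"
    unfolding q_def omega_altdef by (intro borel_measurable_continuous_onI continuous_intros) auto
  have eq: "sigma_tr W V x (dil r u) = r *\<^sub>R (u + (q u + (r - 1) * inner u e_last) *\<^sub>R e_last) + PW x" for u
  proof -
    have "sigma_tr W V x (dil r u) = PW x \<cdot> (PV x \<cdot> dil r u \<cdot> hinv (PV x))"
      unfolding sigma_tr_eq by (subst (1) PW_PV[symmetric, of x]) (simp only: hmul_assoc)
    also have "PV x \<cdot> dil r u \<cdot> hinv (PV x) = dil r u + omega (PV x) (dil r u) *\<^sub>R e_last"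
      by (simp add: hmul_eq hinv_def omega_commute[of "dil r u" "PV x"] flip: scaleR_add_left)
    also have "PW x \<cdot> \<dots> = PW x + dil r u + (omega (PV x + (1/2) *\<^sub>R PW x) (dil r u)) *\<^sub>R e_last"
      by (simp add: hmul_eq algebra_simps)
    also have "omega (PV x + (1/2) *\<^sub>R PW x) (dil r u) = r * q u"
      by (simp add: dil_eq q_def algebra_simps)
    finally have 1: "sigma_tr W V x (dil r u) = PW x + dil r u + (r * q u) *\<^sub>R e_last" .
    have 2: "dil r u = r *\<^sub>R u + ((r\<^sup>2 - r) * inner u e_last) *\<^sub>R e_last"
      by (simp add: dil_eq snd_snd_eq)
    show ?thesis by (subst 1, subst 2) (simp add: algebra_simps power2_eq_square)
  qed
  have "ennreal (r ^ Suc p) * (\<integral>\<^sup>+u. f (sigma_tr W V x (dil r u)) \<partial>Ws.\<nu>) =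
     ennreal (r ^ p) * (ennreal r * (\<integral>\<^sup>+u. f (r *\<^sub>R (u + (q u + (r - 1) * inner u e_last) *\<^sub>R e_last) + PW x) \<partial>Ws.\<nu>))"
    using \<open>r > 0\<close> by (simp add: eq ennreal_mult' mult.assoc[symmetric] mult.commute)
  also have "ennreal r * (\<integral>\<^sup>+u. f (r *\<^sub>R (u + (q u + (r - 1) * inner u e_last) *\<^sub>R e_last) + PW x) \<partial>Ws.\<nu>) =
      (\<integral>\<^sup>+u. f (r *\<^sub>R u + PW x) \<partial>Ws.\<nu>)"
    using \<open>r > 0\<close> by (intro Ws.nn_integral_shear_stretch e_last_in_W norm_e_last q) (auto simp: q_def)
  also have "ennreal (r ^ p) * (\<integral>\<^sup>+u. f (r *\<^sub>R u + PW x) \<partial>Ws.\<nu>) = (\<integral>\<^sup>+u. f (u + PW x) \<partial>Ws.\<nu>)"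
    using \<open>r > 0\<close> by (intro Ws.nn_integral_nu_scale) auto
  also have "\<dots> = (\<integral>\<^sup>+u. f u \<partial>Ws.\<nu>)"
    by (intro Ws.nn_integral_nu_translate PW_W) auto
  finally show ?thesis .
qed

lemma slice_dil: "r > 0 \<Longrightarrow> dil r u \<in> slice D (dil r z) (r * s) \<longleftrightarrow> u \<in> slice D z s"
proof -
  assume r: "r > 0"
  have "dil r u \<in> W \<longleftrightarrow> u \<in> W" using r by (simp add: W_iff PV_dil)
  then show ?thesis using r by (simp add: slice_def dil_Gr[symmetric] hcball_dil)
qed

lemma emeasure_slice_dil:
  assumes "r > 0"
  shows "emeasure Ws.\<nu> (slice D (dil r z) (r * s)) = ennreal (r ^ Suc p) * emeasure Ws.\<nu> (slice D z s)"
proof -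
  have "sigma_tr W V 0 y = y" for y by (simp add: sigma_tr_eq PV_def)
  then have "(\<lambda>u. indicator (slice D (dil r z) (r * s)) (sigma_tr W V 0 (dil r u)) :: ennreal) = indicator (slice D z s)"
    using slice_dil[OF assms] by (auto simp: indicator_def fun_eq_iff)
  then show ?thesis
    using nn_integral_sigma_tr_dil[OF assms, of "indicator (slice D (dil r z) (r * s))" 0]
    by simp
qed

end

section \<open>Blow-up of intrinsic graphs\<close>

lemma exists_factor_gt_1:
  fixes b t :: real
  assumes "b < t" "0 \<le> b"
  obtains s where "s > 1" "s ^ n * b < t"
proof -
  have "((\<lambda>s. s ^ n * b) \<longlongrightarrow> 1 ^ n * b) (at_right 1)"
    by (intro tendsto_intros)
  then have "\<forall>\<^sub>F s in at_right 1. s ^ n * b < t"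
    using assms by (intro order_tendstoD) auto
  then have "\<forall>\<^sub>F s in at_right 1. s ^ n * b < t \<and> s > (1::real)"
    using eventually_at_right_less[of "1::real"] by eventually_elim auto
  then show thesis
    using eventually_happens'[OF trivial_limit_at_right_real] that by blast
qed

lemma eventually_within_open:
  "open T \<Longrightarrow> x \<in> T \<Longrightarrow> \<forall>\<^sub>F y in at x within S. y \<in> T \<and> y \<in> S \<and> y \<noteq> x"
  unfolding eventually_at_topological by blast

locale intrinsic_graph = adapted_splitting d k W V v w m p
  for d :: "'n::finite heis \<Rightarrow> 'n heis \<Rightarrow> real" and k W V v w m p +
  fixes U :: "'n heis set" and \<phi> :: "'n heis \<Rightarrow> 'n heis"
  assumes U_sub: "U \<subseteq> W" and U_open: "openin (top_of_set W) U"
    and phi_V: "\<phi> ` U \<subseteq> V"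
    and uid: "uniformly_intrinsic_differentiable d W V U \<phi>"
begin

section \<open>The graph seen from one of its points\<close>

abbreviation "\<Phi> \<equiv> graph_map \<phi>"

text \<open>Left translation by \<open>\<Phi> q\<close>, read in W: it sends 0 to q and the domain
  of the translated map to U, so u is the position of a parameter seen from q.\<close>

definition sig :: "'n heis \<Rightarrow> 'n heis \<Rightarrow> 'n heis" where
  "sig q u = sigma_tr W V (\<Phi> q) u"

text \<open>The map \<open>\<psi> q\<close> is the translate of \<open>\<phi>\<close> that moves \<open>\<Phi> q\<close> to the identity.\<close>

definition \<psi> :: "'n heis \<Rightarrow> 'n heis \<Rightarrow> 'n heis" where
  "\<psi> q u = \<phi> (sig q u) - \<phi> q"

lemma phi_in_V: "q \<in> U \<Longrightarrow> \<phi> q \<in> V"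
  using phi_V by blast

lemma in_W: "q \<in> U \<Longrightarrow> q \<in> W"
  using U_sub by blast

lemma PV_Phi: "q \<in> U \<Longrightarrow> PV (\<Phi> q) = \<phi> q" and PW_Phi: "q \<in> U \<Longrightarrow> PW (\<Phi> q) = q"
  by (simp_all add: graph_map_def PV_hmul' PW_hmul in_W phi_in_V)

lemma sig_eq: "q \<in> U \<Longrightarrow> sig q u = \<Phi> q \<cdot> u \<cdot> hinv (\<phi> q)"
  by (simp add: sig_def sigma_tr_eq PV_Phi)

lemma sig_0: "q \<in> U \<Longrightarrow> sig q 0 = q"
  by (simp add: sig_eq graph_map_def hmul_assoc)

lemma sig_W: "u \<in> W \<Longrightarrow> sig q u \<in> W"
  unfolding sig_def by (rule sigma_tr_W)

lemma continuous_on_sig [continuous_intros]: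
  "continuous_on A f \<Longrightarrow> continuous_on A (\<lambda>y. sig q (f y))"
  unfolding sig_def by (intro continuous_intros)

lemma psi_0: "q \<in> U \<Longrightarrow> \<psi> q 0 = 0"
  by (simp add: \<psi>_def sig_0)

lemma psi_V: "q \<in> U \<Longrightarrow> sig q u \<in> U \<Longrightarrow> \<psi> q u \<in> V"
  unfolding \<psi>_def by (intro subspace_diff[OF subspace_V] phi_in_V)

text \<open>V is isotropic, so its product is addition and \<open>\<psi> q u\<close> is the group
  quotient of the two values of \<phi>. Near \<open>\<Phi> q\<close> the surface is thus the left
  translate of the graph of \<open>\<psi> q\<close>.\<close>

lemma Phi_sig:
  assumes "q \<in> U" "sig q u \<in> U"
  shows "\<Phi> (sig q u) = \<Phi> q \<cdot> (u \<cdot> \<psi> q u)"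
proof -
  have "hinv (\<phi> q) \<cdot> \<phi> (sig q u) = \<psi> q u"
    using assms phi_in_V by (simp add: \<psi>_def hmul_V hinv_def subspace_neg[OF subspace_V])
  then show ?thesis
    unfolding graph_map_def[of \<phi> "sig q u"] by (subst sig_eq[OF assms(1)]) (simp add: hmul_assoc)
qed

lemma translated_eq:
  assumes "q \<in> U" "sig q u \<in> U"
  shows "translated W V \<phi> (hinv (\<Phi> q)) u = \<psi> q u"
  using assms phi_in_V
  by (simp add: translated_def proj_V_eq hinv_def PV_minus PV_Phi sig_def[symmetric] hmul_V
      subspace_neg[OF subspace_V] \<psi>_def)

lemma PV_hinv: "PV (hinv x) = hinv (PV x)"
  by (simp add: hinv_def PV_minus)

lemma sig_inverse: "sig q (sigma_tr W V (hinv (\<Phi> q)) y) = y" "sigma_tr W V (hinv (\<Phi> q)) (sig q y) = y"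
  by (simp_all add: sig_def sigma_tr_eq PV_hinv hmul_assoc)

lemma sigma_image_iff: "u \<in> sigma_tr W V (hinv (\<Phi> q)) ` U \<longleftrightarrow> sig q u \<in> U"
proof
  assume "u \<in> sigma_tr W V (hinv (\<Phi> q)) ` U"
  then show "sig q u \<in> U" by (auto simp: sig_inverse)
next
  assume "sig q u \<in> U"
  then show "u \<in> sigma_tr W V (hinv (\<Phi> q)) ` U"
    by (rule image_eqI[rotated]) (simp add: sig_inverse)
qed

lemma sig_dil_in_U:
  assumes "q \<in> U" "R > 0" "open T" "q \<in> T"
  obtains r0 where "r0 > 0" "\<And>r u. 0 < r \<Longrightarrow> r < r0 \<Longrightarrow> u \<in> W \<Longrightarrow> N u \<le> R \<Longrightarrow> sig q (dil r u) \<in> U \<inter> T"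
proof -
  obtain T' where T': "open T'" "U = W \<inter> T'"
    using U_open by (auto simp: openin_open)
  have "continuous_on UNIV (sig q)" by (intro continuous_intros)
  then have "open (sig q -` (T' \<inter> T))"
    using T'(1) assms(3) by (intro open_vimage) auto
  moreover have "0 \<in> sig q -` (T' \<inter> T)" using assms T' by (simp add: sig_0)
  ultimately obtain e where e: "e > 0" "hcball d 0 e \<subseteq> sig q -` (T' \<inter> T)"
    using open_contains_hcball by blast
  show thesis
  proof (rule that)
    show "e / R > 0" using e assms by simp
    fix r u assume ru: "0 < r" "r < e / R" "u \<in> W" "N u \<le> R"
    have "N (dil r u) \<le> r * R" using ru by (simp add: hnorm_dil)
    also have "\<dots> \<le> e" using ru assms(2) by (simp add: field_simps)
    finally have "dil r u \<in> hcball d 0 e"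
      by (simp add: hcball_def dist_commute[of 0] hnorm_def)
    then show "sig q (dil r u) \<in> U \<inter> T"
      using e(2) ru(3) T'(2) by (auto simp: sig_W dil_in_W)
  qed
qed

text \<open>Matrix and base point are independent: D may be the differential at a point other than
  q, which is what uniform differentiability provides.\<close>

definition near :: "real mat \<Rightarrow> 'n heis \<Rightarrow> real \<Rightarrow> real \<Rightarrow> bool" where
  "near D q \<epsilon> \<delta> \<longleftrightarrow> (\<forall>u\<in>W. sig q u \<in> U \<and> N u < \<delta> \<longrightarrow> d (lin D u) (\<psi> q u) \<le> \<epsilon> * N u)"

text \<open>Both matrices approximate the same \<open>\<psi> q\<close>, and both maps are
  homogeneous: u is dilated by r into the range of the two estimates, and r cancels at the end. The
  bound therefore does not involve the ranges.\<close>

lemma near_compare: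
  assumes q: "q \<in> U" and near: "near D q \<epsilon> \<delta>" "near D' q \<epsilon>' \<delta>'" and pos: "\<delta> > 0" "\<delta>' > 0"
    and u: "u \<in> W"
  shows "d (lin D u) (lin D' u) \<le> (\<epsilon> + \<epsilon>') * N u"
proof -
  define R where "R = N u + 1"
  have R: "R > 0" "N u \<le> R" using hnorm_nonneg[of u] by (auto simp: R_def)
  obtain r0 where r0: "r0 > 0" "\<And>r u. 0 < r \<Longrightarrow> r < r0 \<Longrightarrow> u \<in> W \<Longrightarrow> N u \<le> R \<Longrightarrow> sig q (dil r u) \<in> U \<inter> UNIV"
    using sig_dil_in_U[OF q R(1) open_UNIV] by auto
  define r where "r = min (r0 / 2) (min (\<delta> / (2 * R)) (\<delta>' / (2 * R)))"
  have r: "r > 0" "r < r0" using r0 R pos by (auto simp: r_def)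
  have "r \<le> \<delta> / (2 * R)" "r \<le> \<delta>' / (2 * R)" by (simp_all add: r_def)
  then have "r * R \<le> \<delta> / 2" "r * R \<le> \<delta>' / 2" using R(1) by (simp_all add: field_simps)
  moreover have "N (dil r u) \<le> r * R" using r R by (simp add: hnorm_dil)
  ultimately have "N (dil r u) < \<delta>" "N (dil r u) < \<delta>'" using pos by linarith+
  moreover have "sig q (dil r u) \<in> U" using r0(2)[OF r u R(2)] by simp
  ultimately have "d (lin D (dil r u)) (\<psi> q (dil r u)) \<le> \<epsilon> * N (dil r u)"
    "d (lin D' (dil r u)) (\<psi> q (dil r u)) \<le> \<epsilon>' * N (dil r u)"
    using near dil_in_W[OF u] by (auto simp: near_def)
  then have "d (lin D (dil r u)) (lin D' (dil r u)) \<le> (\<epsilon> + \<epsilon>') * N (dil r u)"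
    using dist_triangle[of "lin D (dil r u)" "lin D' (dil r u)" "\<psi> q (dil r u)"]
      dist_commute[of "\<psi> q (dil r u)" "lin D' (dil r u)"]
    by (simp add: distrib_right)
  then have "r * d (lin D u) (lin D' u) \<le> r * ((\<epsilon> + \<epsilon>') * N u)"
    using r(1) by (simp add: lin_dil' dist_dil hnorm_dil mult_ac)
  then show ?thesis using r(1) by simp
qed

text \<open>The epsilon-delta form of the vanishing suprema in
  \<open>uniformly_intrinsic_differentiable\<close>; one \<delta> bounds both the distance of base
  points and the size of u.\<close>

definition uid_at :: "'n heis \<Rightarrow> real mat \<Rightarrow> bool" where
  "uid_at q0 D \<longleftrightarrow> (\<forall>\<epsilon>>0. \<exists>\<delta>>0. \<forall>q\<in>U. N (hinv q0 \<cdot> q) < \<delta> \<longrightarrow> near D q \<epsilon> \<delta>)"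

lemma uid_atD: "uid_at q D \<Longrightarrow> q \<in> U \<Longrightarrow> \<epsilon> > 0 \<Longrightarrow> \<exists>\<delta>>0. near D q \<epsilon> \<delta>"
  unfolding uid_at_def by (metis hinv_hmul hnorm_0)

lemma uid_at_exists:
  assumes q0: "q0 \<in> U"
  shows "\<exists>D. uid_at q0 D"
proof -
  define S where "S L \<delta> = (SUP q\<in>{q\<in>U. N (hinv q0 \<cdot> q) < \<delta>}.
              SUP u\<in>{u \<in> sigma_tr W V (hinv (\<Phi> q)) ` U. 0 < N u \<and> N u < \<delta>}.
                ennreal (d (L u) (translated W V \<phi> (hinv (\<Phi> q)) u) / N u))" for L \<delta>
  obtain L where L: "h_homomorphism W V L" "((\<lambda>\<delta>. S L \<delta>) \<longlongrightarrow> 0) (at_right 0)"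
    using uid q0 unfolding uniformly_intrinsic_differentiable_def S_def by blast
  define D where "D = h_matrix k v w L"
  have "uid_at q0 D"
    unfolding uid_at_def
  proof (intro allI impI)
    fix \<epsilon> :: real assume "\<epsilon> > 0"
    then have "\<forall>\<^sub>F \<delta> in at_right 0. S L \<delta> < ennreal \<epsilon>"
      by (intro order_tendstoD[OF L(2)]) simp
    then have "\<forall>\<^sub>F \<delta> in at_right 0. S L \<delta> < ennreal \<epsilon> \<and> \<delta> > 0"
      using eventually_at_right_less[of "0::real"] by eventually_elim auto
    then obtain \<delta> where \<delta>: "S L \<delta> < ennreal \<epsilon>" "\<delta> > 0"
      using eventually_happens'[OF trivial_limit_at_right_real] by blast
    show "\<exists>\<delta>>0. \<forall>q\<in>U. N (hinv q0 \<cdot> q) < \<delta> \<longrightarrow> near D q \<epsilon> \<delta>"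
    proof (intro exI[of _ \<delta>] conjI ballI impI \<delta>(2))
      fix q assume q: "q \<in> U" "N (hinv q0 \<cdot> q) < \<delta>"
      show "near D q \<epsilon> \<delta>"
        unfolding near_def
      proof (intro ballI impI)
        fix u assume u: "u \<in> W" "sig q u \<in> U \<and> N u < \<delta>"
        show "d (lin D u) (\<psi> q u) \<le> \<epsilon> * N u"
        proof (cases "u = 0")
          case False
          then have pos: "0 < N u" by (simp add: hnorm_pos_iff)
          have "u \<in> {u \<in> sigma_tr W V (hinv (\<Phi> q)) ` U. 0 < N u \<and> N u < \<delta>}"
            using u pos sigma_image_iff by simp
          moreover have "q \<in> {q\<in>U. N (hinv q0 \<cdot> q) < \<delta>}" using q by simp
          ultimately have "ennreal (d (L u) (translated W V \<phi> (hinv (\<Phi> q)) u) / N u) \<le> S L \<delta>"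
            unfolding S_def by (intro SUP_upper2[of q] SUP_upper) 
          also note \<delta>(1)
          finally have "d (L u) (translated W V \<phi> (hinv (\<Phi> q)) u) / N u < \<epsilon>"
            by (simp add: ennreal_less_iff dist_nonneg hnorm_nonneg)
          then have "d (L u) (translated W V \<phi> (hinv (\<Phi> q)) u) \<le> \<epsilon> * N u"
            using pos by (simp add: field_simps)
          then show ?thesis
            using u q by (simp add: translated_eq h_homomorphism_eq_lin[OF L(1)] D_def)
        qed (simp add: q psi_0 lin_0)
      qed
    qed
  qed
  then show ?thesis ..
qed

section \<open>Continuity of the differential and of the Jacobian\<close>

lemma lin_entry:
  assumes "i < k" "j < m"
  shows "inner (lin D (b j)) (v i) = D $$ (i, j)"
proof -
  have *: "(\<Sum>j'<m. D $$ (i', j') * inner (b j) (b j')) = D $$ (i', j)" for i'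
  proof -
    have "(\<Sum>j'<m. D $$ (i', j') * inner (b j) (b j')) = (\<Sum>j'<m. if j = j' then D $$ (i', j') else 0)"
      using assms by (intro sum.cong) (auto simp: inner_b)
    then show ?thesis using assms by simp
  qed
  have "inner (lin D (b j)) (v i) = (\<Sum>i'<k. if i = i' then D $$ (i', j) else 0)"
    unfolding lin_def inner_sum_left * using assms by (intro sum.cong) (auto simp: inner_v)
  then show ?thesis using assms by simp
qed

text \<open>For q near q0, \<open>\<psi> q\<close> is approximated by \<open>DD q\<close>, on a
  scale depending on q, and by \<open>D0\<close>, by uniformity. Since \<open>near_compare\<close>
  is independent of the scales, the two matrices differ little on each basis vector.\<close>

lemma entry_tendsto:
  assumes q0: "q0 \<in> U" and uid0: "uid_at q0 D0"
    and near_DD: "\<And>q \<epsilon>. q \<in> U \<Longrightarrow> \<epsilon> > 0 \<Longrightarrow> \<exists>\<delta>>0. near (DD q) q \<epsilon> \<delta>"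
    and ij: "i < k" "j < m"
  shows "((\<lambda>q. DD q $$ (i, j)) \<longlongrightarrow> D0 $$ (i, j)) (at q0 within U)"
    and "DD q0 $$ (i, j) = D0 $$ (i, j)"
proof -
  have key: "\<exists>\<delta>>0. \<forall>q\<in>U. N (hinv q0 \<cdot> q) < \<delta> \<longrightarrow> \<bar>DD q $$ (i, j) - D0 $$ (i, j)\<bar> < e" if "e > 0" for e
  proof -
    obtain \<eta> where \<eta>: "\<eta> > 0" "\<And>x. N x < \<eta> \<Longrightarrow> norm x < e"
      using hnorm_small_imp_norm_small[OF \<open>e > 0\<close>] by blast
    define B where "B = N (b j) + 1"
    have Nb: "B > 0" using hnorm_nonneg[of "b j"] by (simp add: B_def)
    \<comment> \<open>Makes the error \<open>(\<epsilon> + \<epsilon>) * B\<close> equal to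
      \<open>\<eta> / 2\<close>.\<close>
    define \<epsilon> where "\<epsilon> = \<eta> / (4 * B)"
    then have "\<epsilon> > 0" using \<eta>(1) Nb by (simp add: \<epsilon>_def)
    obtain \<delta> where \<delta>: "\<delta> > 0" "\<And>q. q \<in> U \<Longrightarrow> N (hinv q0 \<cdot> q) < \<delta> \<Longrightarrow> near D0 q \<epsilon> \<delta>"
      using uid0 \<open>\<epsilon> > 0\<close> unfolding uid_at_def by blast
    have "\<bar>DD q $$ (i, j) - D0 $$ (i, j)\<bar> < e" if q: "q \<in> U" "N (hinv q0 \<cdot> q) < \<delta>" for q
    proof -
      obtain \<delta>' where \<delta>': "\<delta>' > 0" "near (DD q) q \<epsilon> \<delta>'" using near_DD[OF q(1) \<open>\<epsilon> > 0\<close>] by blast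
      have "d (lin (DD q) (b j)) (lin D0 (b j)) \<le> (\<epsilon> + \<epsilon>) * N (b j)"
        by (rule near_compare[OF q(1) \<delta>'(2) \<delta>(2)[OF q] \<delta>'(1) \<delta>(1) b_in_W[OF ij(2)]])
      also have "\<dots> \<le> (\<epsilon> + \<epsilon>) * B" using \<open>\<epsilon> > 0\<close> by (intro mult_left_mono) (auto simp: B_def)
      also have "\<dots> = \<eta> / 2" using Nb by (simp add: \<epsilon>_def field_simps)
      also have "\<dots> < \<eta>" using \<eta> by simp
      finally have "N (hinv (lin D0 (b j)) \<cdot> lin (DD q) (b j)) < \<eta>" by (simp add: dist_eq_hnorm)
      then have "N (lin (DD q) (b j) - lin D0 (b j)) < \<eta>"
        using lin_V by (simp add: hinv_def hmul_V subspace_neg[OF subspace_V])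
      then have "norm (lin (DD q) (b j) - lin D0 (b j)) < e" by (rule \<eta>(2))
      moreover have "\<bar>inner (lin (DD q) (b j) - lin D0 (b j)) (v i)\<bar> \<le> norm (lin (DD q) (b j) - lin D0 (b j)) * norm (v i)"
        by (rule Cauchy_Schwarz_ineq2)
      moreover have "norm (v i) = 1" using ij by (simp add: norm_eq_sqrt_inner inner_v)
      ultimately show ?thesis using ij by (simp add: inner_diff_left lin_entry)
    qed
    then show ?thesis using \<delta>(1) by blast
  qed
  show "((\<lambda>q. DD q $$ (i, j)) \<longlongrightarrow> D0 $$ (i, j)) (at q0 within U)"
  proof (rule tendstoI)
    fix e :: real assume "e > 0"
    then obtain \<delta> where \<delta>: "\<delta> > 0" "\<And>q. q \<in> U \<Longrightarrow> N (hinv q0 \<cdot> q) < \<delta> \<Longrightarrow> \<bar>DD q $$ (i, j) - D0 $$ (i, j)\<bar> < e"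
      using key by blast
    have "\<forall>\<^sub>F q in at q0 within U. q \<in> {q. d q0 q < \<delta>} \<and> q \<in> U \<and> q \<noteq> q0"
      using \<delta>(1) by (intro eventually_within_open open_hball) simp
    then show "\<forall>\<^sub>F q in at q0 within U. dist (DD q $$ (i, j)) (D0 $$ (i, j)) < e"
      by eventually_elim (auto simp: dist_real_def dist_eq_hnorm' intro: \<delta>(2))
  qed
  have "\<bar>DD q0 $$ (i, j) - D0 $$ (i, j)\<bar> < e" if "e > 0" for e
    using key[OF that] q0 by (metis hinv_hmul hnorm_0)
  then show "DD q0 $$ (i, j) = D0 $$ (i, j)"
    by (meson abs_ge_zero eq_iff_diff_eq_0 abs_eq_0 less_irrefl zero_less_abs_iff)
qed

lemma has_intrinsic_differential_lin:
  assumes q: "q \<in> U" and near: "\<And>\<epsilon>. \<epsilon> > 0 \<Longrightarrow> \<exists>\<delta>>0. near D q \<epsilon> \<delta>"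
  shows "has_intrinsic_differential d W V \<phi> q (lin D)"
  unfolding has_intrinsic_differential_def
proof (intro conjI h_homomorphism_lin tendstoI)
  fix e :: real assume "e > 0"
  then obtain \<delta> where \<delta>: "\<delta> > 0" "near D q (e / 2) \<delta>" using near[of "e / 2"] by auto
  obtain T where T: "open T" "U = W \<inter> T" using U_open by (auto simp: openin_open)
  have "continuous_on UNIV (sig q)" by (intro continuous_intros)
  then have op: "open ({u. d 0 u < \<delta>} \<inter> sig q -` T)"
    using T(1) open_hball by (intro open_Int open_vimage) auto
  have "0 \<in> {u. d 0 u < \<delta>} \<inter> sig q -` T" using \<delta>(1) q T by (simp add: sig_0)
  then have "\<forall>\<^sub>F u in at 0 within W. u \<in> {u. d 0 u < \<delta>} \<inter> sig q -` T \<and> u \<in> W \<and> u \<noteq> 0"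
    using op by (intro eventually_within_open)
  then show "\<forall>\<^sub>F u in at 0 within W. dist (d (lin D u) (translated W V \<phi> (hinv (\<Phi> q)) u) / N u) 0 < e"
  proof eventually_elim
    case (elim u)
    then have u: "sig q u \<in> U" "N u < \<delta>" "u \<in> W" "N u > 0"
      using T(2) hnorm_pos_iff[of u] by (auto simp: sig_W) (simp add: hnorm_def dist_commute)
    then have "d (lin D u) (\<psi> q u) \<le> e / 2 * N u" using \<delta>(2) by (auto simp: near_def)
    also have "e / 2 * N u < e * N u" using u(4) \<open>e > 0\<close> by simp
    finally have "d (lin D u) (\<psi> q u) / N u < e" using u(4) by (simp add: divide_less_eq)
    then show ?case
      using u q \<open>e > 0\<close> by (simp add: translated_eq dist_nonneg hnorm_nonneg)
  qed
qed

definition DD :: "'n heis \<Rightarrow> real mat" where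
  "DD q = h_matrix k v w (intrinsic_differential d W V \<phi> q)"

lemma DD_carrier: "DD q \<in> carrier_mat k m"
  by (simp add: DD_def h_matrix_def m)

lemma near_DD:
  assumes q: "q \<in> U" and "\<epsilon> > 0"
  shows "\<exists>\<delta>>0. near (DD q) q \<epsilon> \<delta>"
proof -
  obtain D where "uid_at q D" using uid_at_exists[OF q] by blast
  then have "has_intrinsic_differential d W V \<phi> q (lin D)"
    using q by (intro has_intrinsic_differential_lin uid_atD) auto
  then have L: "has_intrinsic_differential d W V \<phi> q (intrinsic_differential d W V \<phi> q)"
    unfolding intrinsic_differential_def by (rule someI[where P = "has_intrinsic_differential d W V \<phi> q"])
  define L where "L = intrinsic_differential d W V \<phi> q"
  have hom: "h_homomorphism W V L"
    and lim: "((\<lambda>u. d (L u) (translated W V \<phi> (hinv (\<Phi> q)) u) / N u) \<longlongrightarrow> 0) (at 0 within W)"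
    using L by (auto simp: has_intrinsic_differential_def L_def)
  have "\<forall>\<^sub>F u in at 0 within W. dist (d (L u) (translated W V \<phi> (hinv (\<Phi> q)) u) / N u) 0 < \<epsilon>"
    using lim \<open>\<epsilon> > 0\<close> by (rule tendstoD)
  then obtain e where e: "e > 0" "\<And>u. u \<in> W \<Longrightarrow> u \<noteq> 0 \<Longrightarrow> dist u 0 < e \<Longrightarrow>
      dist (d (L u) (translated W V \<phi> (hinv (\<Phi> q)) u) / N u) 0 < \<epsilon>"
    unfolding eventually_at by blast
  obtain \<delta> where \<delta>: "\<delta> > 0" "\<And>u. N u < \<delta> \<Longrightarrow> norm u < e"
    using hnorm_small_imp_norm_small[OF e(1)] by blast
  have "near (DD q) q \<epsilon> \<delta>"
    unfolding near_def
  proof (intro ballI impI)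
    fix u assume u: "u \<in> W" "sig q u \<in> U \<and> N u < \<delta>"
    show "d (lin (DD q) u) (\<psi> q u) \<le> \<epsilon> * N u"
    proof (cases "u = 0")
      case False
      then have pos: "0 < N u" by (simp add: hnorm_pos_iff)
      have "d (L u) (translated W V \<phi> (hinv (\<Phi> q)) u) / N u < \<epsilon>"
        using e(2)[OF u(1) False] \<delta>(2) u by (simp add: dist_nonneg hnorm_nonneg)
      then show ?thesis
        using pos u q h_homomorphism_eq_lin[OF hom u(1)] by (simp add: translated_eq DD_def L_def field_simps)
    qed (simp add: q psi_0 lin_0)
  qed
  then show ?thesis using \<delta>(1) by blast
qed

text \<open>The chosen differential is known to approximate \<phi> only at q itself. Its entries
  agree with those of a matrix from \<open>uid_at_exists\<close>, which transfers the uniform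
  estimate to it.\<close>

lemma uid_at_DD:
  assumes q: "q \<in> U"
  shows "uid_at q (DD q)"
proof -
  obtain D where D: "uid_at q D" using uid_at_exists[OF q] by blast
  have "lin (DD q) = lin D"
    using entry_tendsto(2)[OF q D near_DD] by (simp add: lin_def fun_eq_iff)
  then show ?thesis using D unfolding uid_at_def near_def by simp
qed

definition J :: "'n heis \<Rightarrow> real" where
  "J q = minor_jacobian (DD q)"

lemma intrinsic_jacobian_eq: "intrinsic_jacobian d k W V v w \<phi> q = J q"
  unfolding intrinsic_jacobian_def J_def minor_jacobian_def DD_def Let_def m[symmetric] ..

lemma J_ge_1: "J q \<ge> 1"
  unfolding J_def by (rule minor_jacobian_ge_1)

text \<open>By the Gram determinant formula, J is the square root of a polynomial in the entries of
  the differential.\<close>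

lemma continuous_on_J: "continuous_on U J"
  unfolding continuous_on_def
proof
  fix q0 assume q0: "q0 \<in> U"
  have J_eq: "J q = sqrt (\<Sum>\<pi> | \<pi> permutes {0..<m}. of_int (sign \<pi>) *
      (\<Prod>a=0..<m. (if a = \<pi> a then 1 else 0) + (\<Sum>i<k. DD q $$ (i, a) * DD q $$ (i, \<pi> a))))" for q
  proof -
    have "J q = sqrt (Determinant.det (Matrix.mat m m (\<lambda>(a, b). (if a = b then 1 else 0) +
        (\<Sum>i<k. DD q $$ (i, a) * DD q $$ (i, b)))))"
      unfolding J_def minor_jacobian_def by (subst det_id_plus_Gram_eq_sum_minors[OF DD_carrier]) simp
    also have "\<dots> = sqrt (\<Sum>\<pi> | \<pi> permutes {0..<m}. of_int (sign \<pi>) *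
      (\<Prod>a=0..<m. (if a = \<pi> a then 1 else 0) + (\<Sum>i<k. DD q $$ (i, a) * DD q $$ (i, \<pi> a))))"
    proof (subst det_def'[of _ m], simp, intro arg_cong[where f = sqrt] sum.cong refl arg_cong2[where f = "(*)"] prod.cong)
      fix \<pi> a assume "\<pi> \<in> {\<pi>. \<pi> permutes {0..<m}}" "a \<in> {0..<m}"
      then have "\<pi> a \<in> {0..<m}" using permutes_in_image by fastforce
      then show "Matrix.mat m m (\<lambda>(a, b). (if a = b then 1 else 0) + (\<Sum>i<k. DD q $$ (i, a) * DD q $$ (i, b))) $$ (a, \<pi> a) =
          (if a = \<pi> a then 1 else 0) + (\<Sum>i<k. DD q $$ (i, a) * DD q $$ (i, \<pi> a))"
        using \<open>a \<in> {0..<m}\<close> by simp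
    qed
    finally show ?thesis .
  qed
  have lim: "((\<lambda>q. DD q $$ (i, j)) \<longlongrightarrow> DD q0 $$ (i, j)) (at q0 within U)" if "i < k" "j < m" for i j
    by (rule entry_tendsto(1)[OF q0 uid_at_DD[OF q0] near_DD that])
  have perm: "\<pi> a < m" if "\<pi> permutes {0..<m}" "a < m" for \<pi> a
    using permutes_in_image[OF that(1), of a] that(2) by simp
  show "(J \<longlongrightarrow> J q0) (at q0 within U)"
    unfolding J_eq by (intro tendsto_intros lim) (auto intro: perm)
qed

text \<open>Differentiability at q0 with relative error 1 bounds \<open>\<phi> q - \<phi> q0\<close>
  by terms that vanish with the position of q seen from q0.\<close>

lemma continuous_on_phi: "continuous_on U \<phi>"
  unfolding continuous_on_def
proof
  fix q0 assume q0: "q0 \<in> U"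
  define D where "D = DD q0"
  obtain \<delta> where \<delta>: "\<delta> > 0" "near D q0 1 \<delta>" using near_DD[OF q0, of 1] by (auto simp: D_def)
  define inv_sig where "inv_sig q = sigma_tr W V (hinv (\<Phi> q0)) q" for q
  have sig_inv: "sig q0 (inv_sig q) = q" for q
    by (simp add: inv_sig_def sig_inverse)
  have "inv_sig q0 = 0"
    using sig_inverse(2)[of q0 0] q0 by (simp add: inv_sig_def sig_0)
  moreover have "continuous_on UNIV inv_sig" unfolding inv_sig_def by (intro continuous_intros)
  ultimately have lim: "(inv_sig \<longlongrightarrow> 0) (at q0 within U)"
    by (metis UNIV_I continuous_on_def tendsto_within_subset subset_UNIV)
  have linlim: "((\<lambda>q. lin D (inv_sig q)) \<longlongrightarrow> lin D 0) (at q0 within U)"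
    unfolding lin_def by (intro tendsto_intros lim)
  have ev: "\<forall>\<^sub>F q in at q0 within U. N (\<phi> q - \<phi> q0) \<le> N (lin D (inv_sig q)) + N (inv_sig q)"
  proof -
    have "\<forall>\<^sub>F q in at q0 within U. N (inv_sig q) < \<delta>"
      using order_tendstoD(2)[OF hnorm_tendsto_0[OF lim] \<delta>(1)] .
    moreover have "\<forall>\<^sub>F q in at q0 within U. q \<in> U" by (auto simp: eventually_at_filter)
    ultimately show ?thesis
    proof eventually_elim
      case (elim q)
      have "inv_sig q \<in> W" unfolding inv_sig_def by (intro sigma_tr_W in_W elim)
      then have "d (lin D (inv_sig q)) (\<psi> q0 (inv_sig q)) \<le> 1 * N (inv_sig q)"
        using \<delta>(2) elim by (simp add: near_def sig_inv)
      moreover have "N (\<psi> q0 (inv_sig q)) \<le> N (lin D (inv_sig q)) + d (lin D (inv_sig q)) (\<psi> q0 (inv_sig q))"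
        using abs_hnorm_diff_le[of "lin D (inv_sig q)" "\<psi> q0 (inv_sig q)"] by linarith
      ultimately show ?case by (simp add: \<psi>_def sig_inv)
    qed
  qed
  have "((\<lambda>q. N (\<phi> q - \<phi> q0)) \<longlongrightarrow> 0) (at q0 within U)"
  proof (rule tendsto_sandwich[OF _ ev tendsto_const])
    show "\<forall>\<^sub>F q in at q0 within U. 0 \<le> N (\<phi> q - \<phi> q0)" by (simp add: hnorm_nonneg)
    have "((\<lambda>q. N (lin D (inv_sig q)) + N (inv_sig q)) \<longlongrightarrow> 0 + 0) (at q0 within U)"
      using linlim by (intro tendsto_add hnorm_tendsto_0 lim) (simp add: lin_0)
    then show "((\<lambda>q. N (lin D (inv_sig q)) + N (inv_sig q)) \<longlongrightarrow> 0) (at q0 within U)" by simp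
  qed
  then have "((\<lambda>q. \<phi> q - \<phi> q0) \<longlongrightarrow> 0) (at q0 within U)"
  proof -
    assume *: "((\<lambda>q. N (\<phi> q - \<phi> q0)) \<longlongrightarrow> 0) (at q0 within U)"
    show ?thesis
    proof (rule tendstoI)
      fix e :: real assume "e > 0"
      then obtain \<eta> where \<eta>: "\<eta> > 0" "\<And>x. N x < \<eta> \<Longrightarrow> norm x < e"
        using hnorm_small_imp_norm_small by blast
      show "\<forall>\<^sub>F q in at q0 within U. dist (\<phi> q - \<phi> q0) 0 < e"
        using order_tendstoD(2)[OF * \<eta>(1)] by eventually_elim (simp only: dist_norm diff_zero \<eta>(2))
    qed
  qed
  then show "(\<phi> \<longlongrightarrow> \<phi> q0) (at q0 within U)" by (rule LIM_zero_cancel)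
qed

lemma continuous_on_Phi: "continuous_on U \<Phi>"
  unfolding graph_map_def by (intro continuous_intros continuous_on_phi)

lemma U_borel: "U \<in> sets borel"
proof -
  obtain T where "open T" "U = W \<inter> T" using U_open by (auto simp: openin_open)
  then show ?thesis using closed_W by simp
qed

section \<open>Rescaled graphs and the tangent cone\<close>

lemma PW_bound: obtains C where "C > 0" "\<And>g. N g \<le> 2 \<Longrightarrow> N (PW g) \<le> C"
proof -
  \<comment> \<open>The radius 2 serves unit balls whose centre has norm at most 1.\<close>
  have "continuous_on (hcball d 0 2) (\<lambda>g. N (PW g))"
    by (intro continuous_intros)
  then have "compact ((\<lambda>g. N (PW g)) ` hcball d 0 2)"
    by (intro compact_continuous_image hcball_compact)
  then obtain C where C: "\<forall>x\<in>(\<lambda>g. N (PW g)) ` hcball d 0 2. norm x \<le> C"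
    using compact_imp_bounded bounded_iff by metis
  show thesis
  proof (rule that[of "max C 1"])
    fix g assume "N g \<le> 2"
    then have "g \<in> hcball d 0 2" by (simp add: hcball_def hnorm_def dist_commute)
    then have "norm (N (PW g)) \<le> C" using C by blast
    then show "N (PW g) \<le> max C 1" by simp
  qed simp
qed

text \<open>Dividing the estimate by r leaves the error \<open>\<eta> / C * N u\<close>, at most
  \<eta> on the range \<open>N u \<le> C\<close>. Left invariance carries it from V-components to
  points of the rescaled graph.\<close>

lemma near_dil:
  assumes q: "q \<in> U" and near: "near D q (\<eta> / C) \<delta>" and C: "C > 0" "\<eta> > 0" and r: "r > 0" "r * C < \<delta>"
    and u: "u \<in> W" "N u \<le> C" "sig q (dil r u) \<in> U"
  shows "d (u \<cdot> ((1 / r) *\<^sub>R \<psi> q (dil r u))) (Gr D u) \<le> \<eta>"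
proof -
  have N: "N (dil r u) = r * N u" using r by (simp add: hnorm_dil)
  also have "\<dots> \<le> r * C" using u r by simp
  finally have "N (dil r u) < \<delta>" using r by simp
  then have le: "d (lin D (dil r u)) (\<psi> q (dil r u)) \<le> \<eta> / C * N (dil r u)"
    using near u dil_in_W[OF u(1)] by (auto simp: near_def)
  have "\<psi> q (dil r u) = dil r ((1 / r) *\<^sub>R \<psi> q (dil r u))"
    using r psi_V[OF q u(3)] by (simp add: dil_V subspace_scale[OF subspace_V])
  then have "d (lin D (dil r u)) (\<psi> q (dil r u)) = r * d (lin D u) ((1 / r) *\<^sub>R \<psi> q (dil r u))"
    using r by (metis lin_dil' dist_dil)
  then have "r * d (lin D u) ((1 / r) *\<^sub>R \<psi> q (dil r u)) \<le> r * (\<eta> / C * N u)"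
    using le N by (simp add: mult_ac)
  then have "d (lin D u) ((1 / r) *\<^sub>R \<psi> q (dil r u)) \<le> \<eta> / C * N u"
    by (simp only: mult_le_cancel_left_pos[OF r(1)])
  also have "\<dots> \<le> \<eta> / C * C" using u C by (intro mult_left_mono) auto
  also have "\<dots> = \<eta>" using C by simp
  finally show ?thesis
    by (simp add: Gr_def dist_left_invariant dist_commute)
qed

lemma Phi_sig_dil:
  assumes "q \<in> U" "sig q (dil r u) \<in> U" "r > 0"
  shows "\<Phi> (sig q (dil r u)) = \<Phi> q \<cdot> dil r (u \<cdot> ((1 / r) *\<^sub>R \<psi> q (dil r u)))"
  using assms psi_V[OF assms(1,2)]
  by (simp add: Phi_sig dil_hmul dil_V subspace_scale[OF subspace_V])

text \<open>A tangent point \<open>Gr D u\<close> is the limit of the rescaled surface points over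
  \<open>dil (s h) u\<close>. Conversely, if rescaled surface points converge, so do their
  W-components; these stay bounded, and the blow-up error on them tends to 0.\<close>

theorem Tan_eq_tangent:
  assumes q: "q \<in> U"
  shows "Tan (\<Phi> ` U) (\<Phi> q) = tangent (DD q)"
proof (intro equalityI subsetI)
  define D where "D = DD q"
  fix y assume "y \<in> tangent (DD q)"
  then obtain u where u: "u \<in> W" "y = Gr D u" by (auto simp: tangent_def D_def)
  define C where "C = N u + 1"
  have C: "C > 0" "N u \<le> C" using hnorm_nonneg[of u] by (auto simp: C_def)
  obtain r0 where r0: "r0 > 0" "\<And>r u. 0 < r \<Longrightarrow> r < r0 \<Longrightarrow> u \<in> W \<Longrightarrow> N u \<le> C \<Longrightarrow> sig q (dil r u) \<in> U \<inter> UNIV"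
    using sig_dil_in_U[OF q C(1) open_UNIV] by auto
  \<comment> \<open>The shift by 2 keeps every scale strictly below \<open>r0\<close>, also for h =
    0.\<close>
  define s where "s h = r0 / real (h + 2)" for h :: nat
  have s: "0 < s h" "s h < r0" for h
  proof -
    have "r0 / real (h + 2) < r0 / 1" using r0(1) by (intro divide_strict_left_mono) auto
    then show "0 < s h" "s h < r0" using r0(1) by (auto simp: s_def)
  qed
  have sU: "sig q (dil (s h) u) \<in> U" for h using r0(2)[OF s u(1) C(2)] by simp
  define X where "X h = \<Phi> (sig q (dil (s h) u))" for h
  have s_lim: "s \<longlonglongrightarrow> 0" unfolding s_def
    using LIMSEQ_ignore_initial_segment[OF lim_const_over_n[of r0], of 2] by simp
  have "dil (1 / s h) (hinv (\<Phi> q) \<cdot> X h) = u \<cdot> ((1 / s h) *\<^sub>R \<psi> q (dil (s h) u))" for h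
    using s(1)[of h] by (simp add: X_def Phi_sig_dil[OF q sU] dil_dil)
  moreover have "(\<lambda>h. u \<cdot> ((1 / s h) *\<^sub>R \<psi> q (dil (s h) u))) \<longlonglongrightarrow> Gr D u"
  proof (rule metric_LIMSEQ_I)
    fix e :: real assume "e > 0"
    then obtain \<eta> where \<eta>: "\<eta> > 0" "\<And>y. d (Gr D u) y < \<eta> \<Longrightarrow> dist (Gr D u) y < e"
      using hdist_small_imp_dist_small by blast
    obtain \<delta> where \<delta>: "\<delta> > 0" "near D q (\<eta> / 2 / C) \<delta>"
      using near_DD[OF q, of "\<eta> / 2 / C"] \<eta> C by (auto simp: D_def)
    have "\<forall>\<^sub>F h in sequentially. s h < \<delta> / C"
      using order_tendstoD(2)[OF s_lim] \<delta>(1) C by simp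
    then obtain h0 where h0: "\<And>h. h \<ge> h0 \<Longrightarrow> s h < \<delta> / C" by (auto simp: eventually_sequentially)
    show "\<exists>h0. \<forall>h\<ge>h0. dist (u \<cdot> ((1 / s h) *\<^sub>R \<psi> q (dil (s h) u))) (Gr D u) < e"
    proof (intro exI[of _ h0] allI impI)
      fix h assume "h \<ge> h0"
      then have "s h * C < \<delta>" using h0[of h] C by (simp add: field_simps)
      then have "d (u \<cdot> ((1 / s h) *\<^sub>R \<psi> q (dil (s h) u))) (Gr D u) \<le> \<eta> / 2"
        using \<eta>(1) by (intro near_dil[OF q \<delta>(2) C(1) _ s(1) _ u(1) C(2) sU]) auto
      then show "dist (u \<cdot> ((1 / s h) *\<^sub>R \<psi> q (dil (s h) u))) (Gr D u) < e"
        using \<eta> by (metis Real_Vector_Spaces.dist_commute dist_commute field_sum_of_halves less_add_same_cancel1 half_gt_zero order.strict_trans1)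
    qed
  qed
  ultimately have lim2: "(\<lambda>h. dil (1 / s h) (hinv (\<Phi> q) \<cdot> X h)) \<longlonglongrightarrow> y" using u(2) by simp
  have "continuous_on UNIV (\<lambda>t. sig q (dil t u))" by (intro continuous_intros)
  then have "isCont (\<lambda>t. sig q (dil t u)) 0" by (simp add: continuous_on_eq_continuous_at)
  then have "(\<lambda>h. sig q (dil (s h) u)) \<longlonglongrightarrow> sig q (dil 0 u)"
    using s_lim by (rule isCont_tendsto_compose)
  then have "X \<longlonglongrightarrow> \<Phi> q"
    unfolding X_def using sU q
    by (intro continuous_on_tendsto_compose[OF continuous_on_Phi]) (auto simp: sig_0)
  then show "y \<in> Tan (\<Phi> ` U) (\<Phi> q)"
    unfolding Tan_def using lim2 s(1) sU
    by (intro CollectI exI[of _ "\<lambda>h. 1 / s h"] exI[of _ X] conjI allI) (auto simp: X_def)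
next
  define D where "D = DD q"
  fix y assume "y \<in> Tan (\<Phi> ` U) (\<Phi> q)"
  then obtain r X where rX: "\<And>h::nat. r h > 0" "\<And>h. X h \<in> \<Phi> ` U" "X \<longlonglongrightarrow> \<Phi> q"
      "(\<lambda>h. dil (r h) (hinv (\<Phi> q) \<cdot> X h)) \<longlonglongrightarrow> y"
    unfolding Tan_def by blast
  define g where "g h = hinv (\<Phi> q) \<cdot> X h" for h
  define a where "a h = PW (g h)" for h
  have cont: "continuous_on UNIV (\<lambda>x. PW (hinv (\<Phi> q) \<cdot> x))" by (intro continuous_intros)
  then have "isCont (\<lambda>x. PW (hinv (\<Phi> q) \<cdot> x)) (\<Phi> q)" by (simp add: continuous_on_eq_continuous_at)
  then have "a \<longlonglongrightarrow> PW (hinv (\<Phi> q) \<cdot> \<Phi> q)"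
    unfolding a_def g_def using rX(3) by (rule isCont_tendsto_compose)
  then have a_lim: "a \<longlonglongrightarrow> 0" by (simp add: PW_def PV_def)
  have a: "a h \<in> W" "sig q (a h) \<in> U" "g h = a h \<cdot> \<psi> q (a h)" for h
  proof -
    obtain q' where q': "q' \<in> U" "X h = \<Phi> q'" using rX(2)[of h] by blast
    define u where "u = sigma_tr W V (hinv (\<Phi> q)) q'"
    have u: "u \<in> W" unfolding u_def by (intro sigma_tr_W in_W q')
    have su: "sig q u = q'"
      by (simp add: u_def sig_inverse)
    have g: "g h = u \<cdot> \<psi> q u"
      using Phi_sig[OF q, of u] q' by (simp add: g_def su)
    have "a h = u"
      unfolding a_def g by (intro PW_hmul u psi_V q) (simp add: su q')
    then show "a h \<in> W" "sig q (a h) \<in> U" "g h = a h \<cdot> \<psi> q (a h)" using u su q' g by auto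
  qed
  have "PW (dil t x) = dil t (PW x)" for t x
    by (simp add: PW_def dil_hmul PV_dil dil_hinv dil_V[OF PV_V])
  moreover have "isCont PW y" 
    using continuous_on_PW[OF continuous_on_id, of UNIV] by (simp add: continuous_on_eq_continuous_at)
  then have "(\<lambda>h. PW (dil (r h) (g h))) \<longlonglongrightarrow> PW y"
    using rX(4)[folded g_def] by (rule isCont_tendsto_compose)
  ultimately have u_lim: "(\<lambda>h. dil (r h) (a h)) \<longlonglongrightarrow> PW y" by (simp add: a_def)
  have "isCont (\<lambda>u. N u) (PW y)" "isCont (Gr D) (PW y)"
    using continuous_on_hnorm_UNIV continuous_on_Gr[OF continuous_on_id, of UNIV D]
    by (simp_all add: continuous_on_eq_continuous_at)
  then have N_lim: "(\<lambda>h. N (dil (r h) (a h))) \<longlonglongrightarrow> N (PW y)" and Gr_lim: "(\<lambda>h. Gr D (dil (r h) (a h))) \<longlonglongrightarrow> Gr D (PW y)"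
    using u_lim by (auto intro: isCont_tendsto_compose)
  have dist_lim: "(\<lambda>h. d (Gr D (dil (r h) (a h))) (dil (r h) (g h))) \<longlonglongrightarrow> 0"
  proof (rule tendstoI)
    fix e :: real assume "e > 0"
    \<comment> \<open>The rescaled parameters converge to \<open>PW y\<close>, so their norms are
      eventually below M and the relative error \<open>e / 2 / M\<close> suffices.\<close>
    define M where "M = N (PW y) + 1"
    have "M > 0" using hnorm_nonneg[of "PW y"] by (simp add: M_def)
    obtain \<delta> where \<delta>: "\<delta> > 0" "near D q (e / 2 / M) \<delta>"
      using near_DD[OF q, of "e / 2 / M"] \<open>e > 0\<close> \<open>M > 0\<close> by (auto simp: D_def)
    have "\<forall>\<^sub>F h in sequentially. N (a h) < \<delta>" by (rule order_tendstoD(2)[OF hnorm_tendsto_0[OF a_lim] \<delta>(1)])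
    moreover have "\<forall>\<^sub>F h in sequentially. N (dil (r h) (a h)) < M"
      by (rule order_tendstoD(2)[OF N_lim]) (simp add: M_def)
    ultimately show "\<forall>\<^sub>F h in sequentially. dist (d (Gr D (dil (r h) (a h))) (dil (r h) (g h))) 0 < e"
    proof eventually_elim
      case (elim h)
      have "d (lin D (a h)) (\<psi> q (a h)) \<le> e / 2 / M * N (a h)"
        using \<delta>(2) a elim by (simp add: near_def)
      then have "r h * d (lin D (a h)) (\<psi> q (a h)) \<le> r h * (e / 2 / M * N (a h))"
        using rX(1)[of h] by (intro mult_left_mono) auto
      also have "\<dots> = e / 2 / M * N (dil (r h) (a h))"
        using rX(1)[of h] by (simp add: hnorm_dil mult_ac)
      also have "\<dots> \<le> e / 2 / M * M" using elim \<open>e > 0\<close> \<open>M > 0\<close> by (intro mult_left_mono) auto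
      also have "\<dots> < e" using \<open>M > 0\<close> \<open>e > 0\<close> by simp
      finally have "r h * d (lin D (a h)) (\<psi> q (a h)) < e" .
      moreover have "d (Gr D (dil (r h) (a h))) (dil (r h) (g h)) = r h * d (lin D (a h)) (\<psi> q (a h))"
        using rX(1)[of h] by (simp add: dil_Gr[symmetric] dist_dil a(3)) (simp add: Gr_def dist_left_invariant)
      ultimately have "d (Gr D (dil (r h) (a h))) (dil (r h) (g h)) < e" by simp
      then show ?case by (simp only: dist_real_def diff_zero abs_of_nonneg[OF dist_nonneg])
    qed
  qed
  have "continuous_on UNIV (\<lambda>x. d (fst x) (snd x))" by (intro continuous_intros)
  then have "isCont (\<lambda>x. d (fst x) (snd x)) (Gr D (PW y), y)" by (simp add: continuous_on_eq_continuous_at)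
  then have "(\<lambda>h. d (fst (Gr D (dil (r h) (a h)), dil (r h) (g h))) (snd (Gr D (dil (r h) (a h)), dil (r h) (g h))))
      \<longlonglongrightarrow> d (fst (Gr D (PW y), y)) (snd (Gr D (PW y), y))"
    using tendsto_Pair[OF Gr_lim rX(4)[folded g_def]] by (rule isCont_tendsto_compose)
  then have "d (Gr D (PW y)) y = 0"
    using dist_lim LIMSEQ_unique by fastforce
  then have "y = Gr D (PW y)" by (simp add: dist_eq_0_iff)
  then show "y \<in> tangent (DD q)"
    using PW_W[of y] unfolding tangent_def D_def by blast
qed

end

section \<open>The area formula\<close>

context intrinsic_graph
begin

text \<open>The graph map is controlled only on U. Extension by 0 makes it Borel on the whole space,
  and the indicator in \<open>J'\<close> gives the added points no mass.\<close>

definition \<Phi>' :: "'n heis \<Rightarrow> 'n heis" where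
  "\<Phi>' q = (if q \<in> U then \<Phi> q else 0)"

definition J' :: "'n heis \<Rightarrow> ennreal" where
  "J' q = ennreal (J q) * indicator U q"

definition \<mu> :: "'n heis measure" where
  "\<mu> = distr (density Ws.\<nu> J') borel \<Phi>'"

lemma measurable_Phi' [measurable]: "\<Phi>' \<in> borel_measurable borel"
  unfolding \<Phi>'_def[abs_def]
  using borel_measurable_continuous_on_if[OF U_borel continuous_on_Phi continuous_on_const, of 0] by simp

lemma measurable_J' [measurable]: "J' \<in> borel_measurable borel"
proof -
  have "(\<lambda>q. indicator U q *\<^sub>R J q) \<in> borel_measurable borel"
    by (rule borel_measurable_continuous_on_indicator[OF U_borel continuous_on_J])
  then have "(\<lambda>q. ennreal (indicator U q *\<^sub>R J q)) \<in> borel_measurable borel"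
    by measurable
  also have "(\<lambda>q. ennreal (indicator U q *\<^sub>R J q)) = J'"
    by (auto simp: J'_def indicator_def fun_eq_iff)
  finally show ?thesis .
qed

lemma sets_mu [simp, measurable_cong]: "sets \<mu> = sets borel"
  by (simp add: \<mu>_def)

lemma emeasure_mu:
  assumes [measurable]: "X \<in> sets borel"
  shows "emeasure \<mu> X = (\<integral>\<^sup>+q. J' q * indicator X (\<Phi>' q) \<partial>Ws.\<nu>)"
proof -
  have "emeasure \<mu> X = emeasure (density Ws.\<nu> J') (\<Phi>' -` X)"
    unfolding \<mu>_def by (subst emeasure_distr) auto
  also have "\<dots> = (\<integral>\<^sup>+q. J' q * indicator (\<Phi>' -` X) q \<partial>Ws.\<nu>)"
    using measurable_sets[OF measurable_Phi' assms] by (intro emeasure_density) auto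
  finally show ?thesis by (simp add: indicator_vimage)
qed

lemma emeasure_mu_blow_up:
  assumes X [measurable]: "X \<in> sets borel" and "r > 0"
  shows "emeasure \<mu> X =
    ennreal (r ^ Suc p) * (\<integral>\<^sup>+u. J' (sig q (dil r u)) * indicator X (\<Phi>' (sig q (dil r u))) \<partial>Ws.\<nu>)"
  unfolding emeasure_mu[OF X] sig_def
  by (rule nn_integral_sigma_tr_dil[symmetric, OF \<open>r > 0\<close>]) measurable

lemma AE_nu_W: "AE u in Ws.\<nu>. u \<in> W"
  unfolding Ws.\<nu>_def by (subst AE_density) (auto simp: indicator_def)

section \<open>Spherical factor of the tangent cone\<close>

lemma spherical_factor_Tan:
  assumes "q \<in> U"
  shows "spherical_factor d (Tan (\<Phi> ` U) (\<Phi> q)) =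
    (SUP z\<in>hcball d 0 1. ennreal (J q) * emeasure Ws.\<nu> (slice (DD q) z 1))"
  unfolding Tan_eq_tangent[OF assms] J_def by (rule spherical_factor_tangent[OF DD_carrier])

lemma spherical_factor_Tan_finite:
  assumes q: "q \<in> U"
  shows "spherical_factor d (Tan (\<Phi> ` U) (\<Phi> q)) < top"
proof -
  obtain C where C: "C > 0" "\<And>g. N g \<le> 2 \<Longrightarrow> N (PW g) \<le> C" using PW_bound by blast
  have sub: "slice (DD q) z 1 \<subseteq> {u. N u \<le> C}" if z: "z \<in> hcball d 0 1" for z
  proof
    fix u assume u: "u \<in> slice (DD q) z 1"
    have "N (Gr (DD q) u) \<le> 2"
      using z u dist_triangle[of "Gr (DD q) u" 0 z]
      by (simp add: slice_def hcball_def hnorm_def dist_commute)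
    then show "u \<in> {u. N u \<le> C}" using C(2)[of "Gr (DD q) u"] u by (simp add: slice_def PW_Gr)
  qed
  have cl: "closed {u. N u \<le> C}" by (intro closed_Collect_le continuous_intros)
  have fin: "emeasure Ws.\<nu> {u. N u \<le> C} < top"
    using cl bounded_hnorm_le by (intro Ws.emeasure_nu_bounded) auto
  have "spherical_factor d (Tan (\<Phi> ` U) (\<Phi> q)) \<le> ennreal (J q) * emeasure Ws.\<nu> {u. N u \<le> C}"
    unfolding spherical_factor_Tan[OF q] using sub cl
    by (intro SUP_least mult_left_mono emeasure_mono) auto
  also have "\<dots> < top" using fin by (simp add: ennreal_mult_less_top)
  finally show ?thesis .
qed

text \<open>A vanishing factor makes the slice about 0 of radius 1 null, and dilations make all
  larger slices null; together they exhaust W.\<close>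

lemma spherical_factor_Tan_eq_0D:
  assumes q: "q \<in> U" and zero: "spherical_factor d (Tan (\<Phi> ` U) (\<Phi> q)) = 0"
  shows "emeasure Ws.\<nu> UNIV = 0"
proof -
  have "ennreal (J q) * emeasure Ws.\<nu> (slice (DD q) 0 1) \<le> 0"
    unfolding zero[symmetric] spherical_factor_Tan[OF q]
    by (rule SUP_upper) (simp add: hcball_def)
  then have slice1: "emeasure Ws.\<nu> (slice (DD q) 0 1) = 0"
    using J_ge_1[of q] by simp
  have slice_n: "emeasure Ws.\<nu> (slice (DD q) 0 (real (Suc n))) = 0" for n
    using emeasure_slice_dil[of "real (Suc n)" "DD q" 0 1] slice1 by simp
  have "W = (\<Union>n. slice (DD q) 0 (real (Suc n)))"
  proof (intro equalityI subsetI)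
    fix u assume u: "u \<in> W"
    obtain n where "d 0 (Gr (DD q) u) \<le> real n" using real_arch_simple by blast
    then have "u \<in> slice (DD q) 0 (real (Suc n))" using u by (simp add: slice_def hcball_def)
    then show "u \<in> (\<Union>n. slice (DD q) 0 (real (Suc n)))" by blast
  qed (auto simp: slice_def)
  moreover have "emeasure Ws.\<nu> (\<Union>n. slice (DD q) 0 (real (Suc n))) = 0"
    by (intro emeasure_UN_eq_0 slice_n) auto
  ultimately have "emeasure Ws.\<nu> W = 0" by simp
  then show ?thesis
    by (simp add: Ws.emeasure_nu)
qed

text \<open>A ball that misses the surface has no mass. Otherwise the blow-up is done at a surface
  point q of the ball, with the differential at q0, and enlarging the slice from radius 1 to s
  absorbs the error.\<close>

lemma mu_density_upper:
  assumes q0: "q0 \<in> U" and "t > 0"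
    and less: "spherical_factor d (Tan (\<Phi> ` U) (\<Phi> q0)) < ennreal t"
  shows "\<exists>\<epsilon>>0. \<forall>y r. 0 < r \<and> r < \<epsilon> \<and> d (\<Phi> q0) y < \<epsilon> \<longrightarrow>
    emeasure \<mu> (hcball d y r) \<le> ennreal (t * r ^ Suc p)"
proof -
  define \<beta> where "\<beta> = spherical_factor d (Tan (\<Phi> ` U) (\<Phi> q0))"
  define D where "D = DD q0"
  obtain c where c: "\<beta> = ennreal c" "0 \<le> c" "c < t"
    using less \<open>t > 0\<close> by (cases \<beta>) (auto simp: \<beta>_def[symmetric] ennreal_less_iff)
  \<comment> \<open>One factor s pays for the oscillation of J, and \<open>s ^ Suc p\<close> for
    comparing the slice of radius s with a unit slice.\<close>
  obtain s where s: "s > 1" "s ^ Suc (Suc p) * c < t"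
    using exists_factor_gt_1[OF c(3,2)] by blast
  define \<eta> where "\<eta> = s - 1"
  have \<eta>: "\<eta> > 0" using s by (simp add: \<eta>_def)
  obtain C where C: "C > 0" "\<And>g. N g \<le> 2 \<Longrightarrow> N (PW g) \<le> C" using PW_bound by blast
  have "\<eta> / C > 0" using \<eta> C by simp
  then obtain \<delta> where \<delta>: "\<delta> > 0" "\<And>q. q \<in> U \<Longrightarrow> N (hinv q0 \<cdot> q) < \<delta> \<Longrightarrow> near D q (\<eta> / C) \<delta>"
    using uid_at_DD[OF q0] unfolding uid_at_def D_def by blast
  have "J q0 < s * J q0" using s J_ge_1[of q0] by simp
  then have "\<forall>\<^sub>F q in at q0 within U. J q < s * J q0"
    using continuous_on_J q0 by (intro order_tendstoD(2)) (auto simp: continuous_on_def)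
  then obtain \<rho> where \<rho>: "\<rho> > 0" "\<And>q. q \<in> U \<Longrightarrow> q \<noteq> q0 \<Longrightarrow> dist q q0 < \<rho> \<Longrightarrow> J q < s * J q0"
    unfolding eventually_at by blast
  have J_le: "J q \<le> s * J q0" if "q \<in> U" "dist q q0 < \<rho>" for q
    using \<rho>(2)[of q] that \<open>J q0 < s * J q0\<close> by (cases "q = q0") auto
  \<comment> \<open>Parameters for which both the blow-up estimate and the bound on J hold.
    \<open>PW\<close> recovers parameters from surface points, so closeness to
    \<open>\<Phi> q0\<close> puts them in T.\<close>
  define T where "T = {q. d q0 q < \<delta>} \<inter> ball q0 \<rho>"
  have "open T" unfolding T_def by (intro open_Int open_hball open_ball)
  moreover have "continuous_on UNIV PW" by (intro continuous_intros)
  ultimately have "open (PW -` T)" by (intro open_vimage)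
  moreover have "\<Phi> q0 \<in> PW -` T" using \<delta>(1) \<rho>(1) q0 by (simp add: T_def PW_Phi)
  ultimately obtain e where e: "e > 0" "hcball d (\<Phi> q0) e \<subseteq> PW -` T"
    using open_contains_hcball by blast
  have T: "q \<in> T" if "q \<in> U" "d (\<Phi> q0) (\<Phi> q) \<le> e" for q
    using e(2) that PW_Phi[OF that(1)] by (auto simp: hcball_def)
  \<comment> \<open>\<open>e / 2\<close> keeps the whole ball within e of \<open>\<Phi> q0\<close>;
    \<open>\<delta> / C\<close> gives \<open>r * C < \<delta>\<close>, the range in which
    \<open>near\<close> applies.\<close>
  define \<epsilon> where "\<epsilon> = min (e / 2) (\<delta> / C)"
  have "\<epsilon> > 0" using e(1) \<delta>(1) C(1) by (simp add: \<epsilon>_def)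
  moreover have "emeasure \<mu> (hcball d y r) \<le> ennreal (t * r ^ Suc p)"
    if yr: "0 < r" "r < \<epsilon>" "d (\<Phi> q0) y < \<epsilon>" for y r
  proof (cases "\<exists>q\<in>U. \<Phi> q \<in> hcball d y r")
    case False
    then have "emeasure \<mu> (hcball d y r) = (\<integral>\<^sup>+q. 0 \<partial>Ws.\<nu>)"
      unfolding emeasure_mu[OF hcball_borel]
      by (intro nn_integral_cong) (auto simp: J'_def \<Phi>'_def indicator_def)
    then show ?thesis by simp
  next
    case True
    then obtain q where q: "q \<in> U" "\<Phi> q \<in> hcball d y r" by blast
    have close: "q' \<in> T" if "q' \<in> U" "\<Phi> q' \<in> hcball d y r" for q'
      using that yr dist_triangle[of "\<Phi> q0" "\<Phi> q'" y] by (intro T) (auto simp: hcball_def \<epsilon>_def)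
    have near: "near D q (\<eta> / C) \<delta>"
      using close[OF q] by (intro \<delta>(2) q(1)) (simp add: T_def dist_eq_hnorm')
    \<comment> \<open>Seen from \<open>\<Phi> q\<close> and rescaled, the ball is the unit ball
      about z; z has norm at most 1 because \<open>\<Phi> q\<close> lies in the ball.\<close>
    define z where "z = dil (1 / r) (hinv (\<Phi> q) \<cdot> y)"
    have y: "y = \<Phi> q \<cdot> dil r z" using yr by (simp add: z_def dil_dil)
    have "r * N z = d y (\<Phi> q)"
      using yr(1) by (simp add: z_def hnorm_dil dist_eq_hnorm)
    also have "\<dots> \<le> r" using q(2) by (simp add: hcball_def)
    finally have Nz: "N z \<le> 1" using yr(1) by simp
    have r: "r * C < \<delta>" using yr(2) C(1) by (auto simp: \<epsilon>_def field_simps)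
    have in_slice: "u \<in> slice D z s" 
      if u: "u \<in> W" "sig q (dil r u) \<in> U" "\<Phi> (sig q (dil r u)) \<in> hcball d y r" for u
    proof -
      define g where "g = u \<cdot> ((1 / r) *\<^sub>R \<psi> q (dil r u))"
      have "\<Phi> q \<cdot> dil r g \<in> hcball d (\<Phi> q \<cdot> dil r z) r"
        using u(3) Phi_sig_dil[OF q(1) u(2) yr(1)] by (simp add: y g_def)
      then have "r * d z g \<le> r * 1"
        using yr(1) by (simp add: hcball_def dist_left_invariant dist_dil)
      then have zg: "d z g \<le> 1" using yr(1) by simp
      then have "N g \<le> 2"
        using Nz dist_triangle[of g 0 z] by (simp add: hnorm_def dist_commute)
      then have "N (PW g) \<le> C" by (rule C(2))
      moreover have "PW g = u"
        unfolding g_def by (intro PW_hmul u subspace_scale[OF subspace_V] psi_V q)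
      ultimately have "N u \<le> C" by simp
      then have "d g (Gr D u) \<le> \<eta>"
        unfolding g_def by (intro near_dil[OF q(1) near C(1) \<eta> yr(1) r u(1) _ u(2)])
      then have "d z (Gr D u) \<le> s"
        using zg dist_triangle[of z "Gr D u" g] by (simp add: \<eta>_def)
      then show ?thesis using u(1) by (simp add: slice_def hcball_def)
    qed
    have "(\<integral>\<^sup>+u. J' (sig q (dil r u)) * indicator (hcball d y r) (\<Phi>' (sig q (dil r u))) \<partial>Ws.\<nu>)
       \<le> (\<integral>\<^sup>+u. ennreal (s * J q0) * indicator (slice D z s) u \<partial>Ws.\<nu>)"
    proof (rule nn_integral_mono_AE, use AE_nu_W in eventually_elim)
      case (elim u)
      show ?case
      proof (cases "sig q (dil r u) \<in> U \<and> \<Phi> (sig q (dil r u)) \<in> hcball d y r")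
        case True
        then have "sig q (dil r u) \<in> T" by (intro close) auto
        then have "J (sig q (dil r u)) \<le> s * J q0"
          using True by (intro J_le) (auto simp: T_def Real_Vector_Spaces.dist_commute)
        then show ?thesis
          using True in_slice[OF elim] by (auto simp: J'_def \<Phi>'_def ennreal_leI)
      qed (auto simp: J'_def \<Phi>'_def indicator_def)
    qed
    also have "\<dots> = ennreal (s * J q0) * emeasure Ws.\<nu> (slice D z s)"
      by (intro nn_integral_cmult_indicator) simp
    \<comment> \<open>A slice of radius s is the dilate of a unit slice whose centre
      \<open>dil (1 / s) z\<close> still has norm at most 1.\<close>
    also have "slice D z s = slice D (dil s (dil (1 / s) z)) (s * 1)"
      using s by (simp add: dil_dil)
    also have "emeasure Ws.\<nu> \<dots> = ennreal (s ^ Suc p) * emeasure Ws.\<nu> (slice D (dil (1 / s) z) 1)"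
      using s by (intro emeasure_slice_dil) auto
    also have "ennreal (s * J q0) * \<dots> =
        ennreal (s ^ Suc (Suc p)) * (ennreal (J q0) * emeasure Ws.\<nu> (slice D (dil (1 / s) z) 1))"
      using s J_ge_1[of q0] by (simp add: ennreal_mult' mult_ac)
    also have "\<dots> \<le> ennreal (s ^ Suc (Suc p)) * \<beta>"
    proof (intro mult_left_mono)
      have "N (dil (1 / s) z) \<le> 1" using Nz s by (simp add: hnorm_dil)
      then have "dil (1 / s) z \<in> hcball d 0 1" by (simp add: hcball_def hnorm_def dist_commute)
      then show "ennreal (J q0) * emeasure Ws.\<nu> (slice D (dil (1 / s) z) 1) \<le> \<beta>"
        unfolding \<beta>_def spherical_factor_Tan[OF q0] D_def by (intro SUP_upper)
    qed simp
    also have "\<dots> = ennreal (s ^ Suc (Suc p) * c)"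
      using s c by (simp add: ennreal_mult' mult_ac)
    also have "\<dots> \<le> ennreal t" using s by (intro ennreal_leI) auto
    finally have "(\<integral>\<^sup>+u. J' (sig q (dil r u)) * indicator (hcball d y r) (\<Phi>' (sig q (dil r u))) \<partial>Ws.\<nu>) \<le> ennreal t" .
    then have "ennreal (r ^ Suc p) * (\<integral>\<^sup>+u. J' (sig q (dil r u)) * indicator (hcball d y r) (\<Phi>' (sig q (dil r u))) \<partial>Ws.\<nu>)
       \<le> ennreal (r ^ Suc p) * ennreal t"
      by (rule mult_left_mono) simp
    then show ?thesis
      using \<open>t > 0\<close> yr(1)
      by (subst emeasure_mu_blow_up[OF hcball_borel yr(1), of _ _ q]) (simp add: ennreal_mult'[symmetric] mult.commute)
  qed
  ultimately show ?thesis by blast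
qed

text \<open>One nearly optimal centre z suffices, and the blow-up is done at q0 itself. Radius
  \<open>r * s\<close> in place of r leaves room for the error, so the surface points over the whole
  unit slice lie in the ball.\<close>

lemma mu_density_lower:
  assumes q0: "q0 \<in> U" and "t > 0" and "\<epsilon> > 0"
    and less: "ennreal t < spherical_factor d (Tan (\<Phi> ` U) (\<Phi> q0))"
  shows "\<exists>y r. 0 < r \<and> r < \<epsilon> \<and> \<Phi> q0 \<in> hcball d y r \<and> ennreal (t * r ^ Suc p) \<le> emeasure \<mu> (hcball d y r)"
proof -
  define D where "D = DD q0"
  obtain z where z: "z \<in> hcball d 0 1" "ennreal t < ennreal (J q0) * emeasure Ws.\<nu> (slice D z 1)"
    using less unfolding spherical_factor_Tan[OF q0] less_SUP_iff D_def by blast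
  obtain a where a: "emeasure Ws.\<nu> (slice D z 1) = ennreal a" "a \<ge> 0"
    using emeasure_slice_finite[of D z 1] by (cases "emeasure Ws.\<nu> (slice D z 1)") auto
  have "t < J q0 * a"
    using z(2) a J_ge_1[of q0] \<open>t > 0\<close> by (simp add: ennreal_mult'[symmetric] ennreal_less_iff)
  \<comment> \<open>\<open>s ^ Suc p\<close> pays for the radius \<open>r * s\<close>, one more
    factor for the bound \<open>J q0 / s\<close> on nearby Jacobians.\<close>
  then obtain s where s: "s > 1" "s ^ Suc (Suc p) * t < J q0 * a"
    using exists_factor_gt_1[of t] \<open>t > 0\<close> by (metis less_imp_le)
  define \<eta> where "\<eta> = s - 1"
  have \<eta>: "\<eta> > 0" using s by (simp add: \<eta>_def)
  obtain C where C: "C > 0" "\<And>g. N g \<le> 2 \<Longrightarrow> N (PW g) \<le> C" using PW_bound by blast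
  have "\<eta> / C > 0" using \<eta> C by simp
  then obtain \<delta> where \<delta>: "\<delta> > 0" "near D q0 (\<eta> / C) \<delta>"
    using near_DD[OF q0] unfolding D_def by blast
  have "J q0 / s < J q0" using s J_ge_1[of q0] by (simp add: field_simps)
  then have "\<forall>\<^sub>F q in at q0 within U. J q0 / s < J q"
    using continuous_on_J q0 by (intro order_tendstoD(1)) (auto simp: continuous_on_def)
  then obtain \<rho> where \<rho>: "\<rho> > 0" "\<And>q. q \<in> U \<Longrightarrow> q \<noteq> q0 \<Longrightarrow> dist q q0 < \<rho> \<Longrightarrow> J q0 / s < J q"
    unfolding eventually_at by blast
  have J_ge: "J q0 / s \<le> J q" if "q \<in> U" "dist q q0 < \<rho>" for q
    using \<rho>(2)[of q] that \<open>J q0 / s < J q0\<close> by (cases "q = q0") auto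
  have "q0 \<in> ball q0 \<rho>" using \<rho>(1) by simp
  then obtain r0 where r0: "r0 > 0"
    "\<And>r u. 0 < r \<Longrightarrow> r < r0 \<Longrightarrow> u \<in> W \<Longrightarrow> N u \<le> C \<Longrightarrow> sig q0 (dil r u) \<in> U \<inter> ball q0 \<rho>"
    using sig_dil_in_U[OF q0 C(1) open_ball] by blast
  \<comment> \<open>The three bounds keep the parameters in U and near q0, keep \<open>r * C\<close>
    below \<delta>, and keep \<open>r * s\<close> below \<epsilon>.\<close>
  define r where "r = min (r0 / 2) (min (\<delta> / (2 * C)) (\<epsilon> / (2 * s)))"
  have r: "r > 0" "r < r0" using r0(1) \<delta>(1) C(1) \<open>\<epsilon> > 0\<close> s(1) by (auto simp: r_def)
  have "r \<le> \<delta> / (2 * C)" "r \<le> \<epsilon> / (2 * s)" by (simp_all add: r_def)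
  then have "r * C \<le> \<delta> / 2" "r * s \<le> \<epsilon> / 2" using C(1) s(1) by (simp_all add: field_simps)
  then have rC: "r * C < \<delta>" and rs: "r * s < \<epsilon>" using \<delta>(1) \<open>\<epsilon> > 0\<close> by auto
  define y where "y = \<Phi> q0 \<cdot> dil r z"
  have Nz: "N z \<le> 1" using z(1) by (simp add: hcball_def hnorm_def dist_commute)
  have "d y (\<Phi> q0) = r * N z"
    using dist_left_invariant[of "\<Phi> q0" "dil r z" 0] r(1) by (simp add: y_def hnorm_def[symmetric] hnorm_dil)
  also have "\<dots> \<le> r * s" using Nz s r by (intro mult_left_mono) auto
  finally have mem: "\<Phi> q0 \<in> hcball d y (r * s)" by (simp add: hcball_def)
  have lower: "J q0 / s \<le> J (sig q0 (dil r u)) \<and> sig q0 (dil r u) \<in> U \<and> \<Phi> (sig q0 (dil r u)) \<in> hcball d y (r * s)"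
    if u: "u \<in> slice D z 1" for u
  proof -
    have uW: "u \<in> W" and zu: "d z (Gr D u) \<le> 1" using u by (auto simp: slice_def hcball_def)
    have "N (Gr D u) \<le> 2"
      using zu Nz dist_triangle[of "Gr D u" 0 z] by (simp add: hnorm_def dist_commute)
    then have uC: "N u \<le> C" using C(2)[of "Gr D u"] by (simp add: PW_Gr uW)
    have sU: "sig q0 (dil r u) \<in> U" "dist (sig q0 (dil r u)) q0 < \<rho>"
      using r0(2)[OF r uW uC] by (auto simp: Real_Vector_Spaces.dist_commute)
    define g where "g = u \<cdot> ((1 / r) *\<^sub>R \<psi> q0 (dil r u))"
    have "d g (Gr D u) \<le> \<eta>"
      unfolding g_def by (rule near_dil[OF q0 \<delta>(2) C(1) \<eta> r(1) rC uW uC sU(1)])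
    then have "d z g \<le> s"
      using zu dist_triangle[of z g "Gr D u"] dist_commute[of g "Gr D u"] by (simp add: \<eta>_def)
    then have "d y (\<Phi> (sig q0 (dil r u))) \<le> r * s"
      using r(1) by (simp add: y_def Phi_sig_dil[OF q0 sU(1) r(1)] g_def[symmetric] dist_left_invariant dist_dil)
    then show ?thesis using J_ge[OF sU] sU(1) by (simp add: hcball_def)
  qed
  have "ennreal (s ^ Suc p * t) \<le> ennreal (J q0 / s * a)"
  proof (rule ennreal_leI)
    have "s * (s ^ Suc p * t) \<le> J q0 * a" using s(2) by (simp add: mult_ac)
    then show "s ^ Suc p * t \<le> J q0 / s * a" using s(1) by (simp add: field_simps)
  qed
  also have "\<dots> = ennreal (J q0 / s) * emeasure Ws.\<nu> (slice D z 1)"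
    unfolding a(1) using J_ge_1[of q0] s by (intro ennreal_mult') simp
  also have "\<dots> = (\<integral>\<^sup>+u. ennreal (J q0 / s) * indicator (slice D z 1) u \<partial>Ws.\<nu>)"
    by (intro nn_integral_cmult_indicator[symmetric]) simp
  also have "\<dots> \<le> (\<integral>\<^sup>+u. J' (sig q0 (dil r u)) * indicator (hcball d y (r * s)) (\<Phi>' (sig q0 (dil r u))) \<partial>Ws.\<nu>)"
  proof (rule nn_integral_mono)
    fix u
    show "ennreal (J q0 / s) * indicator (slice D z 1) u \<le>
       J' (sig q0 (dil r u)) * indicator (hcball d y (r * s)) (\<Phi>' (sig q0 (dil r u)))"
      using lower[of u] by (cases "u \<in> slice D z 1") (auto simp: J'_def \<Phi>'_def ennreal_leI)
  qed
  finally have "ennreal (r ^ Suc p) * ennreal (s ^ Suc p * t) \<le> emeasure \<mu> (hcball d y (r * s))"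
    unfolding emeasure_mu_blow_up[OF hcball_borel r(1), of y "r * s" q0] by (rule mult_left_mono) simp
  moreover have "ennreal (r ^ Suc p) * ennreal (s ^ Suc p * t) = ennreal (t * (r * s) ^ Suc p)"
    using r(1) by (simp add: ennreal_mult'[symmetric] power_mult_distrib mult_ac)
  ultimately show ?thesis
    using rs r(1) s(1) mem by (intro exI[of _ y] exI[of _ "r * s"]) auto
qed

theorem area_formula:
  assumes B: "B \<in> sets borel" "B \<subseteq> \<Phi> ` U"
  shows "(\<integral>\<^sup>+ q \<in> {q \<in> U. \<Phi> q \<in> B}. ennreal (J q) \<partial>hausdorff_measure_E p)
     = (\<integral>\<^sup>+ x \<in> B. spherical_factor d (Tan (\<Phi> ` U) x) \<partial>spherical_measure d (Suc p))"
proof -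
  have "(\<integral>\<^sup>+ q \<in> {q \<in> U. \<Phi> q \<in> B}. ennreal (J q) \<partial>hausdorff_measure_E p) =
     (\<integral>\<^sup>+ q \<in> W. J' q * indicator B (\<Phi>' q) \<partial>hausdorff_measure_E p)"
    using U_sub by (intro nn_integral_cong) (auto simp: J'_def \<Phi>'_def indicator_def)
  also have "\<dots> = emeasure \<mu> B"
    unfolding emeasure_mu[OF B(1)] using B(1)
    by (intro Ws.nn_integral_nu[symmetric] borel_measurable_times measurable_J'
        measurable_compose[OF measurable_Phi' borel_measurable_indicator]) auto
  also have "\<dots> = (\<integral>\<^sup>+ x \<in> B. spherical_factor d (Tan (\<Phi> ` U) x) \<partial>spherical_measure d (Suc p))"
  \<comment> \<open>The density theorem needs a positive density. If the measure on W vanishes,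
    \<mu> and all spherical factors are 0; otherwise \<open>spherical_factor_Tan_eq_0D\<close> gives
    positivity.\<close>
  proof (cases "emeasure Ws.\<nu> UNIV = 0")
    case True
    have null: "emeasure Ws.\<nu> X = 0" if "X \<in> sets borel" for X
      using True that emeasure_mono[of X UNIV Ws.\<nu>] by simp
    then have "UNIV \<in> null_sets Ws.\<nu>" by (simp add: null_sets_def)
    then have "emeasure \<mu> B = (\<integral>\<^sup>+q. 0 \<partial>Ws.\<nu>)"
      unfolding emeasure_mu[OF B(1)] by (intro nn_integral_cong_AE AE_I'[of UNIV]) auto
    then have "emeasure \<mu> B = 0" by simp
    have "spherical_factor d (Tan (\<Phi> ` U) x) = 0" if x: "x \<in> B" for x
    proof -
      obtain q where "q \<in> U" "x = \<Phi> q" using x B(2) by blast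
      then show ?thesis by (simp add: spherical_factor_Tan null SUP_constant bot_ennreal)
    qed
    then have "(\<integral>\<^sup>+ x \<in> B. spherical_factor d (Tan (\<Phi> ` U) x) \<partial>spherical_measure d (Suc p)) =
       (\<integral>\<^sup>+ x. 0 \<partial>spherical_measure d (Suc p))"
      by (intro nn_integral_cong) (auto simp: indicator_def)
    then show ?thesis using \<open>emeasure \<mu> B = 0\<close> by simp
  next
    case False
    show ?thesis
    proof (rule measure_eq_integral_spherical_density[OF sets_mu B(1)])
      fix x assume "x \<in> B"
      then obtain q where q: "q \<in> U" "x = \<Phi> q" using B(2) by blast
      show "0 < spherical_factor d (Tan (\<Phi> ` U) x)"
        using spherical_factor_Tan_eq_0D[OF q(1)] False q(2) by (auto simp: zero_less_iff_neq_zero)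
      show "spherical_factor d (Tan (\<Phi> ` U) x) < top"
        using spherical_factor_Tan_finite[OF q(1)] q(2) by simp
      show "\<exists>\<epsilon>>0. \<forall>y r. 0 < r \<and> r < \<epsilon> \<and> d x y < \<epsilon> \<longrightarrow> emeasure \<mu> (hcball d y r) \<le> ennreal (t * r ^ Suc p)"
        if "t > 0" "spherical_factor d (Tan (\<Phi> ` U) x) < ennreal t" for t
        using mu_density_upper[OF q(1) that(1)] that(2) q(2) by simp
      show "\<exists>y r. 0 < r \<and> r < \<epsilon> \<and> x \<in> hcball d y r \<and> ennreal (t * r ^ Suc p) \<le> emeasure \<mu> (hcball d y r)"
        if "t > 0" "ennreal t < spherical_factor d (Tan (\<Phi> ` U) x)" "\<epsilon> > 0" for t \<epsilon>
        using mu_density_lower[OF q(1) that(1,3)] that(2) q(2) by simp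
    qed
  qed
  finally show ?thesis .
qed

end

theorem theorem1p2:
  fixes d :: "'n::finite heis \<Rightarrow> 'n heis \<Rightarrow> real"
    and k :: nat
    and W V U \<Sigma> B :: "'n heis set"
    and \<phi> :: "'n heis \<Rightarrow> 'n heis"
    and v w :: "nat \<Rightarrow> 'n heis"
  assumes k: "1 \<le> k" "k \<le> CARD('n)"
    and d: "homogeneous_distance d"
    and WV: "semidirect W V" "dim V = k"
    and surface: "parametrized_H_regular_surface d k W V U \<phi> \<Sigma>"
    and orth: "\<forall>a\<in>W. \<forall>b\<in>V. inner a b = 0"
    and basis: "adapted_basis k W V v w"
    and B: "B \<in> sets borel" "B \<subseteq> \<Sigma>"
  shows "(\<integral>\<^sup>+ p \<in> {p \<in> U. graph_map \<phi> p \<in> B}.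
             ennreal (intrinsic_jacobian d k W V v w \<phi> p) \<partial>hausdorff_measure_E (2 * CARD('n) + 1 - k))
         = (\<integral>\<^sup>+ x \<in> B. spherical_factor d (Tan \<Sigma> x) \<partial>spherical_measure d (2 * CARD('n) + 2 - k))"
proof -
  interpret intrinsic_graph d k W V v w "2 * CARD('n) - k" "2 * CARD('n) + 1 - k" U \<phi>
    using assms by unfold_locales (auto simp: parametrized_H_regular_surface_def)
  have "\<Sigma> = graph_map \<phi> ` U" using surface by (simp add: parametrized_H_regular_surface_def)
  then show ?thesis
    using area_formula[of B] B by (simp only: intrinsic_jacobian_eq dims)
qed

end
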